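(* Every finite solvable group is isomorphic to a subgroup of some generalized strongly monomial group.
   Context: All groups are finite and all characters are complex characters. $\mathrm{Irr}(G)$ is the set of irreducible complex characters of $G$. For $\chi\in\mathrm{Irr}(G)$ put $e(\chi)=\frac{\chi(1)}{|G|}\sum_{g\in G}\chi(g)g^{-1}\in\mathbb{C}G$ and $e_{\mathbb{Q}}(\chi)=\sum_{\sigma\in\mathrm{Gal}(\mathbb{Q}(\chi)/\mathbb{Q})}e(\sigma\circ\chi)\in\mathbb{Q}G$, where $\mathbb{Q}(\chi)$ is the field generated over $\mathbb{Q}$ by the values of $\chi$. Conjugation is $\alpha^{g}=g^{-1}\alpha g$; $\mathrm{Cen}_G(\alpha)=\{g\in G:\alpha^g=\alpha\}$; two elements $\alpha,\beta$ are mutually orthogonal if $\alpha\beta=\beta\alpha=0$; $\lambda^{H}$ denotes the character of $H$ induced by $\lambda$. A Shoda pair $(H,K)$ of $G$ is a pair of subgroups with $K\unlhd H$, $H/K$ cyclic, and such that if $g\in G$ and $[H,g]\cap H\subseteq K$ then $g\in H$, where $[H,g]$ is the set of commutators $h^{-1}g^{-1}hg$, $h\in H$ (equivalently, linear characters of $H$ with kernel $K$ induce irreducibly to $G$). If $(H,K)$ is a Shoda pair of $G$ and $\lambda$ is a linear character of $H$ with kernel $K$, then $(H,K)$ is a generalized strong Shoda pair of $G$ if there is a chain of subgroups $H=H_0\leq H_1\leq\cdots\leq H_n=G$ (a strong inductive chain from $H$ to $G$) such that for all $0\leq i\leq n-1$: (i) $H_i\unlhd\mathrm{Cen}_{H_{i+1}}(e_{\mathbb{Q}}(\lambda^{H_i}))$;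 (ii) the distinct $H_{i+1}$-conjugates of $e_{\mathbb{Q}}(\lambda^{H_i})$ are mutually orthogonal. A character $\chi\in\mathrm{Irr}(G)$ is generalized strongly monomial if $\chi=\lambda^G$ for a linear character $\lambda$ of some subgroup $H$ with kernel $K$ such that $(H,K)$ is a generalized strong Shoda pair of $G$. A group is generalized strongly monomial if each of its irreducible complex characters is generalized strongly monomial. *)

theory Defs
  imports
    "Jordan_Normal_Form.VS_Connect"
    "HOL-Algebra.Elementary_Groups"
    "HOL-Algebra.Solvable_Groups"
    "HOL-Algebra.Generated_Fields"
    "HOL-Algebra.Algebraic_Closure_Type"
begin

section \<open>Complex characters of finite groups\<close>

abbreviation subgrp :: "('a, 'b) monoid_scheme \<Rightarrow> 'a set \<Rightarrow> ('a, 'b) monoid_scheme" where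
  "subgrp G H \<equiv> G\<lparr>carrier := H\<rparr>"

definition mat_trace :: "'a::comm_monoid_add mat \<Rightarrow> 'a" where
  "mat_trace A = (\<Sum>i<dim_row A. A $$ (i, i))"

definition representation ::
    "('a, 'b) monoid_scheme \<Rightarrow> nat \<Rightarrow> ('a \<Rightarrow> complex mat) \<Rightarrow> bool" where
  "representation G n \<rho> \<longleftrightarrow> \<rho> \<in> hom G (units_of (ring_mat TYPE(complex) n ()))"

definition irreducible_representation ::
    "('a, 'b) monoid_scheme \<Rightarrow> nat \<Rightarrow> ('a \<Rightarrow> complex mat) \<Rightarrow> bool" where
  "irreducible_representation G n \<rho> \<longleftrightarrow>
     representation G n \<rho> \<and> n > 0 \<and>
     (\<forall>W. VectorSpace.subspace class_ring W (module_vec TYPE(complex) n) \<and>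
          (\<forall>g\<in>carrier G. \<forall>w\<in>W. \<rho> g *\<^sub>v w \<in> W)
          \<longrightarrow> W = {0\<^sub>v n} \<or> W = carrier_vec n)"

text \<open>Characters are functions on the carrier, made total by \<^const>\<open>restrict\<close>, so that equality of
  characters is equality of functions.\<close>

definition irr :: "('a, 'b) monoid_scheme \<Rightarrow> ('a \<Rightarrow> complex) set" where
  "irr G = {\<chi>. \<exists>n \<rho>. irreducible_representation G n \<rho> \<and>
                      \<chi> = (\<lambda>g\<in>carrier G. mat_trace (\<rho> g))}"

definition linear_character :: "('a, 'b) monoid_scheme \<Rightarrow> ('a \<Rightarrow> complex) \<Rightarrow> bool" where
  "linear_character G \<psi> \<longleftrightarrow> \<psi> \<in> irr G \<and> \<psi> \<one>\<^bsub>G\<^esub> = 1"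

definition char_kernel :: "('a, 'b) monoid_scheme \<Rightarrow> ('a \<Rightarrow> complex) \<Rightarrow> 'a set" where
  "char_kernel G \<chi> = {g \<in> carrier G. \<chi> g = \<chi> \<one>\<^bsub>G\<^esub>}"

definition induced ::
    "('a, 'b) monoid_scheme \<Rightarrow> 'a set \<Rightarrow> ('a \<Rightarrow> complex) \<Rightarrow> 'a \<Rightarrow> complex" where
  "induced G H \<psi> = (\<lambda>g\<in>carrier G.
     (\<Sum>x\<in>carrier G. if inv\<^bsub>G\<^esub> x \<otimes>\<^bsub>G\<^esub> g \<otimes>\<^bsub>G\<^esub> x \<in> H then \<psi> (inv\<^bsub>G\<^esub> x \<otimes>\<^bsub>G\<^esub> g \<otimes>\<^bsub>G\<^esub> x) else 0)
     / of_nat (card H))"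


section \<open>The complex group algebra\<close>

text \<open>An element of the group algebra of \<open>G\<close> is its coefficient function, which is \<open>0\<close> outside
  \<^term>\<open>carrier G\<close>. Hence the group algebra of a subgroup is literally a subset of that of the whole
  group.\<close>

definition ga_of :: "'a \<Rightarrow> 'a \<Rightarrow> complex" where
  "ga_of g = (\<lambda>x. if x = g then 1 else 0)"

definition ga_mult ::
    "('a, 'b) monoid_scheme \<Rightarrow> ('a \<Rightarrow> complex) \<Rightarrow> ('a \<Rightarrow> complex) \<Rightarrow> 'a \<Rightarrow> complex" where
  "ga_mult G \<alpha> \<beta> =
     (\<lambda>x. \<Sum>g\<in>carrier G. \<Sum>h\<in>carrier G. \<alpha> g * \<beta> h * ga_of (g \<otimes>\<^bsub>G\<^esub> h) x)"

definition ga_conj ::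
    "('a, 'b) monoid_scheme \<Rightarrow> ('a \<Rightarrow> complex) \<Rightarrow> 'a \<Rightarrow> 'a \<Rightarrow> complex" where
  "ga_conj G \<alpha> g = ga_mult G (ga_mult G (ga_of (inv\<^bsub>G\<^esub> g)) \<alpha>) (ga_of g)"

definition ga_cen :: "('a, 'b) monoid_scheme \<Rightarrow> ('a \<Rightarrow> complex) \<Rightarrow> 'a set" where
  "ga_cen G \<alpha> = {g \<in> carrier G. ga_conj G \<alpha> g = \<alpha>}"

definition ga_orthogonal ::
    "('a, 'b) monoid_scheme \<Rightarrow> ('a \<Rightarrow> complex) \<Rightarrow> ('a \<Rightarrow> complex) \<Rightarrow> bool" where
  "ga_orthogonal G \<alpha> \<beta> \<longleftrightarrow> ga_mult G \<alpha> \<beta> = (\<lambda>_. 0) \<and> ga_mult G \<beta> \<alpha> = (\<lambda>_. 0)"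

definition e_char :: "('a, 'b) monoid_scheme \<Rightarrow> ('a \<Rightarrow> complex) \<Rightarrow> 'a \<Rightarrow> complex" where
  "e_char G \<chi> = (\<lambda>x. \<chi> \<one>\<^bsub>G\<^esub> / of_nat (Coset.order G) * (\<Sum>g\<in>carrier G. \<chi> g * ga_of (inv\<^bsub>G\<^esub> g) x))"

definition char_field :: "('a, 'b) monoid_scheme \<Rightarrow> ('a \<Rightarrow> complex) \<Rightarrow> complex set" where
  "char_field G \<chi> = generate_field (ring_of_type_algebra :: complex ring) (\<chi> ` carrier G)"

text \<open>Automorphisms of a subfield \<open>K\<close> of the complex numbers are taken in \<^term>\<open>extensional K\<close>, so
  that each is counted once.\<close>

definition galois_group_Rats :: "complex set \<Rightarrow> (complex \<Rightarrow> complex) set" where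
  "galois_group_Rats K =
     {\<sigma> \<in> extensional K.
        \<sigma> \<in> ring_iso ((ring_of_type_algebra :: complex ring)\<lparr>carrier := K\<rparr>)
                     ((ring_of_type_algebra :: complex ring)\<lparr>carrier := K\<rparr>) \<and>
        (\<forall>q\<in>\<rat>. \<sigma> q = q)}"

definition e_rat :: "('a, 'b) monoid_scheme \<Rightarrow> ('a \<Rightarrow> complex) \<Rightarrow> 'a \<Rightarrow> complex" where
  "e_rat G \<chi> = (\<lambda>x. \<Sum>\<sigma>\<in>galois_group_Rats (char_field G \<chi>). e_char G (\<sigma> \<circ> \<chi>) x)"


section \<open>Generalized strongly monomial groups\<close>

definition shoda_pair :: "('a, 'b) monoid_scheme \<Rightarrow> 'a set \<Rightarrow> 'a set \<Rightarrow> bool" where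
  "shoda_pair G H K \<longleftrightarrow>
     subgroup H G \<and> K \<lhd> subgrp G H \<and> cyclic_group (subgrp G H Mod K) \<and>
     (\<forall>g\<in>carrier G.
        {inv\<^bsub>G\<^esub> h \<otimes>\<^bsub>G\<^esub> inv\<^bsub>G\<^esub> g \<otimes>\<^bsub>G\<^esub> h \<otimes>\<^bsub>G\<^esub> g | h. h \<in> H} \<inter> H \<subseteq> K \<longrightarrow> g \<in> H)"

definition strong_inductive_chain ::
    "('a, 'b) monoid_scheme \<Rightarrow> 'a set \<Rightarrow> ('a \<Rightarrow> complex) \<Rightarrow> nat \<Rightarrow> (nat \<Rightarrow> 'a set) \<Rightarrow> bool" where
  "strong_inductive_chain G H \<psi> n C \<longleftrightarrow>
     C 0 = H \<and> C n = carrier G \<and> (\<forall>i\<le>n. subgroup (C i) G) \<and>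
     (\<forall>i<n. C i \<subseteq> C (Suc i) \<and>
        (let L = subgrp G (C (Suc i));
             e = e_rat (subgrp G (C i)) (induced (subgrp G (C i)) H \<psi>)
         in C i \<lhd> subgrp G (ga_cen L e) \<and>
            (\<forall>g\<in>C (Suc i). \<forall>h\<in>C (Suc i).
               ga_conj L e g \<noteq> ga_conj L e h \<longrightarrow>
               ga_orthogonal L (ga_conj L e g) (ga_conj L e h))))"

text \<open>The choice of \<open>\<psi>\<close> below is immaterial: linear characters of \<open>H\<close> with the same kernel are
  Galois conjugate, hence so are the characters they induce, and \<^const>\<open>e_rat\<close> is invariant under
  Galois conjugation.\<close>

definition gen_strong_shoda_pair :: "('a, 'b) monoid_scheme \<Rightarrow> 'a set \<Rightarrow> 'a set \<Rightarrow> bool" where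
  "gen_strong_shoda_pair G H K \<longleftrightarrow>
     shoda_pair G H K \<and>
     (\<exists>\<psi>. linear_character (subgrp G H) \<psi> \<and> char_kernel (subgrp G H) \<psi> = K \<and>
          (\<exists>n C. strong_inductive_chain G H \<psi> n C))"

definition gen_strongly_monomial_char ::
    "('a, 'b) monoid_scheme \<Rightarrow> ('a \<Rightarrow> complex) \<Rightarrow> bool" where
  "gen_strongly_monomial_char G \<chi> \<longleftrightarrow>
     \<chi> \<in> irr G \<and>
     (\<exists>H \<psi>. subgroup H G \<and> linear_character (subgrp G H) \<psi> \<and> \<chi> = induced G H \<psi> \<and>
            gen_strong_shoda_pair G H (char_kernel (subgrp G H) \<psi>))"

definition gen_strongly_monomial_group :: "('a, 'b) monoid_scheme \<Rightarrow> bool" where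
  "gen_strongly_monomial_group G \<longleftrightarrow>
     group G \<and> finite (carrier G) \<and> (\<forall>\<chi>\<in>irr G. gen_strongly_monomial_char G \<chi>)"

end

theory Submission
  imports Defs "HOL-Library.Function_Algebras" "Jordan_Normal_Form.Spectral_Radius"
begin

text \<open>
  Let \<open>G = N 0 \<ge> N 1 \<ge> \<dots> \<ge> N k = 1\<close> be the derived series of \<open>G\<close>. The group \<open>G\<close> acts by left
  multiplication on its underlying set, and every such map lies in the group \<open>M\<close> of all permutations
  \<open>\<pi>\<close> with \<open>\<pi> (x n) \<in> \<pi> x n N (i+1)\<close> for \<open>n \<in> N i\<close>: this is an iterated wreath product of the
  abelian factors \<open>N i / N (i+1)\<close>. Let \<open>K j\<close> be the subgroup of \<open>M\<close> acting trivially on \<open>G / N j\<close>.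
  A subgroup \<open>T\<close> of \<open>M\<close> is ``orbit closed'' at level \<open>j\<close> if every element of \<open>M\<close> that preserves the
  \<open>T\<close>-orbits on \<open>G / N j\<close> agrees there with an element of \<open>T\<close>. Let \<open>\<chi>\<close> be an irreducible character of
  such a \<open>T\<close>, trivial on \<open>K (j+1) \<inter> T\<close>. Modulo this kernel \<open>A = K j \<inter> T\<close> is abelian and normal in
  \<open>T\<close>, so \<open>\<chi>\<close> lies over a linear character \<open>\<nu>\<close> of \<open>A\<close>. The stabilizer \<open>S\<close> of \<open>\<nu>\<close> is orbit closed at
  level \<open>j\<close>, and \<open>\<nu>\<close> extends to \<open>S\<close> because \<open>A\<close> has a complement, the stabilizer of a system of base
  points. Hence \<open>\<chi>\<close> is induced from the product of the extension and a character of \<open>S\<close> trivial on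
  \<open>K j \<inter> S\<close>, and one descends to level \<open>0\<close>, where the character is trivial.

  So every irreducible character of \<open>M\<close> is obtained from a linear character \<open>\<lambda>\<close> by successive Clifford
  correspondences over restrictions of \<open>\<lambda>\<close> to normal subgroups. Such a chain of inertia groups is a
  strong inductive chain: if \<open>T\<close> is the stabilizer in \<open>B\<close> of a linear character \<open>\<nu>\<close> of \<open>N \<lhd> B\<close> and
  \<open>b \<in> B\<close>, then either \<open>b\<close> sends \<open>\<nu>\<close> to a Galois conjugate of \<open>\<nu>\<close>, and then it normalizes \<open>T\<close>, or the
  idempotent and its conjugate by \<open>b\<close> are orthogonal.

  The irreducible characters of the subgroups enter only through the identities of spherical
  functions. These are polynomial with rational coefficients, so that Galois conjugates satisfy them
  as well, without any extension of field automorphisms.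
\<close>

section \<open>Spherical functions\<close>

text \<open>Restricting a character, decomposing it and inducing back would call for modules and
  complete reducibility. Here everything is done with functions: the part of \<open>\<chi>\<close>
  over \<open>\<nu>\<close> is the average \<open>eigen_avg\<close>, and averaging one identity
  yields both the Clifford correspondent and the induction formula. Schur's lemma enters only to
  show that irreducible characters satisfy this identity.

  The obstacle in the descent is that an arbitrary subgroup of an iterated wreath product need not
  offer a complement to extend along. Orbit closure is strong enough to produce complements and weak
  enough to pass to stabilizers. Both facts rest on gluing: elements of \<open>M\<close> chosen
  separately on the cosets of \<open>N j\<close> combine to one element as soon as together they
  induce on \<open>G / N j\<close> the permutation of some element of \<open>M\<close>. This is why
  \<open>M\<close> contains all triangular permutations and not just a subgroup around
  \<open>G\<close>.

  Extending \<open>\<nu>\<close> serves to divide it out, so that the correspondent becomes trivial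
  one level earlier; multiplying it back is harmless because a linear character of the larger group
  changes no stabilizer below.\<close>

locale fin_group = group G for G (structure) +
  assumes fin [simp]: "finite (carrier G)"
begin

lemma subgroup_fin_group:
  assumes "subgroup H G" shows "fin_group (subgrp G H)"
proof -
  interpret H: group "subgrp G H" using assms by (rule subgroup.subgroup_is_group) (rule is_group)
  show ?thesis
    by unfold_locales (use assms fin in \<open>simp add: finite_subset[OF subgroup.subset]\<close>)
qed

lemma card_pos: "card (carrier G) > 0"
  using fin one_closed card_gt_0_iff by blast

lemma sum_inv: "(\<Sum>x\<in>carrier G. f (inv x)) = (\<Sum>x\<in>carrier G. f x)"
  by (rule sum.reindex_bij_witness[where i="\<lambda>x. inv x" and j="\<lambda>x. inv x"]) auto

lemma sum_mult_left:
  assumes "a \<in> carrier G"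
  shows "(\<Sum>x\<in>carrier G. f (a \<otimes> x)) = (\<Sum>x\<in>carrier G. f x)"
  by (rule sum.reindex_bij_witness[where i="\<lambda>x. inv a \<otimes> x" and j="\<lambda>x. a \<otimes> x"])
     (use assms in \<open>auto simp: m_assoc[symmetric]\<close>)

lemma sum_mult_right:
  assumes "a \<in> carrier G"
  shows "(\<Sum>x\<in>carrier G. f (x \<otimes> a)) = (\<Sum>x\<in>carrier G. f x)"
  by (rule sum.reindex_bij_witness[where i="\<lambda>x. x \<otimes> inv a" and j="\<lambda>x. x \<otimes> a"])
     (use assms in \<open>auto simp: m_assoc\<close>)

lemma sum_conj:
  assumes "a \<in> carrier G"
  shows "(\<Sum>x\<in>carrier G. f (inv a \<otimes> x \<otimes> a)) = (\<Sum>x\<in>carrier G. f x)"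
proof -
  have "(\<Sum>x\<in>carrier G. f (inv a \<otimes> x \<otimes> a)) = (\<Sum>x\<in>carrier G. f (inv a \<otimes> (x \<otimes> a)))"
    using assms by (intro sum.cong) (auto simp: m_assoc)
  also have "\<dots> = (\<Sum>x\<in>carrier G. f (inv a \<otimes> x))"
    by (rule sum_mult_right) fact
  also have "\<dots> = (\<Sum>x\<in>carrier G. f x)"
    using assms by (intro sum_mult_left) auto
  finally show ?thesis .
qed

end

text \<open>Nothing is required outside the carrier, so one function serves a group and all its
  subgroups. Only at the end is it cut down by \<open>restrict\<close>, to become a member of
  \<open>irr\<close>.\<close>

definition lin_hom :: "('a, 'b) monoid_scheme \<Rightarrow> ('a \<Rightarrow> complex) \<Rightarrow> bool" where
  "lin_hom G \<mu> \<longleftrightarrow> \<mu> \<one>\<^bsub>G\<^esub> = 1 \<and> (\<forall>x\<in>carrier G. \<forall>y\<in>carrier G. \<mu> (x \<otimes>\<^bsub>G\<^esub> y) = \<mu> x * \<mu> y)"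

text \<open>These are exactly the irreducible characters: the last condition says that
  \<open>\<chi> / \<chi>(1)\<close> extends to a homomorphism from the center of the group algebra to the complex numbers,
  and the norm condition together with positivity fixes the degree.\<close>

definition spherical :: "('a, 'b) monoid_scheme \<Rightarrow> ('a \<Rightarrow> complex) \<Rightarrow> bool" where
  "spherical G \<chi> \<longleftrightarrow>
     \<chi> \<one>\<^bsub>G\<^esub> \<in> \<rat> \<and> Re (\<chi> \<one>\<^bsub>G\<^esub>) > 0 \<and>
     (\<Sum>g\<in>carrier G. \<chi> g * \<chi> (inv\<^bsub>G\<^esub> g)) = of_nat (card (carrier G)) \<and>
     (\<forall>g\<in>carrier G. \<forall>h\<in>carrier G.
        \<chi> g * \<chi> h * of_nat (card (carrier G)) =
        \<chi> \<one>\<^bsub>G\<^esub> * (\<Sum>x\<in>carrier G. \<chi> (g \<otimes>\<^bsub>G\<^esub> (inv\<^bsub>G\<^esub> x \<otimes>\<^bsub>G\<^esub> h \<otimes>\<^bsub>G\<^esub> x))))"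

lemma spherical_one_neq_0: "spherical G \<chi> \<Longrightarrow> \<chi> \<one>\<^bsub>G\<^esub> \<noteq> 0"
  by (auto simp: spherical_def)

context fin_group
begin

lemma lin_hom_inv:
  assumes "lin_hom G \<mu>" "x \<in> carrier G"
  shows "\<mu> (inv x) = inverse (\<mu> x)" "\<mu> x \<noteq> 0"
proof -
  have "\<mu> (inv x) * \<mu> x = 1"
    using assms unfolding lin_hom_def by (metis inv_closed l_inv)
  then show "\<mu> (inv x) = inverse (\<mu> x)" "\<mu> x \<noteq> 0"
    by (auto intro: inverse_unique[symmetric] simp: mult.commute)
qed

lemma lin_hom_conj:
  assumes "lin_hom G \<mu>" "x \<in> carrier G" "y \<in> carrier G"
  shows "\<mu> (inv x \<otimes> y \<otimes> x) = \<mu> y"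
  using assms lin_hom_inv[OF assms(1,2)] by (simp add: lin_hom_def)

text \<open>For \<open>g = \<one>\<close> the identity says that \<open>\<chi> h\<close> is the mean
  of \<open>\<chi>\<close> over the conjugates of \<open>h\<close>, and such a mean is a class
  function.\<close>

lemma spherical_class_fun:
  assumes \<chi>: "spherical G \<chi>" and "g \<in> carrier G" "y \<in> carrier G"
  shows "\<chi> (inv y \<otimes> g \<otimes> y) = \<chi> g"
proof -
  have *: "\<chi> h * of_nat (card (carrier G)) = (\<Sum>x\<in>carrier G. \<chi> (inv x \<otimes> h \<otimes> x))"
    if "h \<in> carrier G" for h
  proof -
    have "\<chi> \<one> * (\<chi> h * of_nat (card (carrier G)))
        = \<chi> \<one> * (\<Sum>x\<in>carrier G. \<chi> (\<one> \<otimes> (inv x \<otimes> h \<otimes> x)))"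
      using \<chi> that by (simp add: spherical_def mult.assoc)
    also have "(\<Sum>x\<in>carrier G. \<chi> (\<one> \<otimes> (inv x \<otimes> h \<otimes> x))) = (\<Sum>x\<in>carrier G. \<chi> (inv x \<otimes> h \<otimes> x))"
      using that by (intro sum.cong) auto
    finally show ?thesis using spherical_one_neq_0[OF \<chi>] by simp
  qed
  have "\<chi> (inv y \<otimes> g \<otimes> y) * of_nat (card (carrier G))
      = (\<Sum>x\<in>carrier G. \<chi> (inv x \<otimes> (inv y \<otimes> g \<otimes> y) \<otimes> x))"
    using assms by (intro *) auto
  also have "\<dots> = (\<Sum>x\<in>carrier G. \<chi> (inv (y \<otimes> x) \<otimes> g \<otimes> (y \<otimes> x)))"
    using assms by (intro sum.cong) (auto simp: inv_mult_group m_assoc)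
  also have "\<dots> = (\<Sum>x\<in>carrier G. \<chi> (inv x \<otimes> g \<otimes> x))"
    by (rule sum_mult_left) fact
  also have "\<dots> = \<chi> g * of_nat (card (carrier G))"
    using assms by (intro *[symmetric]) auto
  finally show ?thesis using card_pos by (metis mult_right_cancel of_nat_0_less_iff of_nat_eq_0_iff less_irrefl)
qed

lemma spherical_comm:
  assumes \<chi>: "spherical G \<chi>" and "g \<in> carrier G" "h \<in> carrier G"
  shows "\<chi> (g \<otimes> h) = \<chi> (h \<otimes> g)"
  using spherical_class_fun[OF \<chi>, of "g \<otimes> h" g] assms
  by (simp add: m_assoc[symmetric])

lemma spherical_eq:
  assumes "spherical G \<chi>" "g \<in> carrier G" "h \<in> carrier G"
  shows "\<chi> g * \<chi> h * of_nat (card (carrier G))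
       = \<chi> \<one> * (\<Sum>x\<in>carrier G. \<chi> (g \<otimes> (inv x \<otimes> h \<otimes> x)))"
  using assms unfolding spherical_def by blast

lemma spherical_lin_hom:
  assumes "lin_hom G \<mu>" shows "spherical G \<mu>"
proof -
  have "(\<Sum>g\<in>carrier G. \<mu> g * \<mu> (inv g)) = (\<Sum>g\<in>carrier G. 1)"
    by (intro sum.cong) (auto simp: lin_hom_inv[OF assms])
  moreover have "(\<Sum>x\<in>carrier G. \<mu> (g \<otimes> (inv x \<otimes> h \<otimes> x))) = (\<Sum>x\<in>carrier G. \<mu> g * \<mu> h)"
    if "g \<in> carrier G" "h \<in> carrier G" for g h
    using that assms
    by (intro sum.cong) (auto simp: lin_hom_def lin_hom_inv[OF assms])
  ultimately show ?thesis using assms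
    by (auto simp: spherical_def lin_hom_def)
qed

text \<open>\<open>\<delta>\<close> has the constant value \<open>\<delta> g * \<delta> h\<close> on
  all products of \<open>g\<close> with a conjugate of \<open>h\<close>, so it factors out of the
  sum. The descent uses this to strip an extended linear character from a Clifford
  correspondent.\<close>

lemma spherical_twist:
  assumes \<chi>: "spherical G \<chi>" and \<delta>: "lin_hom G \<delta>"
  shows "spherical G (\<lambda>g. \<delta> g * \<chi> g)"
proof -
  have \<delta>1: "\<delta> \<one> = 1" using \<delta> by (simp add: lin_hom_def)
  have "(\<Sum>g\<in>carrier G. \<delta> g * \<chi> g * (\<delta> (inv g) * \<chi> (inv g))) = (\<Sum>g\<in>carrier G. \<chi> g * \<chi> (inv g))"
    by (intro sum.cong) (auto simp: lin_hom_inv[OF \<delta>])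
  moreover have "\<delta> g * \<chi> g * (\<delta> h * \<chi> h) * of_nat (card (carrier G))
     = \<chi> \<one> * (\<Sum>x\<in>carrier G. \<delta> (g \<otimes> (inv x \<otimes> h \<otimes> x)) * \<chi> (g \<otimes> (inv x \<otimes> h \<otimes> x)))"
    if "g \<in> carrier G" "h \<in> carrier G" for g h
  proof -
    have "(\<Sum>x\<in>carrier G. \<delta> (g \<otimes> (inv x \<otimes> h \<otimes> x)) * \<chi> (g \<otimes> (inv x \<otimes> h \<otimes> x)))
       = (\<Sum>x\<in>carrier G. (\<delta> g * \<delta> h) * \<chi> (g \<otimes> (inv x \<otimes> h \<otimes> x)))"
      using that \<delta> by (intro sum.cong) (auto simp: lin_hom_def lin_hom_inv[OF \<delta>])
    also have "\<dots> = (\<delta> g * \<delta> h) * (\<Sum>x\<in>carrier G. \<chi> (g \<otimes> (inv x \<otimes> h \<otimes> x)))"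
      by (simp add: sum_distrib_left)
    finally show ?thesis
      using spherical_eq[OF \<chi> that] by (simp add: mult_ac)
  qed
  ultimately show ?thesis using \<chi> by (simp add: spherical_def \<delta>1)
qed

end

lemma sum_lin_hom:
  assumes "fin_group A" "lin_hom A \<mu>" "a \<in> carrier A" "\<mu> a \<noteq> 1"
  shows "(\<Sum>x\<in>carrier A. \<mu> x) = 0"
proof -
  interpret fin_group A by fact
  have "(\<Sum>x\<in>carrier A. \<mu> x) = (\<Sum>x\<in>carrier A. \<mu> (a \<otimes>\<^bsub>A\<^esub> x))"
    by (rule sum_mult_left[symmetric]) fact
  also have "\<dots> = (\<Sum>x\<in>carrier A. \<mu> a * \<mu> x)"
    using assms by (intro sum.cong) (auto simp: lin_hom_def)
  also have "\<dots> = \<mu> a * (\<Sum>x\<in>carrier A. \<mu> x)" by (simp add: sum_distrib_left)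
  finally show ?thesis using assms(4) by simp
qed

section \<open>Clifford correspondence for spherical functions\<close>

lemma (in group) mult_inv_cancel [simp]:
  "\<lbrakk>a \<in> carrier G; b \<in> carrier G\<rbrakk> \<Longrightarrow> a \<otimes> (inv a \<otimes> b) = b"
  "\<lbrakk>a \<in> carrier G; b \<in> carrier G\<rbrakk> \<Longrightarrow> inv a \<otimes> (a \<otimes> b) = b"
  by (simp_all add: m_assoc[symmetric])

lemma (in group) inv_subgrp: "subgroup H G \<Longrightarrow> x \<in> H \<Longrightarrow> inv\<^bsub>subgrp G H\<^esub> x = inv x"
  by (rule m_inv_consistent)

lemma (in fin_group) finite_subgroup: "subgroup H G \<Longrightarrow> finite H"
  using fin finite_subset subgroup.subset by blast

text \<open>This is \<open>\<chi>\<close>, extended linearly, at the product of \<open>t\<close>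
  with the idempotent of \<open>\<nu>\<close> in the group algebra of \<open>A\<close>. If
  \<open>\<chi>\<close> is a trace and \<open>t\<close> fixes \<open>\<nu>\<close>, it is the trace
  of \<open>t\<close> on the \<open>\<nu>\<close>-eigenspace of \<open>A\<close>, the value of the
  Clifford correspondent.\<close>

definition eigen_avg :: "('a, 'b) monoid_scheme \<Rightarrow> 'a set \<Rightarrow> ('a \<Rightarrow> complex) \<Rightarrow> ('a \<Rightarrow> complex) \<Rightarrow> 'a \<Rightarrow> complex" where
  "eigen_avg G A \<nu> \<chi> t = (\<Sum>a\<in>A. \<nu> (inv\<^bsub>G\<^esub> a) * \<chi> (a \<otimes>\<^bsub>G\<^esub> t)) / of_nat (card A)"

definition stabilizer :: "('a, 'b) monoid_scheme \<Rightarrow> 'a set \<Rightarrow> ('a \<Rightarrow> complex) \<Rightarrow> 'a set" where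
  "stabilizer G A \<nu> = {t \<in> carrier G. \<forall>a\<in>A. \<nu> (inv\<^bsub>G\<^esub> t \<otimes>\<^bsub>G\<^esub> a \<otimes>\<^bsub>G\<^esub> t) = \<nu> a}"

lemma (in group) subgroup_stabilizer:
  assumes "A \<lhd> G" shows "subgroup (stabilizer G A \<nu>) G"
proof -
  interpret A: normal A G by fact
  show ?thesis
  proof (rule subgroupI)
    show "stabilizer G A \<nu> \<noteq> {}"
      using one_closed A.mem_carrier by (force simp: stabilizer_def)
    fix t assume t: "t \<in> stabilizer G A \<nu>"
    have "\<nu> (inv (inv t) \<otimes> a \<otimes> inv t) = \<nu> a" if "a \<in> A" for a
    proof -
      have "t \<otimes> a \<otimes> inv t \<in> A" using t that by (auto simp: stabilizer_def intro: A.inv_op_closed2)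
      then have "\<nu> (inv t \<otimes> (t \<otimes> a \<otimes> inv t) \<otimes> t) = \<nu> (t \<otimes> a \<otimes> inv t)"
        using t by (auto simp: stabilizer_def)
      moreover have "inv t \<otimes> (t \<otimes> a \<otimes> inv t) \<otimes> t = a"
        using t A.mem_carrier[OF that] by (simp add: stabilizer_def m_assoc)
      ultimately show ?thesis using t by (simp add: stabilizer_def)
    qed
    then show "inv t \<in> stabilizer G A \<nu>" using t by (simp add: stabilizer_def)
    fix s assume s: "s \<in> stabilizer G A \<nu>"
    have "\<nu> (inv (t \<otimes> s) \<otimes> a \<otimes> (t \<otimes> s)) = \<nu> a" if "a \<in> A" for a
    proof -
      have "inv (t \<otimes> s) \<otimes> a \<otimes> (t \<otimes> s) = inv s \<otimes> (inv t \<otimes> a \<otimes> t) \<otimes> s"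
        using t s A.mem_carrier[OF that] by (simp add: stabilizer_def m_assoc inv_mult_group)
      moreover have "inv t \<otimes> a \<otimes> t \<in> A"
        using t that by (auto simp: stabilizer_def intro: A.inv_op_closed1)
      ultimately show ?thesis using t s that by (simp add: stabilizer_def)
    qed
    then show "t \<otimes> s \<in> stabilizer G A \<nu>" using t s by (simp add: stabilizer_def)
  qed (auto simp: stabilizer_def)
qed

context fin_group
begin

context
  fixes A T :: "'a set" and \<nu> \<chi> F :: "'a \<Rightarrow> complex"
  assumes nA: "A \<lhd> G" and \<nu>: "lin_hom (subgrp G A) \<nu>" and \<chi>: "spherical G \<chi>"
    and F_def: "F = eigen_avg G A \<nu> \<chi>" and T_def: "T = stabilizer G A \<nu>"
begin

interpretation A: normal A G by (rule nA)
interpretation AG: fin_group "subgrp G A" by (rule subgroup_fin_group) (rule A.subgroup_axioms)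

lemma normal_lin_hom_mult: "a \<in> A \<Longrightarrow> b \<in> A \<Longrightarrow> \<nu> (a \<otimes> b) = \<nu> a * \<nu> b"
  using \<nu> by (simp add: lin_hom_def)

lemma normal_lin_hom_inv: "a \<in> A \<Longrightarrow> \<nu> (inv a) = inverse (\<nu> a)" "a \<in> A \<Longrightarrow> \<nu> a \<noteq> 0"
  using AG.lin_hom_inv[OF \<nu>] inv_subgrp[OF A.subgroup_axioms] by auto

lemma card_normal_pos: "card A > 0" using AG.card_pos by simp

lemma eigen_avg_left:
  assumes "b \<in> A" "t \<in> carrier G"
  shows "F (b \<otimes> t) = \<nu> b * F t"
proof -
  note [simp] = A.mem_carrier
  have "(\<Sum>a\<in>A. \<nu> (inv a) * \<chi> (a \<otimes> t)) = (\<Sum>a\<in>A. \<nu> (inv (a \<otimes> b)) * \<chi> (a \<otimes> b \<otimes> t))"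
    using AG.sum_mult_right[of b "\<lambda>a. \<nu> (inv a) * \<chi> (a \<otimes> t)"] assms by simp
  also have "\<dots> = (\<Sum>a\<in>A. inverse (\<nu> b) * (\<nu> (inv a) * \<chi> (a \<otimes> (b \<otimes> t))))"
    using assms by (intro sum.cong) (auto simp: normal_lin_hom_mult normal_lin_hom_inv m_assoc)
  finally have "F t = inverse (\<nu> b) * F (b \<otimes> t)"
    by (simp add: F_def eigen_avg_def sum_distrib_left)
  then show ?thesis using normal_lin_hom_inv(2)[OF assms(1)] by simp
qed

lemma eigen_avg_right:
  assumes "b \<in> A" "t \<in> carrier G"
  shows "F (t \<otimes> b) = \<nu> b * F t"
proof -
  note [simp] = A.mem_carrier
  have "(\<Sum>a\<in>A. \<nu> (inv a) * \<chi> (a \<otimes> t)) = (\<Sum>a\<in>A. \<nu> (inv (b \<otimes> a)) * \<chi> (b \<otimes> a \<otimes> t))"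
    using AG.sum_mult_left[of b "\<lambda>a. \<nu> (inv a) * \<chi> (a \<otimes> t)"] assms by simp
  also have "\<dots> = (\<Sum>a\<in>A. inverse (\<nu> b) * (\<nu> (inv a) * \<chi> (a \<otimes> (t \<otimes> b))))"
    using assms spherical_comm[OF \<chi>, of b "_ \<otimes> t"]
    by (intro sum.cong) (auto simp: normal_lin_hom_mult normal_lin_hom_inv m_assoc)
  finally have "F t = inverse (\<nu> b) * F (t \<otimes> b)"
    by (simp add: F_def eigen_avg_def sum_distrib_left)
  then show ?thesis using normal_lin_hom_inv(2)[OF assms(1)] by simp
qed

text \<open>Moving \<open>b\<close> from the left of \<open>s\<close> to the right turns it into
  \<open>inv s \<otimes> b \<otimes> s\<close>, and outside the stabilizer the two eigenvalues
  differ for some \<open>b\<close>. Hence \<open>F\<close> is supported on \<open>T\<close>.\<close>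

lemma eigen_avg_eq_0:
  assumes "s \<in> carrier G" "s \<notin> T"
  shows "F s = 0"
proof -
  obtain b where b: "b \<in> A" "\<nu> (inv s \<otimes> b \<otimes> s) \<noteq> \<nu> b"
    using assms by (auto simp: T_def stabilizer_def)
  have c: "inv s \<otimes> b \<otimes> s \<in> A" using assms b by (auto intro: A.inv_op_closed1)
  have "\<nu> b * F s = F (b \<otimes> s)" using b assms by (simp add: eigen_avg_left)
  also have "b \<otimes> s = s \<otimes> (inv s \<otimes> b \<otimes> s)"
    using b assms A.mem_carrier by (simp add: m_assoc[symmetric])
  also have "F \<dots> = \<nu> (inv s \<otimes> b \<otimes> s) * F s" using c assms by (intro eigen_avg_right)
  finally show ?thesis using b by simp
qed

lemma eigen_avg_class_fun:
  assumes "h \<in> carrier G" "x \<in> T"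
  shows "F (inv x \<otimes> h \<otimes> x) = F h"
proof -
  note [simp] = A.mem_carrier
  have x: "x \<in> carrier G" using assms by (simp add: T_def stabilizer_def)
  have "(\<Sum>a\<in>A. \<nu> (inv a) * \<chi> (a \<otimes> (inv x \<otimes> h \<otimes> x)))
      = (\<Sum>a\<in>A. \<nu> (inv a) * \<chi> (a \<otimes> h))"
  proof (rule sum.reindex_bij_witness[where i="\<lambda>a. inv x \<otimes> a \<otimes> x" and j="\<lambda>a. x \<otimes> a \<otimes> inv x"])
    fix a assume a: "a \<in> A"
    show "inv x \<otimes> (x \<otimes> a \<otimes> inv x) \<otimes> x = a" "x \<otimes> (inv x \<otimes> a \<otimes> x) \<otimes> inv x = a"
      using a x by (simp_all add: m_assoc)
    show c: "x \<otimes> a \<otimes> inv x \<in> A" "inv x \<otimes> a \<otimes> x \<in> A"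
      using a x by (auto intro: A.inv_op_closed1 A.inv_op_closed2)
    have "\<nu> (inv x \<otimes> (x \<otimes> a \<otimes> inv x) \<otimes> x) = \<nu> (x \<otimes> a \<otimes> inv x)"
      using assms c unfolding T_def stabilizer_def by blast
    then have "\<nu> (x \<otimes> a \<otimes> inv x) = \<nu> a"
      using \<open>inv x \<otimes> (x \<otimes> a \<otimes> inv x) \<otimes> x = a\<close> by simp
    moreover have "inv x \<otimes> (x \<otimes> a \<otimes> inv x \<otimes> h) \<otimes> x = a \<otimes> (inv x \<otimes> h \<otimes> x)"
      using a x assms by (simp add: m_assoc)
    then have "\<chi> (x \<otimes> a \<otimes> inv x \<otimes> h) = \<chi> (a \<otimes> (inv x \<otimes> h \<otimes> x))"
      using spherical_class_fun[OF \<chi>, of "x \<otimes> a \<otimes> inv x \<otimes> h" x] a x assms by simp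
    ultimately show "\<nu> (inv (x \<otimes> a \<otimes> inv x)) * \<chi> (x \<otimes> a \<otimes> inv x \<otimes> h)
      = \<nu> (inv a) * \<chi> (a \<otimes> (inv x \<otimes> h \<otimes> x))"
      using c a by (simp add: normal_lin_hom_inv)
  qed
  then show ?thesis by (simp add: F_def eigen_avg_def)
qed

text \<open>The spherical identity is linear in its first factor, so it may be averaged over
  \<open>a \<otimes> g\<close>. The case \<open>g = \<one>\<close> later becomes the induction
  formula.\<close>

lemma eigen_avg_spherical_left:
  assumes "g \<in> carrier G" "h \<in> carrier G"
  shows "F g * \<chi> h * of_nat (card (carrier G))
       = \<chi> \<one> * (\<Sum>x\<in>carrier G. F (g \<otimes> (inv x \<otimes> h \<otimes> x)))"
proof -
  note [simp] = A.mem_carrier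
  have "(\<Sum>a\<in>A. \<nu> (inv a) * \<chi> (a \<otimes> g)) * (\<chi> h * of_nat (card (carrier G)))
      = (\<Sum>a\<in>A. \<nu> (inv a) * (\<chi> (a \<otimes> g) * \<chi> h * of_nat (card (carrier G))))"
    by (simp add: sum_distrib_right sum_distrib_left mult_ac)
  also have "\<dots> = (\<Sum>a\<in>A. \<nu> (inv a) * (\<chi> \<one> * (\<Sum>x\<in>carrier G. \<chi> (a \<otimes> (g \<otimes> (inv x \<otimes> h \<otimes> x))))))"
    using assms by (intro sum.cong[OF refl], subst spherical_eq[OF \<chi>]) (simp_all add: m_assoc)
  also have "\<dots> = \<chi> \<one> * (\<Sum>a\<in>A. \<Sum>x\<in>carrier G. \<nu> (inv a) * \<chi> (a \<otimes> (g \<otimes> (inv x \<otimes> h \<otimes> x))))"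
    by (simp add: sum_distrib_left mult_ac)
  also have "\<dots> = \<chi> \<one> * (\<Sum>x\<in>carrier G. \<Sum>a\<in>A. \<nu> (inv a) * \<chi> (a \<otimes> (g \<otimes> (inv x \<otimes> h \<otimes> x))))"
    by (subst sum.swap) simp
  finally show ?thesis
    by (simp add: F_def eigen_avg_def sum_divide_distrib[symmetric] mult.assoc)
qed

text \<open>Orthogonality of \<open>\<nu>\<close> and its conjugate by \<open>x\<close>: their
  quotient is a linear character of \<open>A\<close>, trivial exactly for \<open>x \<in> T\<close>.
  This indicator cuts sums over the group down to the stabilizer.\<close>

lemma sum_lin_hom_conj:
  assumes "x \<in> carrier G"
  shows "(\<Sum>a\<in>A. \<nu> (inv a) * \<nu> (inv x \<otimes> a \<otimes> x)) = (if x \<in> T then of_nat (card A) else 0)"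
proof -
  note [simp] = A.mem_carrier
  have l: "lin_hom (subgrp G A) (\<lambda>a. \<nu> (inv a) * \<nu> (inv x \<otimes> a \<otimes> x))"
  proof -
    have "inv x \<otimes> (a \<otimes> b) \<otimes> x = (inv x \<otimes> a \<otimes> x) \<otimes> (inv x \<otimes> b \<otimes> x)" if "a \<in> A" "b \<in> A" for a b
      using that assms by (simp add: m_assoc)
    moreover have "inv x \<otimes> a \<otimes> x \<in> A" if "a \<in> A" for a
      using that assms by (auto intro: A.inv_op_closed1)
    ultimately show ?thesis
      using \<nu> assms by (auto simp: lin_hom_def inv_mult_group normal_lin_hom_mult normal_lin_hom_inv)
  qed
  show ?thesis
  proof (cases "x \<in> T")
    case True
    then have "\<nu> (inv a) * \<nu> (inv x \<otimes> a \<otimes> x) = 1" if "a \<in> A" for a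
      using that normal_lin_hom_inv[OF that] by (simp add: T_def stabilizer_def)
    then show ?thesis using True by simp
  next
    case False
    then obtain a where "a \<in> A" "\<nu> (inv x \<otimes> a \<otimes> x) \<noteq> \<nu> a"
      using assms by (auto simp: T_def stabilizer_def)
    then have "\<nu> (inv a) * \<nu> (inv x \<otimes> a \<otimes> x) \<noteq> 1"
      by (simp add: normal_lin_hom_inv field_simps)
    then show ?thesis
      using sum_lin_hom[OF AG.fin_group_axioms l] False \<open>a \<in> A\<close> by simp
  qed
qed

text \<open>Average the mixed identity once more, over \<open>a \<otimes> h\<close>. Since
  \<open>g\<close> fixes \<open>\<nu>\<close>, the conjugate of \<open>a\<close> by \<open>x\<close>
  can be moved past \<open>g\<close> and leaves \<open>F\<close> as the factor
  \<open>\<nu> (inv x \<otimes> a \<otimes> x)\<close>; summing over \<open>a\<close> kills all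
  \<open>x\<close> outside \<open>T\<close>.\<close>

lemma eigen_avg_spherical:
  assumes g: "g \<in> T" and h: "h \<in> carrier G"
  shows "F g * F h * of_nat (card (carrier G))
       = \<chi> \<one> * (\<Sum>x\<in>T. F (g \<otimes> (inv x \<otimes> h \<otimes> x)))"
proof -
  note [simp] = A.mem_carrier
  have gG [simp]: "g \<in> carrier G" using g by (simp add: T_def stabilizer_def)
  have *: "F (g \<otimes> (inv x \<otimes> (a \<otimes> h) \<otimes> x)) = \<nu> (inv x \<otimes> a \<otimes> x) * F (g \<otimes> (inv x \<otimes> h \<otimes> x))"
    if "a \<in> A" "x \<in> carrier G" for a x
  proof -
    let ?b = "inv x \<otimes> a \<otimes> x"
    have b: "?b \<in> A" using that by (auto intro: A.inv_op_closed1)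
    have c: "g \<otimes> ?b \<otimes> inv g \<in> A" using b by (auto intro: A.inv_op_closed2)
    have "\<nu> (inv g \<otimes> (g \<otimes> ?b \<otimes> inv g) \<otimes> g) = \<nu> (g \<otimes> ?b \<otimes> inv g)"
      using g c unfolding T_def stabilizer_def by blast
    moreover have "inv g \<otimes> (g \<otimes> ?b \<otimes> inv g) \<otimes> g = ?b"
      using that by (simp add: m_assoc)
    ultimately have "\<nu> (g \<otimes> ?b \<otimes> inv g) = \<nu> ?b" by simp
    moreover have "g \<otimes> (inv x \<otimes> (a \<otimes> h) \<otimes> x) = (g \<otimes> ?b \<otimes> inv g) \<otimes> (g \<otimes> (inv x \<otimes> h \<otimes> x))"
      using that h by (simp add: m_assoc)
    ultimately show ?thesis using that h c by (simp add: eigen_avg_left)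
  qed
  have "F g * (\<Sum>a\<in>A. \<nu> (inv a) * \<chi> (a \<otimes> h)) * of_nat (card (carrier G))
      = (\<Sum>a\<in>A. \<nu> (inv a) * (F g * \<chi> (a \<otimes> h) * of_nat (card (carrier G))))"
    by (simp add: sum_distrib_right sum_distrib_left mult_ac)
  also have "\<dots> = (\<Sum>a\<in>A. \<nu> (inv a) * (\<chi> \<one> * (\<Sum>x\<in>carrier G. F (g \<otimes> (inv x \<otimes> (a \<otimes> h) \<otimes> x)))))"
    using h by (intro sum.cong[OF refl], subst eigen_avg_spherical_left) auto
  also have "\<dots> = \<chi> \<one> * (\<Sum>a\<in>A. \<Sum>x\<in>carrier G. \<nu> (inv a) * F (g \<otimes> (inv x \<otimes> (a \<otimes> h) \<otimes> x)))"
    by (simp add: sum_distrib_left mult_ac)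
  also have "\<dots> = \<chi> \<one> * (\<Sum>x\<in>carrier G. \<Sum>a\<in>A. \<nu> (inv a) * F (g \<otimes> (inv x \<otimes> (a \<otimes> h) \<otimes> x)))"
    by (subst sum.swap) simp
  also have "\<dots> = \<chi> \<one> * (\<Sum>x\<in>carrier G. \<Sum>a\<in>A. \<nu> (inv a) * \<nu> (inv x \<otimes> a \<otimes> x) * F (g \<otimes> (inv x \<otimes> h \<otimes> x)))"
    by (simp add: * mult.assoc cong: sum.cong)
  also have "\<dots> = \<chi> \<one> * (\<Sum>x\<in>carrier G. (if x \<in> T then of_nat (card A) else 0) * F (g \<otimes> (inv x \<otimes> h \<otimes> x)))"
    by (simp add: sum_lin_hom_conj[symmetric] sum_distrib_right cong: sum.cong)
  also have "\<dots> = \<chi> \<one> * (\<Sum>x\<in>T. of_nat (card A) * F (g \<otimes> (inv x \<otimes> h \<otimes> x)))"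
    by (rule arg_cong2[where f="(*)"], rule refl, rule sum.mono_neutral_cong_right)
       (auto simp: T_def stabilizer_def)
  finally have "F g * (\<Sum>a\<in>A. \<nu> (inv a) * \<chi> (a \<otimes> h)) * of_nat (card (carrier G))
      = \<chi> \<one> * (of_nat (card A) * (\<Sum>x\<in>T. F (g \<otimes> (inv x \<otimes> h \<otimes> x))))"
    by (simp only: sum_distrib_left)
  moreover have "(\<Sum>a\<in>A. \<nu> (inv a) * \<chi> (a \<otimes> h)) = of_nat (card A) * F h"
    using card_normal_pos by (simp add: F_def eigen_avg_def)
  ultimately have "of_nat (card A) * (F g * F h * of_nat (card (carrier G)))
      = of_nat (card A) * (\<chi> \<one> * (\<Sum>x\<in>T. F (g \<otimes> (inv x \<otimes> h \<otimes> x))))"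
    by (simp only: mult_ac)
  moreover have "of_nat (card A) \<noteq> (0::complex)"
    using card_normal_pos by (metis of_nat_eq_0_iff less_irrefl)
  ultimately show ?thesis by (rule mult_left_cancel[THEN iffD1, rotated])
qed

text \<open>The Clifford correspondence. Both claims follow from the averaged identities once the
  degree is known: \<open>F \<one>\<close> is \<open>\<chi> \<one>\<close> divided by the index of
  \<open>T\<close>, hence rational and positive.\<close>

lemma eigen_avg_clifford:
  assumes t0: "t0 \<in> carrier G" "F t0 \<noteq> 0"
  shows "spherical (subgrp G T) F"
    and "\<And>t. t \<in> carrier G \<Longrightarrow> \<chi> t = induced G T F t"
proof -
  have sT: "subgroup T G" unfolding T_def by (rule subgroup_stabilizer) (rule nA)
  interpret TG: fin_group "subgrp G T" by (rule subgroup_fin_group) (rule sT)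
  have t0T: "t0 \<in> T" using t0 eigen_avg_eq_0 by blast
  have oneT: "\<one> \<in> T" using subgroup.one_closed[OF sT] .
  have cT: "card T > 0" using TG.card_pos by simp
  have TC: "t \<in> T \<Longrightarrow> t \<in> carrier G" for t by (simp add: T_def stabilizer_def)
  \<comment> \<open>With \<open>g = \<one>\<close> and \<open>h = t0\<close> all summands equal
    \<open>F t0\<close>, which then cancels. So nonvanishing at any one point fixes the
    degree.\<close>
  have "F \<one> * F t0 * of_nat (card (carrier G)) = \<chi> \<one> * (\<Sum>x\<in>T. F t0)"
    using eigen_avg_spherical[OF oneT t0(1)] t0 eigen_avg_class_fun by (simp add: TC)
  then have one: "F \<one> * of_nat (card (carrier G)) = \<chi> \<one> * of_nat (card T)"
    using t0 by simp
  have \<chi>1: "\<chi> \<one> \<in> \<rat>" "Re (\<chi> \<one>) > 0" "\<chi> \<one> \<noteq> 0" using \<chi> by (auto simp: spherical_def)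
  have cG0: "of_nat (card (carrier G)) \<noteq> (0::complex)"
    using card_pos by (metis of_nat_eq_0_iff less_irrefl)
  have F1: "F \<one> = \<chi> \<one> * of_real (of_nat (card T) / of_nat (card (carrier G)))"
    using one cG0 by (simp only: of_real_divide of_real_of_nat_eq times_divide_eq_right nonzero_eq_divide_eq not_False_eq_True)
  have F1Q: "F \<one> \<in> \<rat>"
    unfolding F1 using \<chi>1(1) by (intro Rats_mult) (simp_all add: Rats_divide)
  have F1pos: "Re (F \<one>) > 0"
  proof -
    obtain r where r: "r = real (card T) / real (card (carrier G))" "r > 0"
      using cT card_pos by (metis divide_pos_pos of_nat_0_less_iff)
    then have "F \<one> = \<chi> \<one> * of_real r" using F1 by simp
    then have "Re (F \<one>) = Re (\<chi> \<one>) * r" by (simp del: of_real_of_nat_eq)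
    then show ?thesis using mult_pos_pos[OF \<chi>1(2) r(2)] by (simp only:)
  qed
  show ind: "\<chi> t = induced G T F t" if t: "t \<in> carrier G" for t
  proof -
    have "F \<one> * \<chi> t * of_nat (card (carrier G)) = \<chi> \<one> * (\<Sum>x\<in>carrier G. F (\<one> \<otimes> (inv x \<otimes> t \<otimes> x)))"
      by (rule eigen_avg_spherical_left) (use t in auto)
    also have "(\<Sum>x\<in>carrier G. F (\<one> \<otimes> (inv x \<otimes> t \<otimes> x)))
       = (\<Sum>x\<in>carrier G. if inv x \<otimes> t \<otimes> x \<in> T then F (inv x \<otimes> t \<otimes> x) else 0)"
      using t by (intro sum.cong) (auto simp: eigen_avg_eq_0)
    finally have "F \<one> * of_nat (card (carrier G)) * \<chi> t = \<chi> \<one> * \<dots>" by (simp add: mult_ac)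
    then show ?thesis using one \<chi>1 cT t by (simp add: induced_def field_simps)
  qed
  show "spherical (subgrp G T) F"
  proof -
    have "F g * F h * of_nat (card T) = F \<one> * (\<Sum>x\<in>T. F (g \<otimes> (inv x \<otimes> h \<otimes> x)))"
      if "g \<in> T" "h \<in> T" for g h
    proof -
      have "\<chi> \<one> * of_nat (card T) * (F g * F h) = F \<one> * (F g * F h * of_nat (card (carrier G)))"
        using one by (simp add: mult_ac)
      also have "\<dots> = \<chi> \<one> * (F \<one> * (\<Sum>x\<in>T. F (g \<otimes> (inv x \<otimes> h \<otimes> x))))"
        using eigen_avg_spherical[of g h] that TC by simp
      finally show ?thesis using \<chi>1 by (simp add: mult_ac)
    qed
    \<comment> \<open>In the norm of \<open>\<chi>\<close> one factor is replaced by the induction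
      formula, and every conjugate contributes the same pairing of \<open>F\<close> with
      \<open>\<chi>\<close>. Shifting by elements of \<open>A\<close> shows that \<open>F\<close>
      only sees the \<open>\<nu>\<close>-part of \<open>\<chi>\<close>, so this is the pairing of
      \<open>F\<close> with itself.\<close>
    moreover have "(\<Sum>t\<in>T. F t * F (inv t)) = of_nat (card T)"
    proof -
      have FG: "(\<Sum>t\<in>T. F t * F (inv t)) = (\<Sum>t\<in>carrier G. F t * F (inv t))"
        by (rule sum.mono_neutral_left) (use TC eigen_avg_eq_0 in auto)
      have *: "(\<Sum>t\<in>carrier G. F t * \<chi> (inv t)) = \<nu> (inv a) * (\<Sum>t\<in>carrier G. F t * \<chi> (a \<otimes> inv t))"
        if "a \<in> A" for a
      proof -
        have [simp]: "a \<in> carrier G" using that A.mem_carrier by blast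
        have "(\<Sum>t\<in>carrier G. F t * \<chi> (inv t)) = (\<Sum>t\<in>carrier G. F (t \<otimes> inv a) * \<chi> (inv (t \<otimes> inv a)))"
          by (rule sum_mult_right[symmetric]) simp
        also have "\<dots> = (\<Sum>t\<in>carrier G. \<nu> (inv a) * (F t * \<chi> (a \<otimes> inv t)))"
          using that by (intro sum.cong) (auto simp: eigen_avg_right inv_mult_group)
        finally show ?thesis by (simp add: sum_distrib_left)
      qed
      have "of_nat (card A) * (\<Sum>t\<in>carrier G. F t * \<chi> (inv t))
          = (\<Sum>a\<in>A. \<nu> (inv a) * (\<Sum>t\<in>carrier G. F t * \<chi> (a \<otimes> inv t)))"
        by (subst sum.cong[OF refl *[symmetric]]) simp_all
      also have "\<dots> = (\<Sum>t\<in>carrier G. F t * (\<Sum>a\<in>A. \<nu> (inv a) * \<chi> (a \<otimes> inv t)))"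
        unfolding sum_distrib_left by (subst sum.swap) (simp add: mult_ac)
      also have "\<dots> = of_nat (card A) * (\<Sum>t\<in>carrier G. F t * F (inv t))"
      proof -
        have "(\<Sum>a\<in>A. \<nu> (inv a) * \<chi> (a \<otimes> u)) = of_nat (card A) * F u" for u
          using card_normal_pos by (simp add: F_def eigen_avg_def)
        then show ?thesis by (simp add: sum_distrib_left mult_ac)
      qed
      finally have FF: "(\<Sum>t\<in>carrier G. F t * F (inv t)) = (\<Sum>t\<in>carrier G. F t * \<chi> (inv t))"
        using card_normal_pos by simp
      have "of_nat (card (carrier G)) * of_nat (card T) = (\<Sum>g\<in>carrier G. \<chi> g * \<chi> (inv g)) * of_nat (card T)"
        using \<chi> by (simp add: spherical_def)
      also have "\<dots> = (\<Sum>g\<in>carrier G. (\<Sum>x\<in>carrier G. F (inv x \<otimes> g \<otimes> x)) * \<chi> (inv g))"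
      proof -
        have "\<chi> g * of_nat (card T) = (\<Sum>x\<in>carrier G. F (inv x \<otimes> g \<otimes> x))" if "g \<in> carrier G" for g
        proof -
          have "(\<Sum>x\<in>carrier G. if inv x \<otimes> g \<otimes> x \<in> T then F (inv x \<otimes> g \<otimes> x) else 0) = (\<Sum>x\<in>carrier G. F (inv x \<otimes> g \<otimes> x))"
            using that by (intro sum.cong) (auto simp: eigen_avg_eq_0)
          then show ?thesis using ind[OF that] cT that by (simp add: induced_def)
        qed
        then have "(\<Sum>g\<in>carrier G. (\<chi> g * of_nat (card T)) * \<chi> (inv g))
            = (\<Sum>g\<in>carrier G. (\<Sum>x\<in>carrier G. F (inv x \<otimes> g \<otimes> x)) * \<chi> (inv g))"
          by (intro sum.cong) simp_all
        moreover have "(\<Sum>g\<in>carrier G. \<chi> g * \<chi> (inv g)) * of_nat (card T)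
            = (\<Sum>g\<in>carrier G. (\<chi> g * of_nat (card T)) * \<chi> (inv g))"
          by (simp add: sum_distrib_left mult_ac)
        ultimately show ?thesis by simp
      qed
      also have "\<dots> = (\<Sum>x\<in>carrier G. \<Sum>g\<in>carrier G. F (inv x \<otimes> g \<otimes> x) * \<chi> (inv g))"
        unfolding sum_distrib_right by (rule sum.swap)
      also have "\<dots> = (\<Sum>x\<in>carrier G. \<Sum>g\<in>carrier G. F g * \<chi> (inv g))"
      proof (rule sum.cong[OF refl])
        fix x assume x: "x \<in> carrier G"
        have "(\<Sum>g\<in>carrier G. F (inv x \<otimes> g \<otimes> x) * \<chi> (inv g))
            = (\<Sum>g\<in>carrier G. F (inv x \<otimes> g \<otimes> x) * \<chi> (inv (inv x \<otimes> g \<otimes> x)))"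
        proof (intro sum.cong refl)
          fix g assume g: "g \<in> carrier G"
          have "inv (inv x \<otimes> g \<otimes> x) = inv x \<otimes> inv g \<otimes> x"
            using g x by (simp add: inv_mult_group m_assoc)
          then show "F (inv x \<otimes> g \<otimes> x) * \<chi> (inv g) = F (inv x \<otimes> g \<otimes> x) * \<chi> (inv (inv x \<otimes> g \<otimes> x))"
            using spherical_class_fun[OF \<chi>, of "inv g" x] g x by simp
        qed
        also have "\<dots> = (\<Sum>g\<in>carrier G. F g * \<chi> (inv g))"
          by (rule sum_conj[OF x])
        finally show "(\<Sum>g\<in>carrier G. F (inv x \<otimes> g \<otimes> x) * \<chi> (inv g)) = (\<Sum>g\<in>carrier G. F g * \<chi> (inv g))" .
      qed
      also have "\<dots> = of_nat (card (carrier G)) * (\<Sum>t\<in>T. F t * F (inv t))"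
        using FF FG by simp
      finally show ?thesis using cG0 by (metis mult_left_cancel)
    qed
    moreover have "(\<Sum>t\<in>T. F t * F (inv\<^bsub>subgrp G T\<^esub> t)) = (\<Sum>t\<in>T. F t * F (inv t))"
      by (rule sum.cong) (simp_all add: inv_subgrp[OF sT])
    moreover have "(\<Sum>x\<in>T. F (g \<otimes> (inv\<^bsub>subgrp G T\<^esub> x \<otimes> h \<otimes> x))) = (\<Sum>x\<in>T. F (g \<otimes> (inv x \<otimes> h \<otimes> x)))" for g h
      by (rule sum.cong) (simp_all add: inv_subgrp[OF sT])
    ultimately show ?thesis
      using F1Q F1pos unfolding spherical_def by simp
  qed
qed

end

end

section \<open>Common eigenfunctions of an abelian section\<close>

definition root_unity :: "nat \<Rightarrow> nat \<Rightarrow> complex" where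
  "root_unity m i = cis (2 * pi * real i / real m)"

lemma root_unity_power:
  assumes "m > 0"
  shows "root_unity m i ^ m = 1" "root_unity m i ^ k = root_unity m k ^ i"
proof -
  have b: "bij_betw (\<lambda>k. cis (2 * pi * real k / real m)) {..<m} {z. z ^ m = 1}"
    using assms by (rule bij_betw_roots_unity)
  have "root_unity m i ^ m = cis (2 * pi * real i)"
    using assms by (simp add: root_unity_def DeMoivre field_simps)
  then show "root_unity m i ^ m = 1" by (simp add: cis_multiple_2pi)
  show "root_unity m i ^ k = root_unity m k ^ i"
    by (simp add: root_unity_def DeMoivre mult_ac)
qed

lemma root_unity_neq_1: "0 < k \<Longrightarrow> k < m \<Longrightarrow> root_unity m k \<noteq> 1"
proof
  assume k: "0 < k" "k < m" and "root_unity m k = 1"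
  then have "cis (2 * pi * real k / real m) = cis (2 * pi * real 0 / real m)"
    by (simp add: root_unity_def)
  moreover have "inj_on (\<lambda>k. cis (2 * pi * real k / real m)) {..<m}"
    using bij_betw_roots_unity[of m] k by (auto simp: bij_betw_def)
  ultimately show False using k by (auto dest: inj_onD[where x=k and y=0])
qed

lemma sum_root_unity:
  assumes "k < m"
  shows "(\<Sum>i<m. root_unity m i ^ k) = (if k = 0 then of_nat m else 0)"
proof (cases "k = 0")
  case False
  then have "root_unity m k \<noteq> 1" using root_unity_neq_1[of k m] assms by simp
  moreover have "(\<Sum>i<m. root_unity m i ^ k) = (\<Sum>i<m. root_unity m k ^ i)"
    using assms by (intro sum.cong root_unity_power) auto
  ultimately show ?thesis
    using False assms root_unity_power(1)[of m k] by (simp add: geometric_sum)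
qed simp

context fin_group
begin

context
  fixes A K :: "'a set" and \<chi> :: "'a \<Rightarrow> complex"
  assumes sA: "subgroup A G" and sK: "subgroup K G" and KA: "K \<subseteq> A"
    and comm: "\<And>a b. a \<in> A \<Longrightarrow> b \<in> A \<Longrightarrow> a \<otimes> b \<otimes> inv (b \<otimes> a) \<in> K"
    and inv\<chi>: "\<And>k t. k \<in> K \<Longrightarrow> t \<in> carrier G \<Longrightarrow> \<chi> (k \<otimes> t) = \<chi> t"
begin

interpretation A: subgroup A G by (rule sA)
interpretation K: subgroup K G by (rule sK)
interpretation AG: fin_group "subgrp G A" by (rule subgroup_fin_group) (rule sA)

text \<open>The space generated by \<open>\<chi>\<close> under left translation by \<open>A\<close>;
  it stands in for the restriction of a representation to \<open>A\<close>. Only values on the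
  carrier matter.\<close>

definition trans_span :: "('a \<Rightarrow> complex) set" where
  "trans_span = {f. \<exists>c. \<forall>t\<in>carrier G. f t = (\<Sum>a\<in>A. c a * \<chi> (a \<otimes> t))}"

lemma trans_span_sum:
  assumes "finite I" "\<And>i. i \<in> I \<Longrightarrow> f i \<in> trans_span"
  shows "(\<lambda>t. \<Sum>i\<in>I. c i * f i t) \<in> trans_span"
proof -
  have "\<forall>i\<in>I. \<exists>d. \<forall>t\<in>carrier G. f i t = (\<Sum>a\<in>A. d a * \<chi> (a \<otimes> t))"
    using assms(2) unfolding trans_span_def by blast
  then obtain d where d: "\<And>i t. i \<in> I \<Longrightarrow> t \<in> carrier G \<Longrightarrow> f i t = (\<Sum>a\<in>A. d i a * \<chi> (a \<otimes> t))"
    by metis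
  have "(\<Sum>i\<in>I. c i * f i t) = (\<Sum>a\<in>A. (\<Sum>i\<in>I. c i * d i a) * \<chi> (a \<otimes> t))" if "t \<in> carrier G" for t
  proof -
    have "(\<Sum>i\<in>I. c i * f i t) = (\<Sum>i\<in>I. \<Sum>a\<in>A. c i * d i a * \<chi> (a \<otimes> t))"
      using d that by (intro sum.cong) (simp_all add: sum_distrib_left mult.assoc)
    also have "\<dots> = (\<Sum>a\<in>A. \<Sum>i\<in>I. c i * d i a * \<chi> (a \<otimes> t))" by (rule sum.swap)
    finally show ?thesis by (simp add: sum_distrib_right)
  qed
  then show ?thesis unfolding trans_span_def by (intro CollectI exI ballI)
qed

lemma trans_span_translate:
  assumes "f \<in> trans_span" "b \<in> A"
  shows "(\<lambda>t. f (b \<otimes> t)) \<in> trans_span"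
proof -
  obtain c where c: "\<And>t. t \<in> carrier G \<Longrightarrow> f t = (\<Sum>a\<in>A. c a * \<chi> (a \<otimes> t))"
    using assms unfolding trans_span_def by blast
  have "f (b \<otimes> t) = (\<Sum>a\<in>A. c (a \<otimes> inv b) * \<chi> (a \<otimes> t))" if t: "t \<in> carrier G" for t
  proof -
    have "(\<Sum>a\<in>A. c (a \<otimes> inv b) * \<chi> (a \<otimes> t)) = (\<Sum>a\<in>A. c (a \<otimes> b \<otimes> inv b) * \<chi> (a \<otimes> b \<otimes> t))"
      using AG.sum_mult_right[of b "\<lambda>a. c (a \<otimes> inv b) * \<chi> (a \<otimes> t)"] assms by simp
    also have "\<dots> = (\<Sum>a\<in>A. c a * \<chi> (a \<otimes> (b \<otimes> t)))"
      using assms t A.mem_carrier by (intro sum.cong) (simp_all add: m_assoc)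
    finally show ?thesis using c[of "b \<otimes> t"] assms t A.mem_carrier by simp
  qed
  then show ?thesis unfolding trans_span_def by (intro CollectI exI ballI)
qed

text \<open>The commutator condition with one argument in \<open>K\<close> gives
  \<open>a \<otimes> k \<in> K #> a\<close>, so invariance under \<open>K\<close> passes from
  \<open>\<chi>\<close> to its translates. Consequently \<open>A\<close> acts on
  \<open>trans_span\<close> by commuting operators.\<close>

lemma trans_span_K:
  assumes "f \<in> trans_span" "k \<in> K" "t \<in> carrier G"
  shows "f (k \<otimes> t) = f t"
proof -
  obtain c where c: "\<And>t. t \<in> carrier G \<Longrightarrow> f t = (\<Sum>a\<in>A. c a * \<chi> (a \<otimes> t))"
    using assms unfolding trans_span_def by blast
  have "\<chi> (a \<otimes> (k \<otimes> t)) = \<chi> (a \<otimes> t)" if a: "a \<in> A" for a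
  proof -
    have [simp]: "k \<in> carrier G" "a \<in> carrier G" using a assms A.mem_carrier K.mem_carrier by auto
    have "a \<otimes> k \<otimes> inv (k \<otimes> a) \<otimes> k \<in> K"
      using comm[of a k] a assms KA by (intro K.m_closed[of "a \<otimes> k \<otimes> inv (k \<otimes> a)"]) auto
    moreover have "a \<otimes> (k \<otimes> t) = (a \<otimes> k \<otimes> inv (k \<otimes> a) \<otimes> k) \<otimes> (a \<otimes> t)"
      using assms by (simp add: m_assoc inv_mult_group)
    ultimately show ?thesis using inv\<chi>[of _ "a \<otimes> t"] assms by simp
  qed
  then show ?thesis using c assms K.mem_carrier by simp
qed

lemma trans_span_comm:
  assumes "f \<in> trans_span" "a \<in> A" "b \<in> A" "t \<in> carrier G"
  shows "f (a \<otimes> (b \<otimes> t)) = f (b \<otimes> (a \<otimes> t))"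
proof -
  have [simp]: "a \<in> carrier G" "b \<in> carrier G" using assms A.mem_carrier by auto
  have "a \<otimes> (b \<otimes> t) = (a \<otimes> b \<otimes> inv (b \<otimes> a)) \<otimes> (b \<otimes> (a \<otimes> t))"
    using assms by (simp add: m_assoc inv_mult_group)
  then show ?thesis using trans_span_K[OF assms(1) comm] assms by simp
qed

lemma char_in_trans_span: "\<chi> \<in> trans_span"
proof -
  have "\<chi> t = (\<Sum>a\<in>A. (if a = \<one> then 1 else 0) * \<chi> (a \<otimes> t))" if "t \<in> carrier G" for t
  proof -
    have "(\<Sum>a\<in>A. (if a = \<one> then 1 else 0) * \<chi> (a \<otimes> t)) = (\<Sum>a\<in>{\<one>}. \<chi> (a \<otimes> t))"
      using AG.fin by (intro sum.mono_neutral_cong_right) auto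
    then show ?thesis using that by simp
  qed
  then show ?thesis unfolding trans_span_def by (intro CollectI exI ballI)
qed

text \<open>Simultaneous diagonalization of commuting operators of finite order, one
  \<open>s\<close> at a time: a discrete Fourier transform along the powers of \<open>s\<close>
  projects onto its eigenspaces, and commutativity preserves the eigenvalues already
  secured.\<close>

lemma eigenfunction_exists:
  assumes \<chi>0: "t0 \<in> carrier G" "\<chi> t0 \<noteq> 0"
  shows "finite S \<Longrightarrow> S \<subseteq> A \<Longrightarrow> \<exists>f\<in>trans_span. (\<exists>t\<in>carrier G. f t \<noteq> 0) \<and>
           (\<forall>s\<in>S. \<exists>z. \<forall>t\<in>carrier G. f (s \<otimes> t) = z * f t)"
proof (induction S rule: finite_induct)
  case empty
  then show ?case using \<chi>0 char_in_trans_span by blast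
next
  case (insert s S)
  then obtain f t1 where f: "f \<in> trans_span" "t1 \<in> carrier G" "f t1 \<noteq> 0"
    and ev: "\<And>s. s \<in> S \<Longrightarrow> \<exists>z. \<forall>t\<in>carrier G. f (s \<otimes> t) = z * f t"
    by auto
  have sA': "s \<in> A" and SA: "S \<subseteq> A" using insert by auto
  have sG [simp]: "s \<in> carrier G" using sA' A.mem_carrier by blast
  \<comment> \<open>The group order is an exponent valid for every \<open>s\<close>.\<close>
  define m where "m = Coset.order G"
  have m: "m > 0" using card_pos by (simp add: m_def Coset.order_def)
  have sm: "s [^] m = \<one>" unfolding m_def by (rule pow_order_eq_1) simp
  have spA: "s [^] (k::nat) \<in> A" for k using sA' by (induction k) auto
  define g where "g i = (\<lambda>t. \<Sum>k<m. root_unity m i ^ k * f (s [^] k \<otimes> t))" for i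
  have gV: "g i \<in> trans_span" for i
    unfolding g_def using f spA by (intro trans_span_sum trans_span_translate) auto
  \<comment> \<open>The Fourier components add up to \<open>m\<close> times \<open>f\<close>, so
    they cannot all vanish at \<open>t1\<close>.\<close>
  have "\<exists>i<m. g i t1 \<noteq> 0"
  proof (rule ccontr)
    assume "\<not> (\<exists>i<m. g i t1 \<noteq> 0)"
    then have "0 = (\<Sum>i<m. g i t1)" by simp
    also have "\<dots> = (\<Sum>k<m. \<Sum>i<m. root_unity m i ^ k * f (s [^] k \<otimes> t1))"
      unfolding g_def by (rule sum.swap)
    also have "\<dots> = (\<Sum>k<m. (if k = 0 then of_nat m else 0) * f (s [^] k \<otimes> t1))"
      by (intro sum.cong refl) (simp only: sum_distrib_right[symmetric] sum_root_unity lessThan_iff)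
    also have "\<dots> = (\<Sum>k\<in>{0::nat}. of_nat m * f (s [^] k \<otimes> t1))"
      using m by (intro sum.mono_neutral_cong_right) auto
    also have "\<dots> = of_nat m * f t1" using f by simp
    finally show False using m f by simp
  qed
  then obtain i where i: "i < m" "g i t1 \<noteq> 0" by blast
  have z0: "root_unity m i \<noteq> 0" by (simp add: root_unity_def)
  have "g i (s \<otimes> t) = inverse (root_unity m i) * g i t" if t: "t \<in> carrier G" for t
  proof -
    define h where "h k = root_unity m i ^ k * f (s [^] k \<otimes> t)" for k
    have "root_unity m i * g i (s \<otimes> t) = (\<Sum>k<m. h (Suc k))"
      unfolding g_def sum_distrib_left h_def using t
      by (intro sum.cong refl) (simp add: m_assoc mult_ac)
    also have "\<dots> = (\<Sum>k<Suc m. h k) - h 0" by (subst sum.lessThan_Suc_shift) simp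
    also have "\<dots> = (\<Sum>k<m. h k)"
      using sm root_unity_power(1)[OF m] by (simp add: h_def)
    finally have "root_unity m i * g i (s \<otimes> t) = g i t" by (simp add: g_def h_def)
    then show ?thesis using z0 by (simp add: field_simps)
  qed
  moreover have "\<exists>z. \<forall>t\<in>carrier G. g i (s' \<otimes> t) = z * g i t" if s': "s' \<in> S" for s'
  proof -
    obtain z where z: "\<And>t. t \<in> carrier G \<Longrightarrow> f (s' \<otimes> t) = z * f t" using ev[OF s'] by blast
    have [simp]: "s' \<in> A" "s' \<in> carrier G" using s' SA A.mem_carrier by auto
    have "g i (s' \<otimes> t) = z * g i t" if t: "t \<in> carrier G" for t
    proof -
      have "f (s [^] k \<otimes> (s' \<otimes> t)) = z * f (s [^] k \<otimes> t)" for k :: nat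
        using trans_span_comm[OF f(1) spA[of k], of s' t] z[of "s [^] k \<otimes> t"] t by simp
      then show ?thesis by (simp add: g_def sum_distrib_left mult_ac)
    qed
    then show ?thesis by blast
  qed
  ultimately show ?case using gV f i by blast
qed

text \<open>The eigenvalues of a common eigenfunction \<open>f\<close> form \<open>\<nu>\<close>. If
  all \<open>\<nu>\<close>-averages of \<open>\<chi>\<close> vanished, so would those of its
  translates and of \<open>f\<close>; but the \<open>\<nu>\<close>-average of \<open>f\<close> is
  \<open>f\<close> itself.\<close>

lemma eigen_avg_exists:
  assumes \<chi>0: "t0 \<in> carrier G" "\<chi> t0 \<noteq> 0"
  shows "\<exists>\<nu>. lin_hom (subgrp G A) \<nu> \<and> (\<forall>k\<in>K. \<nu> k = 1) \<and> (\<exists>t\<in>carrier G. eigen_avg G A \<nu> \<chi> t \<noteq> 0)"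
proof -
  obtain f t1 where f: "f \<in> trans_span" "t1 \<in> carrier G" "f t1 \<noteq> 0"
    and ev: "\<forall>s\<in>A. \<exists>z. \<forall>t\<in>carrier G. f (s \<otimes> t) = z * f t"
    using eigenfunction_exists[OF \<chi>0, of A] AG.fin by auto
  obtain \<nu> where \<nu>: "\<And>a t. a \<in> A \<Longrightarrow> t \<in> carrier G \<Longrightarrow> f (a \<otimes> t) = \<nu> a * f t"
    using ev by metis
  note [simp] = A.mem_carrier
  have \<nu>1: "\<nu> k = 1" if "k \<in> K" for k
    using \<nu>[of k t1] trans_span_K[OF f(1) that f(2)] f KA that by auto
  have \<nu>m: "\<nu> (a \<otimes> b) = \<nu> a * \<nu> b" if "a \<in> A" "b \<in> A" for a b
    using \<nu>[of "a \<otimes> b" t1] \<nu>[of a "b \<otimes> t1"] \<nu>[of b t1] f that by (simp add: m_assoc)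
  have lin: "lin_hom (subgrp G A) \<nu>"
    using \<nu>1[of \<one>] \<nu>m by (auto simp: lin_hom_def)
  have "\<exists>t\<in>carrier G. eigen_avg G A \<nu> \<chi> t \<noteq> 0"
  proof (rule ccontr)
    assume "\<not> ?thesis"
    then have 0: "(\<Sum>a\<in>A. \<nu> (inv a) * \<chi> (a \<otimes> t)) = 0" if "t \<in> carrier G" for t
      using that AG.card_pos AG.fin by (auto simp: eigen_avg_def)
    obtain c where c: "\<And>t. t \<in> carrier G \<Longrightarrow> f t = (\<Sum>a\<in>A. c a * \<chi> (a \<otimes> t))"
      using f unfolding trans_span_def by blast
    have ia: "\<nu> (inv a) * \<nu> a = 1" if "a \<in> A" for a
      using \<nu>m[of "inv a" a] \<nu>1[of \<one>] that by simp
    have "of_nat (card A) * f t1 = (\<Sum>a\<in>A. \<nu> (inv a) * f (a \<otimes> t1))"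
    proof -
      have "\<nu> (inv a) * f (a \<otimes> t1) = f t1" if "a \<in> A" for a
        using \<nu>[OF that f(2)] ia[OF that] by (simp add: mult.assoc[symmetric])
      then show ?thesis by simp
    qed
    also have "\<dots> = (\<Sum>a\<in>A. \<Sum>b\<in>A. c b * (\<nu> (inv a) * \<chi> (a \<otimes> (b \<otimes> t1))))"
    proof (intro sum.cong refl)
      fix a assume a: "a \<in> A"
      then have "f (a \<otimes> t1) = (\<Sum>b\<in>A. c b * \<chi> (a \<otimes> (b \<otimes> t1)))"
        using c[of "a \<otimes> t1"] trans_span_comm[OF char_in_trans_span a] f by simp
      then show "\<nu> (inv a) * f (a \<otimes> t1) = (\<Sum>b\<in>A. c b * (\<nu> (inv a) * \<chi> (a \<otimes> (b \<otimes> t1))))"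
        by (simp add: sum_distrib_left mult_ac)
    qed
    also have "\<dots> = (\<Sum>b\<in>A. c b * (\<Sum>a\<in>A. \<nu> (inv a) * \<chi> (a \<otimes> (b \<otimes> t1))))"
      by (subst sum.swap) (simp add: sum_distrib_left)
    also have "\<dots> = 0" using 0 f by simp
    finally show False using f AG.card_pos AG.fin by auto
  qed
  then show ?thesis using lin \<nu>1 by blast
qed

end

end

section \<open>Induction and Clifford chains\<close>

lemma spherical_cong:
  assumes "group G" "\<And>x. x \<in> carrier G \<Longrightarrow> \<chi> x = \<chi>' x"
  shows "spherical G \<chi> \<longleftrightarrow> spherical G \<chi>'"
proof -
  interpret group G by fact
  show ?thesis unfolding spherical_def using assms(2) by (simp cong: sum.cong)
qed

lemma lin_hom_subset:
  assumes "lin_hom (subgrp G H) \<mu>" "K \<subseteq> H"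
  shows "lin_hom (subgrp G K) \<mu>"
  using assms by (auto simp: lin_hom_def)

lemma lin_hom_mult:
  "lin_hom G \<mu> \<Longrightarrow> lin_hom G \<mu>' \<Longrightarrow> lin_hom G (\<lambda>x. \<mu> x * \<mu>' x)"
  by (auto simp: lin_hom_def)

context fin_group
begin

lemma induced_eq:
  "g \<in> carrier G \<Longrightarrow> induced G H \<mu> g =
    (\<Sum>x\<in>carrier G. if inv x \<otimes> g \<otimes> x \<in> H then \<mu> (inv x \<otimes> g \<otimes> x) else 0) / of_nat (card H)"
  by (simp add: induced_def)

lemma induced_subgrp_eq:
  assumes "subgroup T G" "t \<in> T"
  shows "induced (subgrp G T) H \<mu> t =
    (\<Sum>x\<in>T. if inv x \<otimes> t \<otimes> x \<in> H then \<mu> (inv x \<otimes> t \<otimes> x) else 0) / of_nat (card H)"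
proof -
  have "inv\<^bsub>subgrp G T\<^esub> x = inv x" if "x \<in> T" for x
    by (rule inv_subgrp[OF assms(1) that])
  then show ?thesis
    using assms(2) by (auto simp: induced_def intro!: arg_cong2[where f="(/)"] sum.cong)
qed

lemma induced_cong:
  assumes "\<And>h. h \<in> H \<Longrightarrow> \<mu> h = \<mu>' h"
  shows "induced G H \<mu> = induced G H \<mu>'"
proof -
  have "(if h \<in> H then \<mu> h else 0) = (if h \<in> H then \<mu>' h else 0)" for h using assms by simp
  then show ?thesis unfolding induced_def by presburger
qed

text \<open>With \<open>\<mu>\<close> extended by zero to \<open>l\<close>, the double sum runs over
  conjugates by \<open>x \<otimes> y\<close>, and each element of \<open>G\<close> arises as such a
  product \<open>card T\<close> times, which cancels the outer denominator.\<close>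

lemma induced_trans:
  assumes T: "subgroup T G" and H: "H \<subseteq> T" "H \<noteq> {}"
  shows "induced G T (induced (subgrp G T) H \<mu>) = induced G H \<mu>"
proof
  fix g
  show "induced G T (induced (subgrp G T) H \<mu>) g = induced G H \<mu> g"
  proof (cases "g \<in> carrier G")
    case g: True
    interpret T: subgroup T G by (rule T)
    have TG [simp]: "t \<in> T \<Longrightarrow> t \<in> carrier G" for t by (rule T.mem_carrier)
    define l where "l h = (if h \<in> H then \<mu> h else 0)" for h
    have cT: "of_nat (card T) \<noteq> (0::complex)"
      using finite_subgroup[OF T] T.one_closed by (metis card_0_eq empty_iff of_nat_eq_0_iff)
    have l: "(if inv x \<otimes> g \<otimes> x \<in> T then induced (subgrp G T) H \<mu> (inv x \<otimes> g \<otimes> x) else 0)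
        = (\<Sum>y\<in>T. l (inv (x \<otimes> y) \<otimes> g \<otimes> (x \<otimes> y))) / of_nat (card H)" if x: "x \<in> carrier G" for x
    proof (cases "inv x \<otimes> g \<otimes> x \<in> T")
      case True
      have "(if inv y \<otimes> (inv x \<otimes> g \<otimes> x) \<otimes> y \<in> H then \<mu> (inv y \<otimes> (inv x \<otimes> g \<otimes> x) \<otimes> y) else 0)
          = l (inv (x \<otimes> y) \<otimes> g \<otimes> (x \<otimes> y))" if "y \<in> T" for y
      proof -
        have "inv y \<otimes> (inv x \<otimes> g \<otimes> x) \<otimes> y = inv (x \<otimes> y) \<otimes> g \<otimes> (x \<otimes> y)"
          using x g that by (simp add: m_assoc inv_mult_group)
        then show ?thesis by (simp only: l_def)
      qed
      then have "induced (subgrp G T) H \<mu> (inv x \<otimes> g \<otimes> x)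
          = (\<Sum>y\<in>T. l (inv (x \<otimes> y) \<otimes> g \<otimes> (x \<otimes> y))) / of_nat (card H)"
        unfolding induced_subgrp_eq[OF T True] by (simp only: cong: sum.cong)
      then show ?thesis using True by simp
    next
      case False
      have "l (inv (x \<otimes> y) \<otimes> g \<otimes> (x \<otimes> y)) = 0" if y: "y \<in> T" for y
      proof (rule ccontr)
        assume "l (inv (x \<otimes> y) \<otimes> g \<otimes> (x \<otimes> y)) \<noteq> 0"
        then have "inv (x \<otimes> y) \<otimes> g \<otimes> (x \<otimes> y) \<in> T"
          using H by (auto simp: l_def split: if_splits)
        then have "y \<otimes> (inv (x \<otimes> y) \<otimes> g \<otimes> (x \<otimes> y)) \<otimes> inv y \<in> T"
          using y by auto
        moreover have "y \<otimes> (inv (x \<otimes> y) \<otimes> g \<otimes> (x \<otimes> y)) \<otimes> inv y = inv x \<otimes> g \<otimes> x"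
          using x g y by (simp add: m_assoc inv_mult_group)
        ultimately show False using False by simp
      qed
      then show ?thesis using False by simp
    qed
    have "(\<Sum>x\<in>carrier G. if inv x \<otimes> g \<otimes> x \<in> T then induced (subgrp G T) H \<mu> (inv x \<otimes> g \<otimes> x) else 0)
        = (\<Sum>x\<in>carrier G. \<Sum>y\<in>T. l (inv (x \<otimes> y) \<otimes> g \<otimes> (x \<otimes> y))) / of_nat (card H)"
      by (simp add: l sum_divide_distrib cong: sum.cong)
    also have "(\<Sum>x\<in>carrier G. \<Sum>y\<in>T. l (inv (x \<otimes> y) \<otimes> g \<otimes> (x \<otimes> y)))
        = (\<Sum>y\<in>T. \<Sum>x\<in>carrier G. l (inv (x \<otimes> y) \<otimes> g \<otimes> (x \<otimes> y)))"
      by (rule sum.swap)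
    also have "\<dots> = (\<Sum>y\<in>T. \<Sum>x\<in>carrier G. l (inv x \<otimes> g \<otimes> x))"
      by (rule sum.cong[OF refl], rule sum_mult_right) simp
    also have "\<dots> = of_nat (card T) * (\<Sum>x\<in>carrier G. l (inv x \<otimes> g \<otimes> x))" by simp
    finally show ?thesis using g cT by (simp add: induced_eq l_def)
  qed (simp add: induced_def)
qed

lemma induced_twist:
  assumes \<delta>: "lin_hom G \<delta>" and g: "g \<in> carrier G"
  shows "induced G H (\<lambda>h. \<delta> h * \<mu> h) g = \<delta> g * induced G H \<mu> g"
proof -
  have "(\<Sum>x\<in>carrier G. if inv x \<otimes> g \<otimes> x \<in> H then \<delta> (inv x \<otimes> g \<otimes> x) * \<mu> (inv x \<otimes> g \<otimes> x) else 0)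
     = (\<Sum>x\<in>carrier G. \<delta> g * (if inv x \<otimes> g \<otimes> x \<in> H then \<mu> (inv x \<otimes> g \<otimes> x) else 0))"
    using lin_hom_conj[OF \<delta>] g by (intro sum.cong) auto
  then show ?thesis using g by (simp add: induced_eq sum_distrib_left)
qed

lemma induced_self:
  assumes \<mu>: "lin_hom G \<mu>" and g: "g \<in> carrier G"
  shows "induced G (carrier G) \<mu> g = \<mu> g"
proof -
  have "(\<Sum>x\<in>carrier G. if inv x \<otimes> g \<otimes> x \<in> carrier G then \<mu> (inv x \<otimes> g \<otimes> x) else 0)
     = (\<Sum>x\<in>carrier G. \<mu> g)"
    using lin_hom_conj[OF \<mu>] g by (intro sum.cong) auto
  then show ?thesis using g one_closed by (auto simp: induced_eq)
qed

text \<open>As \<open>\<mu>\<close> is invariant under \<open>G\<close> on \<open>N\<close>, a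
  factor \<open>n\<close> leaves every summand as the same \<open>\<mu> n\<close>. This says that
  the induced function lies over \<open>\<mu>\<close> on \<open>N\<close>, as needed to analyse one
  step of a chain.\<close>

lemma induced_mult_stable:
  assumes H: "subgroup H G" and \<mu>: "lin_hom (subgrp G H) \<mu>" and N: "N \<lhd> G" "N \<subseteq> H"
    and st: "\<And>x n. x \<in> carrier G \<Longrightarrow> n \<in> N \<Longrightarrow> \<mu> (inv x \<otimes> n \<otimes> x) = \<mu> n"
    and n: "n \<in> N" and g: "g \<in> carrier G"
  shows "induced G H \<mu> (n \<otimes> g) = \<mu> n * induced G H \<mu> g"
proof -
  interpret H: subgroup H G by fact
  interpret N: normal N G by fact
  note [simp] = H.mem_carrier N.mem_carrier
  have "(if inv x \<otimes> (n \<otimes> g) \<otimes> x \<in> H then \<mu> (inv x \<otimes> (n \<otimes> g) \<otimes> x) else 0)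
      = \<mu> n * (if inv x \<otimes> g \<otimes> x \<in> H then \<mu> (inv x \<otimes> g \<otimes> x) else 0)"
    if x: "x \<in> carrier G" for x
  proof -
    let ?m = "inv x \<otimes> n \<otimes> x"
    have e: "inv x \<otimes> (n \<otimes> g) \<otimes> x = ?m \<otimes> (inv x \<otimes> g \<otimes> x)"
      using x n g by (simp add: m_assoc)
    have "?m \<in> N" using x n by (auto intro: N.inv_op_closed1)
    then have m: "?m \<in> H" using N by blast
    have "?m \<otimes> (inv x \<otimes> g \<otimes> x) \<in> H \<longleftrightarrow> inv x \<otimes> g \<otimes> x \<in> H"
    proof
      assume a: "?m \<otimes> (inv x \<otimes> g \<otimes> x) \<in> H"
      have "inv ?m \<otimes> (?m \<otimes> (inv x \<otimes> g \<otimes> x)) \<in> H" using a m by blast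
      moreover have "inv ?m \<otimes> (?m \<otimes> (inv x \<otimes> g \<otimes> x)) = inv x \<otimes> g \<otimes> x"
        using x n g by (intro mult_inv_cancel) auto
      ultimately show "inv x \<otimes> g \<otimes> x \<in> H" by simp
    qed (use m in blast)
    moreover have "\<mu> (?m \<otimes> (inv x \<otimes> g \<otimes> x)) = \<mu> n * \<mu> (inv x \<otimes> g \<otimes> x)" if "inv x \<otimes> g \<otimes> x \<in> H"
      using \<mu> m that st[OF x n] by (simp add: lin_hom_def)
    ultimately show ?thesis unfolding e by simp
  qed
  then have "(\<Sum>x\<in>carrier G. if inv x \<otimes> (n \<otimes> g) \<otimes> x \<in> H then \<mu> (inv x \<otimes> (n \<otimes> g) \<otimes> x) else 0)
     = \<mu> n * (\<Sum>x\<in>carrier G. if inv x \<otimes> g \<otimes> x \<in> H then \<mu> (inv x \<otimes> g \<otimes> x) else 0)"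
    by (simp add: sum_distrib_left cong: sum.cong)
  then show ?thesis using n g by (simp add: induced_eq)
qed

end

text \<open>Read upwards: \<open>H\<close> and its character stay fixed, and each step passes from
  an inertia group to the group in which it was formed. The normal subgroup lies in
  \<open>H\<close>, so its character is just \<open>\<mu>\<close> and need not be recorded.
  Sphericity of the induced function is carried along instead of being derived.\<close>

inductive clifford_chain :: "('a, 'b) monoid_scheme \<Rightarrow> 'a set \<Rightarrow> 'a set \<Rightarrow> ('a \<Rightarrow> complex) \<Rightarrow> bool" for M where
  base: "subgroup H M \<Longrightarrow> lin_hom (subgrp M H) \<mu> \<Longrightarrow> clifford_chain M H H \<mu>"
| step: "clifford_chain M T H \<mu> \<Longrightarrow> subgroup B M \<Longrightarrow> N \<lhd> subgrp M B \<Longrightarrow> N \<subseteq> H \<Longrightarrow>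
    T = stabilizer (subgrp M B) N \<mu> \<Longrightarrow> spherical (subgrp M B) (induced (subgrp M B) H \<mu>) \<Longrightarrow>
    clifford_chain M B H \<mu>"

context fin_group
begin

lemma clifford_chainD:
  assumes "clifford_chain G B H \<mu>"
  shows "subgroup B G" "subgroup H G" "H \<subseteq> B" "lin_hom (subgrp G H) \<mu>"
    "spherical (subgrp G B) (induced (subgrp G B) H \<mu>)"
proof -
  from assms have "subgroup B G \<and> subgroup H G \<and> H \<subseteq> B \<and> lin_hom (subgrp G H) \<mu> \<and>
    spherical (subgrp G B) (induced (subgrp G B) H \<mu>)"
  proof induction
    case (base H \<mu>)
    interpret H: fin_group "subgrp G H" by (rule subgroup_fin_group) fact
    have "induced (subgrp G H) H \<mu> h = \<mu> h" if "h \<in> H" for h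
      using H.induced_self[OF base(2)] that by simp
    then have "spherical (subgrp G H) (induced (subgrp G H) H \<mu>) = spherical (subgrp G H) \<mu>"
      by (intro spherical_cong) (simp_all add: H.is_group)
    then show ?case using base H.spherical_lin_hom by blast
  next
    case (step T H \<mu> B N)
    then show ?case by (auto simp: stabilizer_def)
  qed
  then show "subgroup B G" "subgroup H G" "H \<subseteq> B" "lin_hom (subgrp G H) \<mu>"
    "spherical (subgrp G B) (induced (subgrp G B) H \<mu>)" by blast+
qed

text \<open>A linear character of \<open>B\<close> is invariant under \<open>B\<close> and has no
  zeros, so multiplying by it changes none of the stabilizers in the chain, and it commutes with
  induction.\<close>

lemma clifford_chain_twist:
  assumes "clifford_chain G B H \<mu>" "lin_hom (subgrp G B) \<delta>"
  shows "clifford_chain G B H (\<lambda>x. \<delta> x * \<mu> x)"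
  using assms
proof induction
  case (base H \<mu>)
  then show ?case by (intro clifford_chain.base lin_hom_mult) auto
next
  case (step T H \<mu> B N)
  interpret B: fin_group "subgrp G B" by (rule subgroup_fin_group) fact
  interpret N: normal N "subgrp G B" by fact
  have TB: "T \<subseteq> B" using step by (auto simp: stabilizer_def)
  have "clifford_chain G T H (\<lambda>x. \<delta> x * \<mu> x)"
    using step lin_hom_subset[OF step.prems TB] by blast
  moreover have "T = stabilizer (subgrp G B) N (\<lambda>x. \<delta> x * \<mu> x)"
  proof -
    have "\<delta> (inv\<^bsub>subgrp G B\<^esub> t \<otimes> n \<otimes> t) = \<delta> n" "\<delta> n \<noteq> 0" if "t \<in> B" "n \<in> N" for t n
      using B.lin_hom_conj[OF step.prems, of t n] B.lin_hom_inv(2)[OF step.prems, of n] that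
        N.mem_carrier[of n] by auto
    then show ?thesis using step(5) by (auto simp: stabilizer_def)
  qed
  moreover have "spherical (subgrp G B) (induced (subgrp G B) H (\<lambda>x. \<delta> x * \<mu> x))"
  proof -
    have "spherical (subgrp G B) (induced (subgrp G B) H (\<lambda>x. \<delta> x * \<mu> x))
      = spherical (subgrp G B) (\<lambda>x. \<delta> x * induced (subgrp G B) H \<mu> x)"
      using B.induced_twist[OF step.prems] by (intro spherical_cong B.is_group)
    then show ?thesis using B.spherical_twist[OF step(6) step.prems] by simp
  qed
  ultimately show ?case using step by (intro clifford_chain.step[of _ T _ _ B N])
qed

end

section \<open>Galois conjugation and orthogonality\<close>

abbreviation "cfield \<equiv> (ring_of_type_algebra :: complex ring)"

lemma cfield_simps [simp]:
  "carrier cfield = UNIV" "x \<otimes>\<^bsub>cfield\<^esub> y = x * y" "x \<oplus>\<^bsub>cfield\<^esub> y = x + y"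
  "\<one>\<^bsub>cfield\<^esub> = 1" "\<zero>\<^bsub>cfield\<^esub> = 0"
  by (simp_all add: ring_of_type_algebra_def)

lemma cfield_a_inv [simp]: "\<ominus>\<^bsub>cfield\<^esub> x = - x"
proof -
  interpret R: field cfield by (rule field_from_type_algebra)
  show ?thesis by (rule R.minus_equality) auto
qed

lemma cfield_m_inv [simp]: "x \<noteq> 0 \<Longrightarrow> inv\<^bsub>cfield\<^esub> x = inverse x"
proof -
  interpret R: field cfield by (rule field_from_type_algebra)
  assume "x \<noteq> 0"
  then show ?thesis by (intro R.comm_inv_char) auto
qed

lemma generate_field_closed:
  fixes Z :: "complex set"
  defines "K \<equiv> generate_field cfield Z"
  shows "1 \<in> K" "x \<in> Z \<Longrightarrow> x \<in> K" "x \<in> K \<Longrightarrow> y \<in> K \<Longrightarrow> x + y \<in> K"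
    "x \<in> K \<Longrightarrow> y \<in> K \<Longrightarrow> x * y \<in> K" "x \<in> K \<Longrightarrow> - x \<in> K" "0 \<in> K"
    "x \<in> K \<Longrightarrow> inverse x \<in> K"
proof -
  interpret R: field cfield by (rule field_from_type_algebra)
  show "1 \<in> K" "x \<in> Z \<Longrightarrow> x \<in> K" "x \<in> K \<Longrightarrow> y \<in> K \<Longrightarrow> x + y \<in> K"
    "x \<in> K \<Longrightarrow> y \<in> K \<Longrightarrow> x * y \<in> K" "x \<in> K \<Longrightarrow> - x \<in> K"
    unfolding K_def
    using generate_field.one[of cfield Z] generate_field.incl[of x Z cfield] generate_field.eng_add[of x cfield Z y]
      generate_field.eng_mult[of x cfield Z y] generate_field.a_inv[of x cfield Z] by simp_all
  show 0: "0 \<in> K" unfolding K_def using R.zero_in_generate by simp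
  \<comment> \<open>Zero is no exception because \<open>inverse 0 = 0\<close> in HOL.\<close>
  show "x \<in> K \<Longrightarrow> inverse x \<in> K"
    using generate_field.m_inv[of x cfield Z] 0 unfolding K_def by (cases "x = 0") simp_all
qed

lemma Rats_subset_generate_field: "\<rat> \<subseteq> generate_field cfield Z"
proof
  fix q :: complex assume "q \<in> \<rat>"
  then obtain a b :: int where ab: "b > 0" "q = of_int a / of_int b" by (rule Rats_cases')
  have nat: "of_nat n \<in> generate_field cfield Z" for n
    by (induction n) (auto intro: generate_field_closed)
  have int: "of_int z \<in> generate_field cfield Z" for z
  proof (cases z)
    case (nonneg n) then show ?thesis using nat[of n] by simp
  next
    case (neg n) then show ?thesis
      using generate_field_closed(5)[OF nat[of "Suc n"]] by (simp del: of_nat_Suc)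
  qed
  show "q \<in> generate_field cfield Z"
    using ab int by (simp add: divide_inverse generate_field_closed(4,7))
qed

lemma galois_group_Rats_iff:
  "\<sigma> \<in> galois_group_Rats K \<longleftrightarrow> \<sigma> \<in> extensional K \<and> bij_betw \<sigma> K K \<and> \<sigma> 1 = 1 \<and>
     (\<forall>x\<in>K. \<forall>y\<in>K. \<sigma> (x + y) = \<sigma> x + \<sigma> y \<and> \<sigma> (x * y) = \<sigma> x * \<sigma> y) \<and> (\<forall>q\<in>\<rat>. \<sigma> q = q)"
proof -
  have "bij_betw \<sigma> K K \<Longrightarrow> \<sigma> \<in> K \<rightarrow> K" by (auto simp: bij_betw_def)
  then show ?thesis
    by (auto simp: galois_group_Rats_def ring_iso_def Ring.ring_hom_def)
qed

context
  fixes Z K :: "complex set"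
  assumes K: "K = generate_field cfield Z"
begin

lemma galois_id: "(\<lambda>x\<in>K. x) \<in> galois_group_Rats K"
proof -
  have "bij_betw (\<lambda>x\<in>K. x) K K" by (rule bij_betwI[where g="\<lambda>x. x"]) auto
  then show ?thesis
    using generate_field_closed[where Z=Z] Rats_subset_generate_field[of Z]
    by (auto simp: galois_group_Rats_iff K)
qed

lemma galois_comp:
  assumes "\<sigma> \<in> galois_group_Rats K" "\<tau> \<in> galois_group_Rats K"
  shows "compose K \<sigma> \<tau> \<in> galois_group_Rats K"
proof -
  have "bij_betw (compose K \<sigma> \<tau>) K K"
    using assms by (auto simp: galois_group_Rats_iff intro: bij_betw_compose)
  moreover have "\<tau> x \<in> K" if "x \<in> K" for x
    using assms that by (auto simp: galois_group_Rats_iff bij_betw_def)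
  ultimately show ?thesis
    using assms generate_field_closed[where Z=Z] Rats_subset_generate_field[of Z]
    by (auto simp: galois_group_Rats_iff compose_def K subset_iff)
qed

lemma galois_inv:
  assumes "\<sigma> \<in> galois_group_Rats K"
  shows "restrict (inv_into K \<sigma>) K \<in> galois_group_Rats K"
proof -
  let ?t = "inv_into K \<sigma>"
  have b: "bij_betw \<sigma> K K" using assms by (simp add: galois_group_Rats_iff)
  have inj: "inj_on \<sigma> K" and im: "\<sigma> ` K = K" using b by (auto simp: bij_betw_def)
  have tK: "?t x \<in> K" "\<sigma> (?t x) = x" if "x \<in> K" for x
    using that im inv_into_into[of x \<sigma> K] f_inv_into_f[of x \<sigma> K] by auto
  have eq: "?t y = x" if "x \<in> K" "\<sigma> x = y" for x y
    using inj that by auto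
  have cl: "x + y \<in> K" "x * y \<in> K" if "x \<in> K" "y \<in> K" for x y
    using that generate_field_closed[where Z=Z] by (auto simp: K)
  have Q: "q \<in> K" if "q \<in> \<rat>" for q using that Rats_subset_generate_field[of Z] by (auto simp: K)
  have "bij_betw (restrict ?t K) K K"
    using bij_betw_inv_into[OF b] by (simp cong: bij_betw_cong)
  moreover have "?t (x + y) = ?t x + ?t y" "?t (x * y) = ?t x * ?t y" if "x \<in> K" "y \<in> K" for x y
    using assms tK[OF that(1)] tK[OF that(2)] cl
    by (auto intro!: eq simp: galois_group_Rats_iff)
  moreover have "?t q = q" if "q \<in> \<rat>" for q
    using assms that Q by (intro eq) (auto simp: galois_group_Rats_iff)
  ultimately show ?thesis using cl Q by (auto simp: galois_group_Rats_iff)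
qed

text \<open>With \<open>Z\<close> the set of values of \<open>\<chi>\<close>, this identifies an
  automorphism with the Galois conjugate of \<open>\<chi>\<close> that it produces; distinct
  automorphisms give distinct conjugates.\<close>

lemma galois_determined:
  assumes "\<sigma> \<in> galois_group_Rats K" "\<tau> \<in> galois_group_Rats K" "\<And>x. x \<in> Z \<Longrightarrow> \<sigma> x = \<tau> x"
  shows "\<sigma> = \<tau>"
proof -
  note cl = generate_field_closed[where Z=Z, folded K]
  have s: "\<sigma> (x + y) = \<sigma> x + \<sigma> y" "\<sigma> (x * y) = \<sigma> x * \<sigma> y" "\<tau> (x + y) = \<tau> x + \<tau> y" "\<tau> (x * y) = \<tau> x * \<tau> y"
    "\<sigma> 1 = 1" "\<tau> 1 = 1" "\<sigma> 0 = 0" "\<tau> 0 = 0" if "x \<in> K" "y \<in> K" for x y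
    using assms(1,2) that by (auto simp: galois_group_Rats_iff)
  have "\<sigma> x = \<tau> x" if "x \<in> generate_field cfield Z" for x
    using that
  proof induction
    case one
    then show ?case using s cl by simp
  next
    case (incl h) then show ?case using assms(3) by simp
  next
    case (a_inv h)
    then have h: "h \<in> K" "- h \<in> K" using cl by (auto simp: K)
    have "\<sigma> (- h) + \<sigma> h = 0" "\<tau> (- h) + \<tau> h = 0" using s(1,3)[of "- h" h] s(7,8) h by auto
    then show ?case using a_inv by (simp add: eq_neg_iff_add_eq_0[symmetric])
  next
    case (m_inv h)
    then have h: "h \<in> K" "inverse h \<in> K" "h \<noteq> 0" using cl by (auto simp: K)
    have "\<sigma> (inverse h) * \<sigma> h = 1" "\<tau> (inverse h) * \<tau> h = 1"
      using s(2,4)[of "inverse h" h] s(5,6) h by auto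
    then have "\<sigma> (inverse h) = \<tau> (inverse h)"
      using m_inv by (metis mult_cancel_right mult_zero_right zero_neq_one)
    then show ?case using h by simp
  next
    case (eng_add h1 h2)
    then show ?case using s by (simp add: K)
  next
    case (eng_mult h1 h2)
    then show ?case using s by (simp add: K)
  qed
  then show ?thesis using assms
    by (intro extensionalityI[of _ K]) (auto simp: galois_group_Rats_iff K)
qed

end

text \<open>Used to see that the Galois group in the definition of \<^const>\<open>e_rat\<close> is finite; a sum over
  an infinite Galois group would be the junk value \<open>0\<close>.\<close>

lemma finite_orthogonal:
  fixes F :: "('a \<Rightarrow> complex) set"
  assumes S: "finite S" and supp: "\<And>f x. f \<in> F \<Longrightarrow> x \<notin> S \<Longrightarrow> f x = 0"
    and orth: "\<And>f f'. f \<in> F \<Longrightarrow> f' \<in> F \<Longrightarrow> f \<noteq> f' \<Longrightarrow> (\<Sum>x\<in>S. f x * f' (i x)) = 0"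
    and norm: "\<And>f. f \<in> F \<Longrightarrow> (\<Sum>x\<in>S. f x * f (i x)) \<noteq> 0"
  shows "finite F"
proof -
  interpret V: vector_space "\<lambda>c (f :: 'a \<Rightarrow> complex) x. c * f x"
    by unfold_locales (auto simp: fun_eq_iff algebra_simps)
  have fs: "(\<Sum>v\<in>A. (h v :: 'a \<Rightarrow> complex)) x = (\<Sum>v\<in>A. h v x)" for A h x
    by (induction A rule: infinite_finite_induct) auto
  have "V.independent F"
    unfolding V.dependent_explicit
  proof clarify
    fix A u v assume A: "finite A" "A \<subseteq> F" "(\<Sum>v\<in>A. (\<lambda>x. u v * v x)) = 0" "v \<in> A" "u v \<noteq> 0"
    have z: "(\<Sum>w\<in>A. u w * w x) = 0" for x
      using A(3) fs[of "\<lambda>v x. u v * v x" A x] by simp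
    have "0 = (\<Sum>x\<in>S. (\<Sum>w\<in>A. u w * w x) * v (i x))" by (simp add: z)
    also have "\<dots> = (\<Sum>w\<in>A. u w * (\<Sum>x\<in>S. w x * v (i x)))"
      unfolding sum_distrib_left sum_distrib_right mult.assoc by (rule sum.swap)
    also have "\<dots> = (\<Sum>w\<in>A. if w = v then u v * (\<Sum>x\<in>S. v x * v (i x)) else 0)"
      using A orth[of _ v] by (intro sum.cong) auto
    also have "\<dots> = u v * (\<Sum>x\<in>S. v x * v (i x))" using A by simp
    finally show False using norm[of v] A by auto
  qed
  moreover have "F \<subseteq> V.span (ga_of ` S)"
  proof
    fix f assume f: "f \<in> F"
    have "f = (\<Sum>s\<in>S. (\<lambda>x. f s * ga_of s x))"
    proof
      fix x
      have "(\<Sum>s\<in>S. f s * ga_of s x) = (\<Sum>s\<in>S. if s = x then f x else 0)"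
        by (intro sum.cong) (auto simp: ga_of_def)
      then show "f x = (\<Sum>s\<in>S. (\<lambda>x. f s * ga_of s x)) x"
        unfolding fs using S supp[OF f, of x] by auto
    qed
    also have "\<dots> \<in> V.span (ga_of ` S)"
      by (intro V.span_sum V.span_scale V.span_base) auto
    finally show "f \<in> V.span (ga_of ` S)" .
  qed
  ultimately show ?thesis using V.independent_span_bound[of "ga_of ` S" F] S by blast
qed

section \<open>Convolution of spherical functions\<close>

context fin_group
begin

text \<open>Pair the spherical identity of \<open>\<phi>\<close> with \<open>\<psi>\<close> in the
  variable \<open>h\<close>. Since \<open>\<psi>\<close> is a class function, the average over
  \<open>x\<close> collapses.\<close>

lemma spherical_convolution:
  assumes \<phi>: "spherical G \<phi>" and \<psi>: "spherical G \<psi>" and g: "g \<in> carrier G"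
  shows "\<phi> g * (\<Sum>h\<in>carrier G. \<phi> h * \<psi> (inv h)) = \<phi> \<one> * (\<Sum>h\<in>carrier G. \<phi> (g \<otimes> h) * \<psi> (inv h))"
proof -
  have c0: "of_nat (card (carrier G)) \<noteq> (0::complex)"
    using card_pos by (metis of_nat_eq_0_iff less_irrefl)
  have "(\<phi> g * (\<Sum>h\<in>carrier G. \<phi> h * \<psi> (inv h))) * of_nat (card (carrier G))
      = (\<Sum>h\<in>carrier G. (\<phi> g * \<phi> h * of_nat (card (carrier G))) * \<psi> (inv h))"
    by (simp add: sum_distrib_left sum_distrib_right mult_ac)
  also have "\<dots> = (\<Sum>h\<in>carrier G. \<phi> \<one> * (\<Sum>x\<in>carrier G. \<phi> (g \<otimes> (inv x \<otimes> h \<otimes> x))) * \<psi> (inv h))"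
    using g by (intro sum.cong[OF refl]) (simp add: spherical_eq[OF \<phi>])
  also have "\<dots> = \<phi> \<one> * (\<Sum>h\<in>carrier G. \<Sum>x\<in>carrier G. \<phi> (g \<otimes> (inv x \<otimes> h \<otimes> x)) * \<psi> (inv h))"
    by (simp add: sum_distrib_left sum_distrib_right mult_ac)
  also have "(\<Sum>h\<in>carrier G. \<Sum>x\<in>carrier G. \<phi> (g \<otimes> (inv x \<otimes> h \<otimes> x)) * \<psi> (inv h))
     = (\<Sum>x\<in>carrier G. \<Sum>h\<in>carrier G. \<phi> (g \<otimes> (inv x \<otimes> h \<otimes> x)) * \<psi> (inv h))"
    by (rule sum.swap)
  also have "\<dots> = (\<Sum>x\<in>carrier G. \<Sum>h\<in>carrier G. \<phi> (g \<otimes> h) * \<psi> (inv h))"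
  proof (rule sum.cong[OF refl])
    fix x assume x: "x \<in> carrier G"
    have "(\<Sum>h\<in>carrier G. \<phi> (g \<otimes> (inv x \<otimes> h \<otimes> x)) * \<psi> (inv h))
        = (\<Sum>h\<in>carrier G. \<phi> (g \<otimes> (inv x \<otimes> h \<otimes> x)) * \<psi> (inv (inv x \<otimes> h \<otimes> x)))"
    proof (rule sum.cong[OF refl])
      fix h assume h: "h \<in> carrier G"
      have "inv (inv x \<otimes> h \<otimes> x) = inv x \<otimes> inv h \<otimes> x"
        using h x by (simp add: inv_mult_group m_assoc)
      then show "\<phi> (g \<otimes> (inv x \<otimes> h \<otimes> x)) * \<psi> (inv h)
        = \<phi> (g \<otimes> (inv x \<otimes> h \<otimes> x)) * \<psi> (inv (inv x \<otimes> h \<otimes> x))"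
        using spherical_class_fun[OF \<psi>, of "inv h" x] h x by simp
    qed
    also have "\<dots> = (\<Sum>h\<in>carrier G. \<phi> (g \<otimes> h) * \<psi> (inv h))"
      by (rule sum_conj[OF x])
    finally show "(\<Sum>h\<in>carrier G. \<phi> (g \<otimes> (inv x \<otimes> h \<otimes> x)) * \<psi> (inv h))
        = (\<Sum>h\<in>carrier G. \<phi> (g \<otimes> h) * \<psi> (inv h))" .
  qed
  also have "\<phi> \<one> * \<dots> = (\<phi> \<one> * (\<Sum>h\<in>carrier G. \<phi> (g \<otimes> h) * \<psi> (inv h))) * of_nat (card (carrier G))"
    by simp
  finally show ?thesis using c0 by (rule mult_right_cancel[THEN iffD1, rotated])
qed

text \<open>The convolution at \<open>g0\<close> is symmetric in \<open>\<phi>\<close> and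
  \<open>\<psi>\<close>, and up to the common degree it is the pairing times the value at
  \<open>g0\<close> of either function. Different values force the pairing to be 0. Galois
  conjugates meet the condition on the degree because the degree is rational.\<close>

lemma spherical_orthogonal:
  assumes \<phi>: "spherical G \<phi>" and \<psi>: "spherical G \<psi>" and one: "\<phi> \<one> = \<psi> \<one>"
    and ne: "g0 \<in> carrier G" "\<phi> g0 \<noteq> \<psi> g0"
  shows "(\<Sum>h\<in>carrier G. \<phi> h * \<psi> (inv h)) = 0"
    and "\<And>g. g \<in> carrier G \<Longrightarrow> (\<Sum>h\<in>carrier G. \<phi> (g \<otimes> h) * \<psi> (inv h)) = 0"
proof -
  let ?P = "\<Sum>h\<in>carrier G. \<phi> h * \<psi> (inv h)"
  have P': "(\<Sum>h\<in>carrier G. \<psi> h * \<phi> (inv h)) = ?P"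
    using sum_inv[of "\<lambda>h. \<phi> h * \<psi> (inv h)"] by (simp add: mult.commute)
  have "(\<Sum>h\<in>carrier G. \<psi> (g0 \<otimes> h) * \<phi> (inv h)) = (\<Sum>h\<in>carrier G. \<phi> (g0 \<otimes> h) * \<psi> (inv h))"
  proof -
    have "(\<Sum>h\<in>carrier G. \<psi> (g0 \<otimes> h) * \<phi> (inv h))
        = (\<Sum>h\<in>carrier G. \<psi> (g0 \<otimes> (inv g0 \<otimes> h)) * \<phi> (inv (inv g0 \<otimes> h)))"
      using sum_mult_left[of "inv g0" "\<lambda>h. \<psi> (g0 \<otimes> h) * \<phi> (inv h)"] ne by simp
    also have "\<dots> = (\<Sum>h\<in>carrier G. \<psi> h * \<phi> (inv h \<otimes> g0))"
      using ne by (intro sum.cong) (auto simp: inv_mult_group)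
    also have "\<dots> = (\<Sum>h\<in>carrier G. \<psi> (inv h) * \<phi> (h \<otimes> g0))"
      using sum_inv[of "\<lambda>h. \<psi> h * \<phi> (inv h \<otimes> g0)"] by (simp cong: sum.cong)
    also have "\<dots> = (\<Sum>h\<in>carrier G. \<phi> (g0 \<otimes> h) * \<psi> (inv h))"
      using ne spherical_comm[OF \<phi>, of _ g0] by (intro sum.cong) auto
    finally show ?thesis .
  qed
  then have "\<phi> g0 * ?P = \<psi> g0 * ?P"
    using spherical_convolution[OF \<phi> \<psi> ne(1)] spherical_convolution[OF \<psi> \<phi> ne(1)] one P' by simp
  then show P: "?P = 0" using ne by auto
  show "(\<Sum>h\<in>carrier G. \<phi> (g \<otimes> h) * \<psi> (inv h)) = 0" if "g \<in> carrier G" for g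
    using spherical_convolution[OF \<phi> \<psi> that] P spherical_one_neq_0[OF \<phi>] by simp
qed

section \<open>Products and conjugates in the group algebra, coefficientwise\<close>

lemma ga_mult_eq:
  assumes "\<And>h. h \<notin> carrier G \<Longrightarrow> \<beta> h = 0"
  shows "ga_mult G \<alpha> \<beta> x = (if x \<in> carrier G then \<Sum>g\<in>carrier G. \<alpha> g * \<beta> (inv g \<otimes> x) else 0)"
proof -
  have "(\<Sum>h\<in>carrier G. \<alpha> g * \<beta> h * ga_of (g \<otimes> h) x) = (if x \<in> carrier G then \<alpha> g * \<beta> (inv g \<otimes> x) else 0)"
    if g: "g \<in> carrier G" for g
  proof (cases "x \<in> carrier G")
    case True
    have "(\<Sum>h\<in>carrier G. \<alpha> g * \<beta> h * ga_of (g \<otimes> h) x)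
        = (\<Sum>h\<in>carrier G. if h = inv g \<otimes> x then \<alpha> g * \<beta> h else 0)"
      using g True by (intro sum.cong) (auto simp: ga_of_def)
    then show ?thesis using g True by simp
  next
    case False
    then have "ga_of (g \<otimes> h) x = 0" if "h \<in> carrier G" for h
      using g that by (auto simp: ga_of_def)
    then show ?thesis using False by simp
  qed
  then show ?thesis by (simp add: ga_mult_def)
qed

lemma ga_conj_eq:
  assumes supp: "\<And>h. h \<notin> carrier G \<Longrightarrow> \<alpha> h = 0" and b: "b \<in> carrier G"
  shows "ga_conj G \<alpha> b x = (if x \<in> carrier G then \<alpha> (b \<otimes> x \<otimes> inv b) else 0)"
proof -
  have 1: "ga_mult G (ga_of (inv b)) \<alpha> x = (if x \<in> carrier G then \<alpha> (b \<otimes> x) else 0)" for x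
  proof (cases "x \<in> carrier G")
    case True
    have "(\<Sum>g\<in>carrier G. ga_of (inv b) g * \<alpha> (inv g \<otimes> x))
      = (\<Sum>g\<in>carrier G. if g = inv b then \<alpha> (inv g \<otimes> x) else 0)"
      by (intro sum.cong) (auto simp: ga_of_def)
    then show ?thesis using b True by (simp add: ga_mult_eq[OF supp])
  qed (simp add: ga_mult_eq[OF supp])
  have ob: "ga_of b h = 0" if "h \<notin> carrier G" for h
    using b that by (auto simp: ga_of_def)
  show ?thesis
  proof (cases "x \<in> carrier G")
    case True
    have "ga_mult G (ga_mult G (ga_of (inv b)) \<alpha>) (ga_of b) x
       = (\<Sum>g\<in>carrier G. \<alpha> (b \<otimes> g) * ga_of b (inv g \<otimes> x))"
      using True by (simp add: ga_mult_eq[OF ob] 1 cong: sum.cong)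
    also have "\<dots> = (\<Sum>g\<in>carrier G. if g = x \<otimes> inv b then \<alpha> (b \<otimes> g) else 0)"
    proof (rule sum.cong[OF refl])
      fix g assume g: "g \<in> carrier G"
      have "inv g \<otimes> x = b \<longleftrightarrow> g = x \<otimes> inv b"
        using g b True by (metis inv_closed inv_solve_left inv_solve_right m_closed)
      then show "\<alpha> (b \<otimes> g) * ga_of b (inv g \<otimes> x) = (if g = x \<otimes> inv b then \<alpha> (b \<otimes> g) else 0)"
        by (simp add: ga_of_def)
    qed
    also have "\<dots> = \<alpha> (b \<otimes> x \<otimes> inv b)" using b True by (simp add: m_assoc)
    finally show ?thesis using True by (simp add: ga_conj_def)
  next
    case False
    have "ga_mult G (ga_mult G (ga_of (inv b)) \<alpha>) (ga_of b) x = 0"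
      using False by (simp add: ga_mult_eq[OF ob])
    then show ?thesis using False by (simp add: ga_conj_def)
  qed
qed

lemma e_char_eq:
  "e_char G \<phi> x = (if x \<in> carrier G then \<phi> \<one> / of_nat (card (carrier G)) * \<phi> (inv x) else 0)"
proof (cases "x \<in> carrier G")
  case True
  have "(\<Sum>g\<in>carrier G. \<phi> g * ga_of (inv g) x) = (\<Sum>g\<in>carrier G. if g = inv x then \<phi> g else 0)"
    using True by (intro sum.cong) (auto simp: ga_of_def)
  then show ?thesis using True by (simp add: e_char_def Coset.order_def)
next
  case False
  then have "ga_of (inv g) x = 0" if "g \<in> carrier G" for g using that by (auto simp: ga_of_def)
  then show ?thesis using False by (simp add: e_char_def)
qed

end

section \<open>Steps of a strong inductive chain\<close>

context fin_group
begin

lemma spherical_conj: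
  assumes sT: "subgroup T G" and b: "b \<in> carrier G"
    and nb: "\<And>t. t \<in> T \<Longrightarrow> b \<otimes> t \<otimes> inv b \<in> T" "\<And>t. t \<in> T \<Longrightarrow> inv b \<otimes> t \<otimes> b \<in> T"
    and \<phi>: "spherical (subgrp G T) \<phi>"
  shows "spherical (subgrp G T) (\<lambda>t. \<phi> (b \<otimes> t \<otimes> inv b))"
proof -
  interpret T: subgroup T G by fact
  note [simp] = T.mem_carrier inv_subgrp[OF sT]
  let ?c = "\<lambda>t. b \<otimes> t \<otimes> inv b"
  have re: "(\<Sum>t\<in>T. f (?c t)) = (\<Sum>t\<in>T. f t)" for f :: "'a \<Rightarrow> complex"
    by (rule sum.reindex_bij_witness[where i="\<lambda>t. inv b \<otimes> t \<otimes> b" and j="?c"])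
       (use b nb in \<open>auto simp: m_assoc\<close>)
  have ci: "?c (inv t) = inv (?c t)" if "t \<in> T" for t
    using that b by (simp add: inv_mult_group m_assoc)
  have cm: "?c (s \<otimes> t) = ?c s \<otimes> ?c t" if "s \<in> T" "t \<in> T" for s t
    using that b by (simp add: m_assoc)
  have S: "\<phi> \<one> \<in> \<rat>" "Re (\<phi> \<one>) > 0" "(\<Sum>g\<in>T. \<phi> g * \<phi> (inv g)) = of_nat (card T)"
    "\<And>g h. g \<in> T \<Longrightarrow> h \<in> T \<Longrightarrow> \<phi> g * \<phi> h * of_nat (card T) = \<phi> \<one> * (\<Sum>x\<in>T. \<phi> (g \<otimes> (inv x \<otimes> h \<otimes> x)))"
    using \<phi> by (simp_all add: spherical_def cong: sum.cong)
  have "(\<Sum>g\<in>T. \<phi> (?c g) * \<phi> (?c (inv g))) = of_nat (card T)"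
    using re[of "\<lambda>g. \<phi> g * \<phi> (inv g)"] S(3) by (simp add: ci cong: sum.cong)
  moreover have "\<phi> (?c g) * \<phi> (?c h) * of_nat (card T) = \<phi> \<one> * (\<Sum>x\<in>T. \<phi> (?c (g \<otimes> (inv x \<otimes> h \<otimes> x))))"
    if "g \<in> T" "h \<in> T" for g h
  proof -
    have "(\<Sum>x\<in>T. \<phi> (?c (g \<otimes> (inv x \<otimes> h \<otimes> x)))) = (\<Sum>x\<in>T. \<phi> (?c g \<otimes> (inv (?c x) \<otimes> ?c h \<otimes> ?c x)))"
      using that by (intro sum.cong refl) (simp only: cm ci T.m_closed T.m_inv_closed)
    also have "\<dots> = (\<Sum>x\<in>T. \<phi> (?c g \<otimes> (inv x \<otimes> ?c h \<otimes> x)))"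
      by (rule re)
    finally show ?thesis using S(4)[OF nb(1)[OF that(1)] nb(1)[OF that(2)]] by simp
  qed
  ultimately show ?thesis using b S(1,2) by (simp add: spherical_def cong: sum.cong)
qed

lemma ga_conj_comp:
  assumes "\<And>h. h \<notin> carrier G \<Longrightarrow> \<alpha> h = 0" "g \<in> carrier G" "h \<in> carrier G"
  shows "ga_conj G (ga_conj G \<alpha> g) h = ga_conj G \<alpha> (g \<otimes> h)"
proof
  fix x
  have s: "ga_conj G \<alpha> g y = 0" if "y \<notin> carrier G" for y
    using assms(2) that by (simp add: ga_conj_eq[OF assms(1)])
  show "ga_conj G (ga_conj G \<alpha> g) h x = ga_conj G \<alpha> (g \<otimes> h) x"
    using assms(2,3) by (simp add: ga_conj_eq[OF assms(1)] ga_conj_eq[OF s] inv_mult_group m_assoc)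
qed

lemma ga_mult_conj:
  assumes "\<And>h. h \<notin> carrier G \<Longrightarrow> \<alpha> h = 0" "\<And>h. h \<notin> carrier G \<Longrightarrow> \<beta> h = 0" "g \<in> carrier G"
  shows "ga_mult G (ga_conj G \<alpha> g) (ga_conj G \<beta> g) = ga_conj G (ga_mult G \<alpha> \<beta>) g"
proof
  fix x
  have s: "ga_conj G \<beta> g y = 0" if "y \<notin> carrier G" for y
    using assms(3) that by (simp add: ga_conj_eq[OF assms(2)])
  have m: "ga_mult G \<alpha> \<beta> y = 0" if "y \<notin> carrier G" for y
    using that by (simp add: ga_mult_eq[OF assms(2)])
  show "ga_mult G (ga_conj G \<alpha> g) (ga_conj G \<beta> g) x = ga_conj G (ga_mult G \<alpha> \<beta>) g x"
  proof (cases "x \<in> carrier G")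
    case True
    have "(\<Sum>y\<in>carrier G. \<alpha> (g \<otimes> y \<otimes> inv g) * \<beta> (g \<otimes> (inv y \<otimes> x) \<otimes> inv g))
      = (\<Sum>y\<in>carrier G. \<alpha> (inv (inv g) \<otimes> y \<otimes> inv g) * \<beta> (inv (inv (inv g) \<otimes> y \<otimes> inv g) \<otimes> (g \<otimes> x \<otimes> inv g)))"
      using True assms(3) by (intro sum.cong) (simp_all add: inv_mult_group m_assoc)
    also have "\<dots> = (\<Sum>y\<in>carrier G. \<alpha> y * \<beta> (inv y \<otimes> (g \<otimes> x \<otimes> inv g)))"
      using assms(3) by (intro sum_conj) simp
    finally show ?thesis using True assms(3)
      by (simp add: ga_mult_eq[OF s] ga_conj_eq[OF assms(1)] ga_conj_eq[OF assms(2)] ga_conj_eq[OF m]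
           ga_mult_eq[OF assms(2)] cong: sum.cong)
  qed (use assms(3) in \<open>simp add: ga_mult_eq[OF s] ga_conj_eq[OF m]\<close>)
qed

lemma subgroup_ga_cen:
  assumes supp: "\<And>h. h \<notin> carrier G \<Longrightarrow> \<alpha> h = 0"
  shows "subgroup (ga_cen G \<alpha>) G"
proof (rule subgroupI)
  have one: "ga_conj G \<alpha> \<one> = \<alpha>"
    by (rule ext) (simp add: ga_conj_eq[OF supp] supp)
  show "ga_cen G \<alpha> \<subseteq> carrier G" by (auto simp: ga_cen_def)
  show "ga_cen G \<alpha> \<noteq> {}" using one by (auto simp: ga_cen_def)
  fix a assume a: "a \<in> ga_cen G \<alpha>"
  have "ga_conj G (ga_conj G \<alpha> a) (inv a) = ga_conj G \<alpha> (a \<otimes> inv a)"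
    using a by (intro ga_conj_comp supp) (auto simp: ga_cen_def)
  then show "inv a \<in> ga_cen G \<alpha>" using a one by (simp add: ga_cen_def)
  fix b assume b: "b \<in> ga_cen G \<alpha>"
  have "ga_conj G (ga_conj G \<alpha> a) b = ga_conj G \<alpha> (a \<otimes> b)"
    using a b by (intro ga_conj_comp supp) (auto simp: ga_cen_def)
  then show "a \<otimes> b \<in> ga_cen G \<alpha>" using a b by (simp add: ga_cen_def)
qed

section \<open>One step of a chain: the conjugates of the rational idempotent of a character over
  \<open>\<nu>\<close>\<close>

context
  fixes T N :: "'a set" and \<nu> \<chi> \<eta> :: "'a \<Rightarrow> complex" and K and Gal
  assumes sT: "subgroup T G" and nN: "N \<lhd> G" and NT: "N \<subseteq> T" and T_eq: "T = stabilizer G N \<nu>"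
    and \<chi>: "spherical (subgrp G T) \<chi>"
    and \<chi>N: "\<And>n t. n \<in> N \<Longrightarrow> t \<in> T \<Longrightarrow> \<chi> (n \<otimes> t) = \<nu> n * \<chi> t"
    and K_eq: "K = char_field (subgrp G T) \<chi>" and Gal: "Gal = galois_group_Rats K"
    and \<eta>: "\<eta> = e_rat (subgrp G T) \<chi>"
begin

interpretation T: subgroup T G by (rule sT)
interpretation N: normal N G by (rule nN)
interpretation TG: fin_group "subgrp G T" by (rule subgroup_fin_group) (rule sT)

lemma char_field_generated: "K = generate_field cfield (\<chi> ` T)"
  by (simp add: K_eq char_field_def)

lemmas char_field_closed = generate_field_closed[where Z="\<chi> ` T", folded char_field_generated]

lemma char_value_in_field: "t \<in> T \<Longrightarrow> \<chi> t \<in> K"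
  by (rule char_field_closed(2)) simp

lemma char_field_sum: "(\<And>x. x \<in> A \<Longrightarrow> f x \<in> K) \<Longrightarrow> sum f A \<in> K"
  by (induction A rule: infinite_finite_induct) (auto intro: char_field_closed)

lemma char_field_Rats: "q \<in> \<rat> \<Longrightarrow> q \<in> K"
  using Rats_subset_generate_field[of "\<chi> ` T"] by (auto simp: char_field_generated)

lemma gal_props:
  assumes "\<sigma> \<in> Gal"
  shows "x \<in> K \<Longrightarrow> \<sigma> x \<in> K" "x \<in> K \<Longrightarrow> y \<in> K \<Longrightarrow> \<sigma> (x + y) = \<sigma> x + \<sigma> y"
    "x \<in> K \<Longrightarrow> y \<in> K \<Longrightarrow> \<sigma> (x * y) = \<sigma> x * \<sigma> y" "\<sigma> 1 = 1" "q \<in> \<rat> \<Longrightarrow> \<sigma> q = q" "inj_on \<sigma> K"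
  using assms unfolding Gal galois_group_Rats_iff bij_betw_def by auto

lemma gal_sum:
  assumes "\<sigma> \<in> Gal" "\<And>x. x \<in> A \<Longrightarrow> f x \<in> K"
  shows "\<sigma> (sum f A) = (\<Sum>x\<in>A. \<sigma> (f x))"
  using assms(2)
proof (induction A rule: infinite_finite_induct)
  case (insert x A)
  then show ?case using gal_props(2)[OF assms(1), of "f x" "sum f A"] char_field_sum[of A f] by simp
qed (use gal_props(5)[OF assms(1), of 0] in simp_all)

lemma char_degree: "\<chi> \<one> \<in> \<rat>" "Re (\<chi> \<one>) > 0" "\<chi> \<one> \<noteq> 0"
  using \<chi> by (auto simp: spherical_def)

lemma spherical_gal:
  assumes \<sigma>: "\<sigma> \<in> Gal" shows "spherical (subgrp G T) (\<lambda>x. \<sigma> (\<chi> x))"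
proof -
  note g = gal_props[OF \<sigma>] gal_sum[OF \<sigma>] and [simp] = inv_subgrp[OF sT]
  have cT: "of_nat n \<in> K" "\<sigma> (of_nat n) = of_nat n" for n by (auto intro: char_field_Rats g)
  have "(\<Sum>t\<in>T. \<sigma> (\<chi> t) * \<sigma> (\<chi> (inv t))) = \<sigma> (\<Sum>t\<in>T. \<chi> t * \<chi> (inv t))"
    by (simp add: g char_value_in_field char_field_closed)
  also have "(\<Sum>t\<in>T. \<chi> t * \<chi> (inv t)) = of_nat (card T)"
    using \<chi> by (simp add: spherical_def cong: sum.cong)
  finally have 1: "(\<Sum>t\<in>T. \<sigma> (\<chi> t) * \<sigma> (\<chi> (inv t))) = of_nat (card T)" by (simp add: cT)
  have "\<sigma> (\<chi> s) * \<sigma> (\<chi> t) * of_nat (card T) = \<sigma> (\<chi> \<one>) * (\<Sum>x\<in>T. \<sigma> (\<chi> (s \<otimes> (inv x \<otimes> t \<otimes> x))))"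
    if "s \<in> T" "t \<in> T" for s t
  proof -
    have "\<chi> s * \<chi> t * of_nat (card T) = \<chi> \<one> * (\<Sum>x\<in>T. \<chi> (s \<otimes> (inv x \<otimes> t \<otimes> x)))"
      using \<chi> that by (simp add: spherical_def cong: sum.cong)
    then have "\<sigma> (\<chi> s * \<chi> t * of_nat (card T)) = \<sigma> (\<chi> \<one> * (\<Sum>x\<in>T. \<chi> (s \<otimes> (inv x \<otimes> t \<otimes> x))))"
      by simp
    then show ?thesis using that by (simp add: g cT char_value_in_field char_field_closed char_field_sum)
  qed
  then show ?thesis using 1 char_degree g(5)[OF char_degree(1)]
    by (simp add: spherical_def cong: sum.cong)
qed

text \<open>The idempotent of the conjugate of \<open>\<chi>\<close> by \<open>\<sigma>\<close>,
  extended by zero outside \<open>T\<close>. The degree needs no \<open>\<sigma>\<close> since it is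
  rational.\<close>

definition gal_part :: "(complex \<Rightarrow> complex) \<Rightarrow> 'a \<Rightarrow> complex" where
  "gal_part \<sigma> x = (if x \<in> T then \<chi> \<one> / of_nat (card T) * \<sigma> (\<chi> (inv x)) else 0)"

lemma e_rat_eq: "\<eta> x = (\<Sum>\<sigma>\<in>Gal. gal_part \<sigma> x)"
  unfolding \<eta> e_rat_def K_eq[symmetric] Gal[symmetric]
  by (intro sum.cong refl)
     (auto simp: TG.e_char_eq gal_part_def inv_subgrp[OF sT] gal_props(5)[OF _ char_degree(1)])

lemma e_rat_supp: "x \<notin> carrier G \<Longrightarrow> \<eta> x = 0"
  by (auto simp: e_rat_eq gal_part_def intro!: sum.neutral)

text \<open>Since \<open>\<chi> n = \<nu> n * \<chi> \<one>\<close> and the degree is nonzero,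
  \<open>\<nu>\<close> takes its values in the field of \<open>\<chi>\<close>. So automorphisms of
  that field can be applied to \<open>\<nu>\<close> directly.\<close>

lemma normal_value_in_field: "n \<in> N \<Longrightarrow> \<nu> n \<in> K" "n \<in> N \<Longrightarrow> \<nu> (inv n) * \<nu> n = 1"
proof -
  assume n: "n \<in> N"
  then have nT: "n \<in> T" "n \<in> carrier G" using NT by auto
  have "\<nu> n = \<chi> n * inverse (\<chi> \<one>)" using \<chi>N[OF n T.one_closed] char_degree nT by simp
  then show "\<nu> n \<in> K" using nT by (simp add: char_field_closed char_value_in_field)
  have "\<chi> \<one> = \<nu> (inv n) * \<chi> n" "\<chi> n = \<nu> n * \<chi> \<one>"
    using \<chi>N[of "inv n" n] \<chi>N[of n \<one>] n nT by simp_all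
  then have "1 * \<chi> \<one> = (\<nu> (inv n) * \<nu> n) * \<chi> \<one>" by (simp only: mult.assoc mult_1_left)
  then show "\<nu> (inv n) * \<nu> n = 1" using char_degree(3) by (metis mult_right_cancel)
qed

lemma normal_conj_closed: "b \<in> carrier G \<Longrightarrow> n \<in> N \<Longrightarrow> b \<otimes> n \<otimes> inv b \<in> N"
  "b \<in> carrier G \<Longrightarrow> n \<in> N \<Longrightarrow> inv b \<otimes> n \<otimes> b \<in> N"
  by (auto intro: N.inv_op_closed1 N.inv_op_closed2)

lemma subgroup_mult_mem_iff: "m \<in> T \<Longrightarrow> y \<in> carrier G \<Longrightarrow> m \<otimes> y \<in> T \<longleftrightarrow> y \<in> T"
  "m \<in> T \<Longrightarrow> y \<in> carrier G \<Longrightarrow> y \<otimes> m \<in> T \<longleftrightarrow> y \<in> T"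
proof -
  assume m: "m \<in> T" and y: "y \<in> carrier G"
  have "inv m \<otimes> (m \<otimes> y) = y" "y \<otimes> m \<otimes> inv m = y" using m y by (simp_all add: m_assoc)
  then show "m \<otimes> y \<in> T \<longleftrightarrow> y \<in> T" "y \<otimes> m \<in> T \<longleftrightarrow> y \<in> T"
    using m by (metis T.m_closed T.m_inv_closed)+
qed

text \<open>Elements \<open>n\<close> of the normal subgroup can be moved through the product, acting by \<open>\<sigma> (\<nu> n)\<close> on
  its left factor and by \<open>\<tau> (\<nu> (b n b\<^sup>-\<^sup>1))\<close> on its right factor.\<close>

lemma gal_part_conv_nonzero:
  assumes \<sigma>: "\<sigma> \<in> Gal" and \<tau>: "\<tau> \<in> Gal" and b: "b \<in> carrier G" and x: "x \<in> carrier G"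
    and nz: "(\<Sum>g\<in>carrier G. gal_part \<sigma> g * gal_part \<tau> (b \<otimes> (inv g \<otimes> x) \<otimes> inv b)) \<noteq> 0" (is "?W \<noteq> 0")
    and n: "n \<in> N"
  shows "\<sigma> (\<nu> n) = \<tau> (\<nu> (b \<otimes> n \<otimes> inv b))"
proof -
  have nG: "n \<in> carrier G" "n \<in> T" using n NT by auto
  let ?m = "b \<otimes> n \<otimes> inv b"
  have m: "?m \<in> N" "?m \<in> T" using normal_conj_closed(1)[OF b n] NT by auto
  have 1: "gal_part \<sigma> (g \<otimes> n) = \<sigma> (\<nu> (inv n)) * gal_part \<sigma> g" if g: "g \<in> carrier G" for g
  proof (cases "g \<in> T")
    case True
    then have "\<sigma> (\<chi> (inv (g \<otimes> n))) = \<sigma> (\<nu> (inv n)) * \<sigma> (\<chi> (inv g))"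
      using \<chi>N[of "inv n" "inv g"] n nG normal_value_in_field[of "inv n"] char_value_in_field[of "inv g"] g
      by (simp add: inv_mult_group gal_props(3)[OF \<sigma>])
    then show ?thesis using True nG by (simp add: gal_part_def)
  next
    case False
    then show ?thesis using subgroup_mult_mem_iff(2)[OF nG(2) g] by (simp add: gal_part_def)
  qed
  have 2: "gal_part \<tau> (b \<otimes> (inv (g \<otimes> n) \<otimes> x) \<otimes> inv b) = \<tau> (\<nu> ?m) * gal_part \<tau> (b \<otimes> (inv g \<otimes> x) \<otimes> inv b)"
    if g: "g \<in> carrier G" for g
  proof -
    let ?y = "b \<otimes> (inv g \<otimes> x) \<otimes> inv b"
    have e: "b \<otimes> (inv (g \<otimes> n) \<otimes> x) \<otimes> inv b = inv ?m \<otimes> ?y"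
      using g x b nG by (simp add: inv_mult_group m_assoc)
    show ?thesis
    proof (cases "?y \<in> T")
      case True
      have "\<chi> (inv ?y \<otimes> ?m) = \<chi> (?m \<otimes> inv ?y)"
        using TG.spherical_comm[OF \<chi>, of "inv ?y" ?m] True m by simp
      also have "\<dots> = \<nu> ?m * \<chi> (inv ?y)" using True m by (intro \<chi>N) auto
      finally have "\<chi> (inv (inv ?m \<otimes> ?y)) = \<nu> ?m * \<chi> (inv ?y)"
        using True m by (simp add: inv_mult_group[of "inv ?m" ?y])
      then have "\<tau> (\<chi> (inv (inv ?m \<otimes> ?y))) = \<tau> (\<nu> ?m) * \<tau> (\<chi> (inv ?y))"
        using normal_value_in_field(1)[OF m(1)] char_value_in_field[of "inv ?y"] True by (simp add: gal_props(3)[OF \<tau>])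
      moreover have "inv ?m \<otimes> ?y \<in> T" using True m by blast
      ultimately show ?thesis unfolding e using True by (simp add: gal_part_def)
    next
      case False
      then have "inv ?m \<otimes> ?y \<notin> T"
        using subgroup_mult_mem_iff(1)[of "inv ?m" ?y] m g x b by simp
      then show ?thesis unfolding e using False by (simp add: gal_part_def)
    qed
  qed
  \<comment> \<open>Reindexing by \<open>g \<otimes> n\<close> multiplies the whole sum by one
    number, which must be 1 as the sum is nonzero.\<close>
  have "?W = (\<Sum>g\<in>carrier G. gal_part \<sigma> (g \<otimes> n) * gal_part \<tau> (b \<otimes> (inv (g \<otimes> n) \<otimes> x) \<otimes> inv b))"
    by (rule sum_mult_right[symmetric]) (rule nG)
  also have "\<dots> = \<sigma> (\<nu> (inv n)) * \<tau> (\<nu> ?m) * ?W"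
    unfolding sum_distrib_left by (rule sum.cong[OF refl]) (simp add: 1 2)
  finally have "\<sigma> (\<nu> (inv n)) * \<tau> (\<nu> ?m) = 1" using nz by simp
  moreover have "\<sigma> (\<nu> (inv n)) * \<sigma> (\<nu> n) = 1"
    using normal_value_in_field(2)[OF n] gal_props(3)[OF \<sigma>, of "\<nu> (inv n)" "\<nu> n"] normal_value_in_field(1)[OF n] normal_value_in_field(1)[of "inv n"] n gal_props(4)[OF \<sigma>]
    by simp
  ultimately show ?thesis by (metis mult_cancel_left mult_zero_left zero_neq_one)
qed

text \<open>The assumption \<open>st\<close> says that conjugation by \<open>b\<close> turns
  \<open>\<nu>\<close> into a Galois conjugate. Automorphisms are injective on the field, so Galois
  conjugates have the same stabilizer, while conjugation by \<open>b\<close> conjugates the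
  stabilizer.\<close>

lemma normalizes:
  assumes \<sigma>: "\<sigma> \<in> Gal" and \<tau>: "\<tau> \<in> Gal" and b: "b \<in> carrier G"
    and st: "\<And>n. n \<in> N \<Longrightarrow> \<sigma> (\<nu> n) = \<tau> (\<nu> (b \<otimes> n \<otimes> inv b))" and t: "t \<in> T"
  shows "b \<otimes> t \<otimes> inv b \<in> T" "inv b \<otimes> t \<otimes> b \<in> T"
proof -
  have tG: "t \<in> carrier G" using t by simp
  have tn: "\<nu> (inv t \<otimes> n \<otimes> t) = \<nu> n" if "n \<in> N" for n
    using t that unfolding T_eq stabilizer_def by blast
  have st': "\<tau> (\<nu> n) = \<sigma> (\<nu> (inv b \<otimes> n \<otimes> b))" if "n \<in> N" for n
    using st[OF normal_conj_closed(2)[OF b that]] b that by (simp add: m_assoc)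
  have "\<nu> (inv (b \<otimes> t \<otimes> inv b) \<otimes> n \<otimes> (b \<otimes> t \<otimes> inv b)) = \<nu> n" if n: "n \<in> N" for n
  proof -
    let ?m = "inv b \<otimes> n \<otimes> b"
    have m: "?m \<in> N" "inv t \<otimes> ?m \<otimes> t \<in> N" using normal_conj_closed(2)[OF b n] normal_conj_closed(2)[OF tG] by auto
    have e: "inv (b \<otimes> t \<otimes> inv b) \<otimes> n \<otimes> (b \<otimes> t \<otimes> inv b) = b \<otimes> (inv t \<otimes> ?m \<otimes> t) \<otimes> inv b"
      using b tG n by (simp add: inv_mult_group m_assoc)
    have "\<tau> (\<nu> (b \<otimes> (inv t \<otimes> ?m \<otimes> t) \<otimes> inv b)) = \<sigma> (\<nu> (inv t \<otimes> ?m \<otimes> t))" using st[OF m(2)] by simp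
    also have "\<dots> = \<sigma> (\<nu> ?m)" using tn[OF m(1)] by simp
    also have "\<dots> = \<tau> (\<nu> n)" using st'[OF n] by simp
    finally show ?thesis unfolding e
      using normal_value_in_field(1)[OF n] normal_value_in_field(1)[OF normal_conj_closed(1)[OF b m(2)]] gal_props(6)[OF \<tau>] by (meson inj_onD)
  qed
  then show "b \<otimes> t \<otimes> inv b \<in> T" using b tG unfolding T_eq stabilizer_def by blast
  have "\<nu> (inv (inv b \<otimes> t \<otimes> b) \<otimes> n \<otimes> (inv b \<otimes> t \<otimes> b)) = \<nu> n" if n: "n \<in> N" for n
  proof -
    let ?m = "b \<otimes> n \<otimes> inv b"
    have m: "?m \<in> N" "inv t \<otimes> ?m \<otimes> t \<in> N" using normal_conj_closed(1)[OF b n] normal_conj_closed(2)[OF tG] by auto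
    have e: "inv (inv b \<otimes> t \<otimes> b) \<otimes> n \<otimes> (inv b \<otimes> t \<otimes> b) = inv b \<otimes> (inv t \<otimes> ?m \<otimes> t) \<otimes> b"
      using b tG n by (simp add: inv_mult_group m_assoc)
    have "\<sigma> (\<nu> (inv b \<otimes> (inv t \<otimes> ?m \<otimes> t) \<otimes> b)) = \<tau> (\<nu> (inv t \<otimes> ?m \<otimes> t))" using st'[OF m(2)] by simp
    also have "\<dots> = \<tau> (\<nu> ?m)" using tn[OF m(1)] by simp
    also have "\<dots> = \<sigma> (\<nu> n)" using st[OF n] by simp
    finally show ?thesis unfolding e
      using normal_value_in_field(1)[OF n] normal_value_in_field(1)[OF normal_conj_closed(2)[OF b m(2)]] gal_props(6)[OF \<sigma>] by (meson inj_onD)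
  qed
  then show "inv b \<otimes> t \<otimes> b \<in> T" using b tG unfolding T_eq stabilizer_def by blast
qed

text \<open>Once \<open>b\<close> normalizes \<open>T\<close>, the two functions compared are
  spherical on the same group and of the same degree. If they differed, orthogonality would make
  their convolution, and with it the sum, vanish.\<close>

lemma gal_part_conv_conj:
  assumes \<sigma>: "\<sigma> \<in> Gal" and \<tau>: "\<tau> \<in> Gal" and b: "b \<in> carrier G" and x: "x \<in> carrier G"
    and nz: "(\<Sum>g\<in>carrier G. gal_part \<sigma> g * gal_part \<tau> (b \<otimes> (inv g \<otimes> x) \<otimes> inv b)) \<noteq> 0"
    and nb: "\<And>t. t \<in> T \<Longrightarrow> b \<otimes> t \<otimes> inv b \<in> T" "\<And>t. t \<in> T \<Longrightarrow> inv b \<otimes> t \<otimes> b \<in> T"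
    and t: "t \<in> T"
  shows "\<sigma> (\<chi> t) = \<tau> (\<chi> (b \<otimes> t \<otimes> inv b))"
proof (rule ccontr)
  assume ne: "\<sigma> (\<chi> t) \<noteq> \<tau> (\<chi> (b \<otimes> t \<otimes> inv b))"
  let ?\<psi> = "\<lambda>t. \<tau> (\<chi> (b \<otimes> t \<otimes> inv b))"
  let ?c = "\<chi> \<one> / of_nat (card T)"
  have \<psi>: "spherical (subgrp G T) ?\<psi>"
    by (rule spherical_conj[OF sT b nb spherical_gal[OF \<tau>]])
  have one: "?\<psi> \<one> = \<sigma> (\<chi> \<one>)" using b char_degree by (simp add: gal_props(5)[OF \<sigma>] gal_props(5)[OF \<tau>])
  have z: "(\<Sum>h\<in>T. ?\<psi> (g \<otimes> h) * \<sigma> (\<chi> (inv h))) = 0" if "g \<in> T" for g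
    using TG.spherical_orthogonal(2)[OF \<psi> spherical_gal[OF \<sigma>] _ _ ne[symmetric], of g] one t that
    by (simp add: inv_subgrp[OF sT] cong: sum.cong)
  have bT: "b \<otimes> y \<otimes> inv b \<in> T \<longleftrightarrow> y \<in> T" if "y \<in> carrier G" for y
    using nb(1)[of y] nb(2)[of "b \<otimes> y \<otimes> inv b"] that b by (auto simp: m_assoc)
  have "(\<Sum>g\<in>carrier G. gal_part \<sigma> g * gal_part \<tau> (b \<otimes> (inv g \<otimes> x) \<otimes> inv b)) = 0"
  proof (cases "x \<in> T")
    case True
    have "gal_part \<sigma> g * gal_part \<tau> (b \<otimes> (inv g \<otimes> x) \<otimes> inv b)
       = ?c * ?c * (?\<psi> (inv x \<otimes> g) * \<sigma> (\<chi> (inv g)))" if g: "g \<in> T" for g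
    proof -
      have "b \<otimes> (inv g \<otimes> x) \<otimes> inv b \<in> T" using g True by (intro nb) auto
      moreover have "inv (b \<otimes> (inv g \<otimes> x) \<otimes> inv b) = b \<otimes> (inv x \<otimes> g) \<otimes> inv b"
        using g b x by (simp add: inv_mult_group m_assoc)
      ultimately show ?thesis using g by (simp add: gal_part_def)
    qed
    then have "(\<Sum>g\<in>carrier G. gal_part \<sigma> g * gal_part \<tau> (b \<otimes> (inv g \<otimes> x) \<otimes> inv b))
      = (\<Sum>g\<in>T. ?c * ?c * (?\<psi> (inv x \<otimes> g) * \<sigma> (\<chi> (inv g))))"
      by (intro sum.mono_neutral_cong_right) (auto simp: gal_part_def)
    also have "\<dots> = ?c * ?c * (\<Sum>g\<in>T. ?\<psi> (inv x \<otimes> g) * \<sigma> (\<chi> (inv g)))"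
      by (simp add: sum_distrib_left)
    also have "\<dots> = 0" using z[of "inv x"] True by simp
    finally show ?thesis .
  next
    case False
    have "gal_part \<sigma> g * gal_part \<tau> (b \<otimes> (inv g \<otimes> x) \<otimes> inv b) = 0" if "g \<in> carrier G" for g
      using bT[of "inv g \<otimes> x"] subgroup_mult_mem_iff(1)[of "inv g" x] False that x by (auto simp: gal_part_def)
    then show ?thesis by simp
  qed
  then show False using nz by simp
qed

text \<open>Expand the product over pairs of Galois conjugates. A single nonzero term already makes
  \<open>b\<close> normalize \<open>T\<close> and identifies the conjugate of \<open>\<chi>\<close>
  by \<open>b\<close> with a Galois conjugate, so that conjugation by \<open>b\<close> merely
  permutes the summands of \<open>\<eta>\<close>.\<close>

lemma e_rat_conj:
  assumes b: "b \<in> carrier G" and nz: "ga_mult G \<eta> (ga_conj G \<eta> b) \<noteq> (\<lambda>_. 0)"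
  shows "ga_conj G \<eta> b = \<eta>" "\<And>t. t \<in> T \<Longrightarrow> b \<otimes> t \<otimes> inv b \<in> T"
proof -
  have cs: "ga_conj G \<eta> b y = 0" if "y \<notin> carrier G" for y
    using that b by (simp add: ga_conj_eq[OF e_rat_supp])
  obtain x where x: "ga_mult G \<eta> (ga_conj G \<eta> b) x \<noteq> 0" using nz by blast
  then have xG: "x \<in> carrier G" by (auto simp: ga_mult_eq[OF cs] split: if_splits)
  let ?W = "\<lambda>\<sigma> \<tau>. \<Sum>g\<in>carrier G. gal_part \<sigma> g * gal_part \<tau> (b \<otimes> (inv g \<otimes> x) \<otimes> inv b)"
  have "ga_mult G \<eta> (ga_conj G \<eta> b) x = (\<Sum>g\<in>carrier G. \<eta> g * \<eta> (b \<otimes> (inv g \<otimes> x) \<otimes> inv b))"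
    using b xG by (simp add: ga_mult_eq[OF cs] ga_conj_eq[OF e_rat_supp] cong: sum.cong)
  also have "\<dots> = (\<Sum>g\<in>carrier G. \<Sum>\<sigma>\<in>Gal. \<Sum>\<tau>\<in>Gal. gal_part \<sigma> g * gal_part \<tau> (b \<otimes> (inv g \<otimes> x) \<otimes> inv b))"
    by (simp only: e_rat_eq sum_product)
  also have "\<dots> = (\<Sum>\<sigma>\<in>Gal. \<Sum>g\<in>carrier G. \<Sum>\<tau>\<in>Gal. gal_part \<sigma> g * gal_part \<tau> (b \<otimes> (inv g \<otimes> x) \<otimes> inv b))"
    by (rule sum.swap)
  also have "\<dots> = (\<Sum>\<sigma>\<in>Gal. \<Sum>\<tau>\<in>Gal. ?W \<sigma> \<tau>)"
    by (intro sum.cong[OF refl] sum.swap)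
  finally have "(\<Sum>\<sigma>\<in>Gal. \<Sum>\<tau>\<in>Gal. ?W \<sigma> \<tau>) \<noteq> 0" using x by simp
  then obtain \<sigma> where \<sigma>: "\<sigma> \<in> Gal" "(\<Sum>\<tau>\<in>Gal. ?W \<sigma> \<tau>) \<noteq> 0"
    by (rule sum.not_neutral_contains_not_neutral)
  from \<sigma>(2) obtain \<tau> where \<tau>: "\<tau> \<in> Gal" "?W \<sigma> \<tau> \<noteq> 0"
    by (rule sum.not_neutral_contains_not_neutral)
  have nb: "b \<otimes> t \<otimes> inv b \<in> T" "inv b \<otimes> t \<otimes> b \<in> T" if "t \<in> T" for t
    using normalizes[OF \<sigma>(1) \<tau>(1) b gal_part_conv_nonzero[OF \<sigma>(1) \<tau>(1) b xG \<tau>(2)] that] by blast+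
  show nb1: "b \<otimes> t \<otimes> inv b \<in> T" if "t \<in> T" for t using nb(1) that by blast
  have cj: "\<sigma> (\<chi> t) = \<tau> (\<chi> (b \<otimes> t \<otimes> inv b))" if "t \<in> T" for t
    using gal_part_conv_conj[OF \<sigma>(1) \<tau>(1) b xG \<tau>(2) nb that] by blast
  \<comment> \<open>The inverse of \<open>\<tau>\<close> after \<open>\<sigma>\<close>: by
    \<open>cj\<close> it carries \<open>\<chi>\<close> to its conjugate by \<open>b\<close>.\<close>
  define \<rho> where "\<rho> = compose K (restrict (inv_into K \<tau>) K) \<sigma>"
  have \<rho>: "\<rho> \<in> Gal" unfolding \<rho>_def Gal
    using \<sigma>(1) \<tau>(1) galois_comp[OF char_field_generated] galois_inv[OF char_field_generated] by (simp add: Gal)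
  define \<rho>' where "\<rho>' = restrict (inv_into K \<rho>) K"
  have \<rho>': "\<rho>' \<in> Gal" unfolding \<rho>'_def Gal using \<rho> galois_inv[OF char_field_generated] by (simp add: Gal)
  have \<rho>\<chi>: "\<chi> (b \<otimes> t \<otimes> inv b) = \<rho> (\<chi> t)" if t: "t \<in> T" for t
  proof -
    have "inv_into K \<tau> (\<sigma> (\<chi> t)) = \<chi> (b \<otimes> t \<otimes> inv b)"
      unfolding cj[OF t] by (rule inv_into_f_f[OF gal_props(6)[OF \<tau>(1)] char_value_in_field[OF nb1[OF t]]])
    then show ?thesis using char_value_in_field[OF t] gal_props(1)[OF \<sigma>(1)] by (simp add: \<rho>_def compose_def)
  qed
  have bij: "bij_betw \<rho> K K" using \<rho> by (simp add: Gal galois_group_Rats_iff)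
  have rr: "\<rho> (\<rho>' z) = z" "\<rho>' (\<rho> z) = z" "\<rho> z \<in> K" "\<rho>' z \<in> K" if "z \<in> K" for z
    using that bij gal_props(1)[OF \<rho>] by (auto simp: \<rho>'_def bij_betw_def inv_into_into f_inv_into_f)
  have re: "(\<Sum>\<sigma>\<in>Gal. \<sigma> (\<rho> z)) = (\<Sum>\<sigma>\<in>Gal. \<sigma> z)" if z: "z \<in> K" for z
  proof (rule sum.reindex_bij_witness[where j="\<lambda>\<sigma>. compose K \<sigma> \<rho>" and i="\<lambda>\<sigma>. compose K \<sigma> \<rho>'"])
    fix s assume s: "s \<in> Gal"
    then have ext: "s \<in> extensional K" by (simp add: Gal galois_group_Rats_iff)
    show "compose K (compose K s \<rho>) \<rho>' = s" "compose K (compose K s \<rho>') \<rho> = s"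
      by (rule extensionalityI[OF _ ext]; simp add: compose_def rr)+
    show "compose K s \<rho> \<in> Gal" "compose K s \<rho>' \<in> Gal"
      using s \<rho> \<rho>' galois_comp[OF char_field_generated] by (simp_all add: Gal)
    show "compose K s \<rho> z = s (\<rho> z)" using z by (simp add: compose_def)
  qed
  show "ga_conj G \<eta> b = \<eta>"
  proof
    fix y
    show "ga_conj G \<eta> b y = \<eta> y"
    proof (cases "y \<in> T")
      case True
      then have yG: "y \<in> carrier G" by simp
      have i: "inv (b \<otimes> y \<otimes> inv b) = b \<otimes> inv y \<otimes> inv b" using b yG by (simp add: inv_mult_group m_assoc)
      have "\<eta> (b \<otimes> y \<otimes> inv b) = (\<Sum>\<sigma>\<in>Gal. \<chi> \<one> / of_nat (card T) * \<sigma> (\<rho> (\<chi> (inv y))))"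
        unfolding e_rat_eq using True nb1[OF True] \<rho>\<chi>[of "inv y"]
        by (intro sum.cong refl) (simp add: gal_part_def i)
      also have "\<dots> = (\<Sum>\<sigma>\<in>Gal. \<chi> \<one> / of_nat (card T) * \<sigma> (\<chi> (inv y)))"
        using re[of "\<chi> (inv y)"] char_value_in_field[of "inv y"] True by (simp only: sum_distrib_left[symmetric] T.m_inv_closed)
      also have "\<dots> = \<eta> y" using True by (simp add: e_rat_eq gal_part_def)
      finally show ?thesis using yG b by (simp add: ga_conj_eq[OF e_rat_supp])
    next
      case False
      have "b \<otimes> y \<otimes> inv b \<notin> T" if "y \<in> carrier G"
        using nb(2)[of "b \<otimes> y \<otimes> inv b"] False that b by (auto simp: m_assoc)
      then have "ga_conj G \<eta> b y = 0" using b by (auto simp: ga_conj_eq[OF e_rat_supp] e_rat_eq gal_part_def)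
      then show ?thesis using False by (simp add: e_rat_eq gal_part_def)
    qed
  qed
qed

lemma gal_pairing:
  assumes "\<sigma> \<in> Gal" "\<tau> \<in> Gal" "\<sigma> \<noteq> \<tau>"
  shows "(\<Sum>t\<in>T. \<sigma> (\<chi> t) * \<tau> (\<chi> (inv t))) = 0"
proof -
  obtain t where t: "t \<in> T" "\<sigma> (\<chi> t) \<noteq> \<tau> (\<chi> t)"
    using galois_determined[OF char_field_generated, of \<sigma> \<tau>] assms by (auto simp: Gal)
  show ?thesis
    using TG.spherical_orthogonal(1)[OF spherical_gal[OF assms(1)] spherical_gal[OF assms(2)] _ _ t(2)] t(1)
      char_degree assms by (simp add: gal_props(5) inv_subgrp[OF sT] cong: sum.cong)
qed

lemma gal_norm:
  assumes "\<sigma> \<in> Gal" shows "(\<Sum>t\<in>T. \<sigma> (\<chi> t) * \<sigma> (\<chi> (inv t))) = of_nat (card T)"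
  using spherical_gal[OF assms] by (simp add: spherical_def inv_subgrp[OF sT] cong: sum.cong)

lemma card_subgroup_neq_0: "of_nat (card T) \<noteq> (0::complex)"
  using T.one_closed finite_subgroup[OF sT] by (metis card_0_eq empty_iff of_nat_eq_0_iff)

text \<open>The Galois conjugates of \<open>\<chi>\<close> are pairwise orthogonal functions of
  nonzero norm on the finite set \<open>T\<close>, and they determine the automorphisms.\<close>

lemma finite_Gal: "finite Gal"
proof -
  let ?f = "\<lambda>\<sigma> x. if x \<in> T then \<sigma> (\<chi> x) else (0::complex)"
  have "finite (?f ` Gal)"
  proof (rule finite_orthogonal[where S=T and i="\<lambda>x. inv x"])
    show "finite T" using finite_subgroup[OF sT] .
    fix f f' assume "f \<in> ?f ` Gal" "f' \<in> ?f ` Gal" "f \<noteq> f'"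
    then obtain \<sigma> \<tau> where "\<sigma> \<in> Gal" "\<tau> \<in> Gal" "\<sigma> \<noteq> \<tau>" "f = ?f \<sigma>" "f' = ?f \<tau>" by auto
    then show "(\<Sum>x\<in>T. f x * f' (inv x)) = 0" using gal_pairing[of \<sigma> \<tau>] by (simp cong: sum.cong)
  next
    fix f assume "f \<in> ?f ` Gal"
    then obtain \<sigma> where "\<sigma> \<in> Gal" "f = ?f \<sigma>" by auto
    then show "(\<Sum>x\<in>T. f x * f (inv x)) \<noteq> 0" using gal_norm[of \<sigma>] card_subgroup_neq_0 by (simp cong: sum.cong)
  qed auto
  moreover have "inj_on ?f Gal"
  proof (rule inj_onI)
    fix \<sigma> \<tau> assume a: "\<sigma> \<in> Gal" "\<tau> \<in> Gal" "?f \<sigma> = ?f \<tau>"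
    then have "\<sigma> (\<chi> t) = \<tau> (\<chi> t)" if "t \<in> T" for t using fun_cong[OF a(3), of t] that by simp
    then show "\<sigma> = \<tau>" using galois_determined[OF char_field_generated, of \<sigma> \<tau>] a by (auto simp: Gal)
  qed
  ultimately show ?thesis by (rule finite_imageD)
qed

text \<open>By orthogonality the coefficient at \<open>\<one>\<close> is \<open>card Gal\<close>
  times a nonzero number; finiteness of \<open>Gal\<close> keeps that cardinality from defaulting to
  0.\<close>

lemma e_rat_square: "ga_mult G \<eta> \<eta> \<noteq> (\<lambda>_. 0)"
proof -
  let ?c = "\<chi> \<one> / of_nat (card T)"
  have "ga_mult G \<eta> \<eta> \<one> = (\<Sum>g\<in>carrier G. \<eta> g * \<eta> (inv g))"
    by (simp add: ga_mult_eq[OF e_rat_supp] cong: sum.cong)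
  also have "\<dots> = (\<Sum>g\<in>T. \<eta> g * \<eta> (inv g))"
    by (rule sum.mono_neutral_right) (auto simp: e_rat_eq gal_part_def)
  also have "\<dots> = (\<Sum>g\<in>T. \<Sum>\<sigma>\<in>Gal. \<Sum>\<tau>\<in>Gal. ?c * ?c * (\<tau> (\<chi> g) * \<sigma> (\<chi> (inv g))))"
    unfolding e_rat_eq sum_product
    by (intro sum.cong[OF refl]) (simp add: gal_part_def)
  also have "\<dots> = (\<Sum>\<sigma>\<in>Gal. \<Sum>g\<in>T. \<Sum>\<tau>\<in>Gal. ?c * ?c * (\<tau> (\<chi> g) * \<sigma> (\<chi> (inv g))))"
    by (rule sum.swap)
  also have "\<dots> = (\<Sum>\<sigma>\<in>Gal. \<Sum>\<tau>\<in>Gal. \<Sum>g\<in>T. ?c * ?c * (\<tau> (\<chi> g) * \<sigma> (\<chi> (inv g))))"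
    by (intro sum.cong[OF refl] sum.swap)
  also have "\<dots> = (\<Sum>\<sigma>\<in>Gal. \<Sum>\<tau>\<in>Gal. ?c * ?c * (\<Sum>g\<in>T. \<tau> (\<chi> g) * \<sigma> (\<chi> (inv g))))"
    by (simp only: sum_distrib_left)
  also have "\<dots> = (\<Sum>\<sigma>\<in>Gal. \<Sum>\<tau>\<in>Gal. if \<tau> = \<sigma> then ?c * ?c * of_nat (card T) else 0)"
    by (intro sum.cong[OF refl]) (simp add: gal_norm gal_pairing)
  also have "\<dots> = of_nat (card Gal) * (?c * ?c * of_nat (card T))"
    using finite_Gal by simp
  finally have "ga_mult G \<eta> \<eta> \<one> = of_nat (card Gal) * (?c * ?c * of_nat (card T))" .
  moreover have "card Gal \<noteq> 0"
    using finite_Gal galois_id[OF char_field_generated] by (auto simp: Gal)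
  ultimately have "ga_mult G \<eta> \<eta> \<one> \<noteq> 0" using char_degree card_subgroup_neq_0 by simp
  then show ?thesis by (metis)
qed

text \<open>If \<open>x\<close> centralizes \<open>\<eta>\<close>, then the product of
  \<open>\<eta>\<close> with its conjugate by \<open>x\<close> is the nonzero square of
  \<open>\<eta>\<close>, so \<open>e_rat_conj\<close> makes \<open>x\<close> normalize
  \<open>T\<close>. For orthogonality, contrapose \<open>e_rat_conj\<close> after moving one of the
  two conjugates back to \<open>\<eta>\<close>.\<close>

lemma strong_step:
  shows "T \<lhd> subgrp G (ga_cen G \<eta>)"
    and "\<And>g h. g \<in> carrier G \<Longrightarrow> h \<in> carrier G \<Longrightarrow> ga_conj G \<eta> g \<noteq> ga_conj G \<eta> h \<Longrightarrow>
          ga_orthogonal G (ga_conj G \<eta> g) (ga_conj G \<eta> h)"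
proof -
  let ?C = "ga_cen G \<eta>"
  have sC: "subgroup ?C G" by (rule subgroup_ga_cen) (rule e_rat_supp)
  interpret CG: fin_group "subgrp G ?C" by (rule subgroup_fin_group) (rule sC)
  have TC: "T \<subseteq> ?C"
  proof
    fix b assume b: "b \<in> T"
    have "ga_conj G \<eta> b x = \<eta> x" for x
    proof (cases "x \<in> carrier G")
      case True
      have "b \<otimes> x \<otimes> inv b \<in> T \<longleftrightarrow> x \<in> T" using b True subgroup_mult_mem_iff by simp
      moreover have "\<chi> (inv (b \<otimes> x \<otimes> inv b)) = \<chi> (inv x)" if "x \<in> T"
        using TG.spherical_class_fun[OF \<chi>, of "inv x" "inv b"] b that
        by (simp add: inv_subgrp[OF sT] inv_mult_group m_assoc)
      ultimately show ?thesis using True b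
        by (cases "x \<in> T") (simp_all add: ga_conj_eq[OF e_rat_supp] e_rat_eq gal_part_def)
    qed (use b in \<open>simp add: ga_conj_eq[OF e_rat_supp] e_rat_supp\<close>)
    then show "b \<in> ?C" using b by (auto simp: ga_cen_def)
  qed
  show "T \<lhd> subgrp G ?C"
  proof (rule CG.normal_invI)
    show "subgroup T (subgrp G ?C)"
      using subgroup_incl[OF sT sC TC] .
    fix x h assume xh: "x \<in> carrier (subgrp G ?C)" "h \<in> T"
    then have x: "x \<in> carrier G" "ga_conj G \<eta> x = \<eta>" "x \<in> ?C" by (auto simp: ga_cen_def)
    have "x \<otimes> h \<otimes> inv x \<in> T" by (rule e_rat_conj(2)) (use x xh e_rat_square in auto)
    then show "x \<otimes>\<^bsub>subgrp G ?C\<^esub> h \<otimes>\<^bsub>subgrp G ?C\<^esub> inv\<^bsub>subgrp G ?C\<^esub> x \<in> T"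
      using inv_subgrp[OF sC x(3)] by simp
  qed
  have cs: "ga_conj G \<eta> b y = 0" if "y \<notin> carrier G" "b \<in> carrier G" for y b
    using that by (simp add: ga_conj_eq[OF e_rat_supp])
  have orth: "ga_mult G (ga_conj G \<eta> g) (ga_conj G \<eta> h) = (\<lambda>_. 0)"
    if gh: "g \<in> carrier G" "h \<in> carrier G" and ne: "ga_conj G \<eta> g \<noteq> ga_conj G \<eta> h" for g h
  proof -
    \<comment> \<open>Conjugation is a right action, so conjugating by \<open>?b\<close> and then by
      \<open>g\<close> is conjugating by \<open>h\<close>.\<close>
    let ?b = "h \<otimes> inv g"
    have hb: "ga_conj G (ga_conj G \<eta> ?b) g = ga_conj G \<eta> h"
      using ga_conj_comp[OF e_rat_supp, where g="?b" and h=g] gh by (simp add: m_assoc)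
    have "ga_mult G \<eta> (ga_conj G \<eta> ?b) = (\<lambda>_. 0)"
    proof (rule ccontr)
      assume "ga_mult G \<eta> (ga_conj G \<eta> ?b) \<noteq> (\<lambda>_. 0)"
      then have "ga_conj G \<eta> ?b = \<eta>" using gh by (intro e_rat_conj(1)) auto
      then show False using hb ne by simp
    qed
    moreover have "ga_mult G (ga_conj G \<eta> g) (ga_conj G (ga_conj G \<eta> ?b) g) = ga_conj G (ga_mult G \<eta> (ga_conj G \<eta> ?b)) g"
      by (rule ga_mult_conj) (use gh cs e_rat_supp in auto)
    moreover have "ga_conj G (\<lambda>_. 0) g = (\<lambda>_. 0)"
      using gh by (intro ext) (simp add: ga_conj_eq)
    ultimately show ?thesis unfolding hb by simp
  qed
  show "ga_orthogonal G (ga_conj G \<eta> g) (ga_conj G \<eta> h)"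
    if "g \<in> carrier G" "h \<in> carrier G" "ga_conj G \<eta> g \<noteq> ga_conj G \<eta> h" for g h
    using orth[OF that] orth[OF that(2,1) that(3)[symmetric]] by (simp add: ga_orthogonal_def)
qed

end

end

context fin_group
begin

lemma clifford_chain_step_strong:
  assumes B: "subgroup B G" and c: "clifford_chain G T H \<mu>" and N: "N \<lhd> subgrp G B" "N \<subseteq> H"
    and T: "T = stabilizer (subgrp G B) N \<mu>"
  defines "L \<equiv> subgrp G B" and "e \<equiv> e_rat (subgrp G T) (induced (subgrp G T) H \<mu>)"
  shows "T \<subseteq> B" "T \<lhd> subgrp G (ga_cen L e)"
    "\<And>g h. g \<in> B \<Longrightarrow> h \<in> B \<Longrightarrow> ga_conj L e g \<noteq> ga_conj L e h \<Longrightarrow>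
       ga_orthogonal L (ga_conj L e g) (ga_conj L e h)"
proof -
  interpret B: fin_group L unfolding L_def by (rule subgroup_fin_group) (rule B)
  note cc = clifford_chainD[OF c]
  interpret TG: fin_group "subgrp G T" by (rule subgroup_fin_group) (rule cc)
  have N': "N \<lhd> L" using N by (simp add: L_def)
  have sT: "subgroup T L" unfolding T L_def[symmetric] by (rule B.subgroup_stabilizer) (rule N')
  show TB: "T \<subseteq> B" using subgroup.subset[OF sT] by (simp add: L_def)
  have NT: "N \<subseteq> T" using N cc by blast
  have N'': "N \<lhd> subgrp G T"
    using B.normal_restrict_supergroup[OF sT N' NT] by (simp add: L_def)
  have st: "\<mu> (inv\<^bsub>subgrp G T\<^esub> x \<otimes>\<^bsub>subgrp G T\<^esub> n \<otimes>\<^bsub>subgrp G T\<^esub> x) = \<mu> n"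
    if "x \<in> carrier (subgrp G T)" "n \<in> N" for x n
  proof -
    have "x \<in> T" using that by simp
    moreover have "inv\<^bsub>subgrp G T\<^esub> x = inv\<^bsub>subgrp G B\<^esub> x"
      using inv_subgrp[OF B] inv_subgrp[OF cc(1)] \<open>x \<in> T\<close> TB by auto
    ultimately show ?thesis using that(2) unfolding T stabilizer_def by simp
  qed
  have \<chi>N: "induced (subgrp G T) H \<mu> (n \<otimes>\<^bsub>L\<^esub> t) = \<mu> n * induced (subgrp G T) H \<mu> t"
    if "n \<in> N" "t \<in> T" for n t
    using TG.induced_mult_stable[OF _ _ N'' N(2) st that(1), of t] that cc subgroup_incl[OF cc(2) cc(1) cc(3)]
    by (simp add: L_def)
  have LT: "subgrp L T = subgrp G T" by (simp add: L_def)
  have sph: "spherical (subgrp L T) (induced (subgrp G T) H \<mu>)" using cc(5) LT by simp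
  note ss = B.strong_step[where T=T and N=N and \<nu>=\<mu> and \<chi>="induced (subgrp G T) H \<mu>",
      OF sT N' NT _ sph \<chi>N refl refl refl]
  show "T \<lhd> subgrp G (ga_cen L e)"
    using ss(1) T by (simp add: L_def e_def)
  show "ga_orthogonal L (ga_conj L e g) (ga_conj L e h)"
    if "g \<in> B" "h \<in> B" "ga_conj L e g \<noteq> ga_conj L e h" for g h
    using ss(2)[of g h] that T by (simp add: L_def e_def)
qed

lemma clifford_chain_strong:
  assumes "clifford_chain G B H \<mu>"
  shows "\<exists>n C. C 0 = H \<and> C n = B \<and> (\<forall>i\<le>n. subgroup (C i) G) \<and>
     (\<forall>i<n. C i \<subseteq> C (Suc i) \<and>
        (let L = subgrp G (C (Suc i));
             e = e_rat (subgrp G (C i)) (induced (subgrp G (C i)) H \<mu>)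
         in C i \<lhd> subgrp G (ga_cen L e) \<and>
            (\<forall>g\<in>C (Suc i). \<forall>h\<in>C (Suc i).
               ga_conj L e g \<noteq> ga_conj L e h \<longrightarrow>
               ga_orthogonal L (ga_conj L e g) (ga_conj L e h))))"
  using assms
proof induction
  case (base H \<mu>)
  show ?case by (rule exI[of _ 0], rule exI[of _ "\<lambda>_. H"]) (use base in simp)
next
  case (step T H \<mu> B N)
  then obtain n C where C: "C 0 = H" "C n = T" "\<forall>i\<le>n. subgroup (C i) G"
    and st: "\<forall>i<n. C i \<subseteq> C (Suc i) \<and>
        (let L = subgrp G (C (Suc i));
             e = e_rat (subgrp G (C i)) (induced (subgrp G (C i)) H \<mu>)
         in C i \<lhd> subgrp G (ga_cen L e) \<and>
            (\<forall>g\<in>C (Suc i). \<forall>h\<in>C (Suc i).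
               ga_conj L e g \<noteq> ga_conj L e h \<longrightarrow>
               ga_orthogonal L (ga_conj L e g) (ga_conj L e h)))"
    by blast
  note cs = clifford_chain_step_strong[OF step(2,1,3,4,5)]
  show ?case
  proof (rule exI[of _ "Suc n"], rule exI[of _ "C(Suc n := B)"], intro conjI allI impI)
    show "(C(Suc n := B)) 0 = H" "(C(Suc n := B)) (Suc n) = B" using C by simp_all
    show "subgroup ((C(Suc n := B)) i) G" if "i \<le> Suc n" for i
      using that C step(2) by (auto simp: le_Suc_eq)
    fix i assume "i < Suc n"
    then consider "i < n" | "i = n" by linarith
    note i = this
    show "(C(Suc n := B)) i \<subseteq> (C(Suc n := B)) (Suc i)"
      using i st cs(1) C(2) by cases auto
    show "let L = subgrp G ((C(Suc n := B)) (Suc i));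
             e = e_rat (subgrp G ((C(Suc n := B)) i)) (induced (subgrp G ((C(Suc n := B)) i)) H \<mu>)
         in (C(Suc n := B)) i \<lhd> subgrp G (ga_cen L e) \<and>
            (\<forall>g\<in>(C(Suc n := B)) (Suc i). \<forall>h\<in>(C(Suc n := B)) (Suc i).
               ga_conj L e g \<noteq> ga_conj L e h \<longrightarrow>
               ga_orthogonal L (ga_conj L e g) (ga_conj L e h))"
      using i
    proof cases
      case 1
      then show ?thesis using st by simp
    next
      case 2
      then show ?thesis using cs(2,3) C(2) by (simp add: Let_def)
    qed
  qed
qed

text \<open>As \<open>N\<close> is normal in \<open>B\<close> and contained in \<open>H\<close>, the
  commutators of its elements with \<open>g\<close> lie in \<open>H\<close>. The hypothesis then
  makes \<open>g\<close> fix \<open>\<mu>\<close> on \<open>N\<close>, so \<open>g\<close> falls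
  into the inertia group; walking down the chain ends in \<open>H\<close>.\<close>

lemma clifford_chain_shoda:
  assumes "clifford_chain G B H \<mu>" "g \<in> B"
    "\<And>h. h \<in> H \<Longrightarrow> inv h \<otimes> inv g \<otimes> h \<otimes> g \<in> H \<Longrightarrow> \<mu> (inv h \<otimes> inv g \<otimes> h \<otimes> g) = 1"
  shows "g \<in> H"
  using assms
proof induction
  case (step T H \<mu> B N)
  interpret B: fin_group "subgrp G B" by (rule subgroup_fin_group) (rule step)
  interpret N: normal N "subgrp G B" by (rule step)
  interpret Bs: subgroup B G by (rule step)
  note cc = clifford_chainD[OF step(1)]
  interpret H: fin_group "subgrp G H" by (rule subgroup_fin_group) (rule cc)
  have "\<mu> (inv\<^bsub>subgrp G B\<^esub> g \<otimes> n \<otimes> g) = \<mu> n" if n: "n \<in> N" for n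
  proof -
    have nB: "n \<in> B" "n \<in> carrier G" "g \<in> carrier G" "n \<in> H"
      using N.mem_carrier[OF n] step.prems n step(4) by auto
    have ig: "inv\<^bsub>subgrp G B\<^esub> g = inv g" using inv_subgrp[OF step(2)] step.prems by simp
    have in': "inv\<^bsub>subgrp G H\<^esub> n = inv n" using inv_subgrp[OF cc(2)] nB by simp
    have m: "inv g \<otimes> n \<otimes> g \<in> N" using N.inv_op_closed1[OF _ n, of g] step.prems ig by simp
    then have mH: "inv g \<otimes> n \<otimes> g \<in> H" using step(4) by blast
    have iH: "inv n \<in> H" using subgroup.m_inv_closed[OF cc(2) nB(4)] .
    have e: "inv n \<otimes> inv g \<otimes> n \<otimes> g = inv n \<otimes> (inv g \<otimes> n \<otimes> g)"
      using nB by (simp add: m_assoc)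
    have "inv n \<otimes> (inv g \<otimes> n \<otimes> g) \<in> H" using subgroup.m_closed[OF cc(2) iH mH] .
    then have "\<mu> (inv n \<otimes> (inv g \<otimes> n \<otimes> g)) = 1" using step.prems(2)[OF nB(4)] e by simp
    moreover have "\<mu> (inv n \<otimes> (inv g \<otimes> n \<otimes> g)) = inverse (\<mu> n) * \<mu> (inv g \<otimes> n \<otimes> g)"
      using cc(4) iH mH H.lin_hom_inv(1)[OF cc(4), of n] nB in' by (simp add: lin_hom_def)
    ultimately have "inverse (\<mu> n) * \<mu> (inv g \<otimes> n \<otimes> g) = 1" by simp
    then show ?thesis using H.lin_hom_inv(2)[OF cc(4), of n] nB ig by (simp add: field_simps)
  qed
  then have "g \<in> T" using step(5) step.prems by (simp add: stabilizer_def)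
  then show ?case using step by blast
qed

lemma lin_hom_kernel_normal:
  assumes "lin_hom G \<mu>"
  shows "{g \<in> carrier G. \<mu> g = 1} \<lhd> G"
proof (rule normal_invI)
  show "subgroup {g \<in> carrier G. \<mu> g = 1} G"
    by (rule subgroupI) (use assms lin_hom_inv[OF assms] one_closed in \<open>auto simp: lin_hom_def\<close>)
  fix x h assume "x \<in> carrier G" "h \<in> {g \<in> carrier G. \<mu> g = 1}"
  then show "x \<otimes> h \<otimes> inv x \<in> {g \<in> carrier G. \<mu> g = 1}"
    using lin_hom_conj[OF assms, of "inv x" h] by simp
qed

lemma lin_hom_pow:
  assumes "lin_hom G \<mu>" "x \<in> carrier G"
  shows "\<mu> (x [^] (k::nat)) = \<mu> x ^ k"
proof (induction k)
  case (Suc k)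
  have "\<mu> (x [^] k \<otimes> x) = \<mu> (x [^] k) * \<mu> x"
    using assms nat_pow_closed[OF assms(2)] unfolding lin_hom_def by blast
  then show ?case using Suc by (simp only: nat_pow_Suc power_Suc mult.commute)
qed (use assms(1) in \<open>simp add: lin_hom_def\<close>)

text \<open>A multiplicative group of \<open>m\<close> complex numbers consists of
  \<open>m\<close>-th roots of unity, and there are only \<open>m\<close> of these. So the image
  contains all of them, in particular a primitive one.\<close>

lemma lin_hom_image_generator:
  assumes \<mu>: "lin_hom G \<mu>"
  shows "\<exists>h\<in>carrier G. \<forall>g\<in>carrier G. \<exists>k::nat. \<mu> g = \<mu> h ^ k"
proof -
  define I where "I = \<mu> ` carrier G"
  define m where "m = card I"
  have fI: "finite I" by (simp add: I_def)
  have m: "m > 0" 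
    unfolding m_def card_gt_0_iff using fI one_closed by (auto simp only: I_def image_is_empty)
  have pw: "z ^ m = 1" if zI: "z \<in> I" for z
  proof -
    obtain x where x: "x \<in> carrier G" "z = \<mu> x" using zI by (auto simp: I_def)
    have z0: "z \<noteq> 0" using lin_hom_inv(2)[OF \<mu>] x by simp
    have I0: "w \<noteq> 0" if "w \<in> I" for w using lin_hom_inv(2)[OF \<mu>] that by (auto simp: I_def)
    have "z * w \<in> I" if wI: "w \<in> I" for w
    proof -
      obtain y where y: "y \<in> carrier G" "w = \<mu> y" using wI by (auto simp: I_def)
      then have "z * w = \<mu> (x \<otimes> y)" using \<mu> x by (simp add: lin_hom_def)
      then show ?thesis using x y by (auto simp: I_def)
    qed
    moreover have inj: "inj_on ((*) z) I" using z0 by (auto simp: inj_on_def)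
    ultimately have im: "(*) z ` I = I" using fI by (intro endo_inj_surj) auto
    \<comment> \<open>Multiplication by \<open>z\<close> permutes the image, hence preserves the
      product of its elements while multiplying it by \<open>z ^ m\<close>.\<close>
    have "(\<Prod>w\<in>I. w) = (\<Prod>w\<in>(*) z ` I. w)" by (simp only: im)
    also have "\<dots> = (\<Prod>w\<in>I. z * w)" by (rule prod.reindex_cong[OF inj]) auto
    also have "\<dots> = z ^ m * (\<Prod>w\<in>I. w)" by (simp add: prod.distrib m_def)
    finally show ?thesis using fI I0 by (simp add: prod_zero_iff)
  qed
  have bij: "bij_betw (\<lambda>k. cis (2 * pi * real k / real m)) {..<m} {z. z ^ m = 1}"
    using m by (rule bij_betw_roots_unity)
  have "card {z::complex. z ^ m = 1} = m" "finite {z::complex. z ^ m = 1}"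
    using bij_betw_same_card[OF bij] bij_betw_finite[OF bij] by auto
  then have I_eq: "I = {z. z ^ m = 1}"
    using pw by (intro card_subset_eq) (auto simp: m_def)
  have "root_unity m 1 \<in> I" using I_eq root_unity_power(1)[OF m] by simp
  then obtain h where h: "h \<in> carrier G" "\<mu> h = root_unity m 1" by (auto simp: I_def)
  have "\<exists>k. \<mu> g = \<mu> h ^ k" if gG: "g \<in> carrier G" for g
  proof -
    have "\<mu> g \<in> {z. z ^ m = 1}" using gG I_eq by (auto simp: I_def)
    then obtain k where "\<mu> g = cis (2 * pi * real k / real m)"
      using bij by (auto simp: bij_betw_def)
    then have "\<mu> g = \<mu> h ^ k" using h by (simp add: root_unity_def DeMoivre mult_ac)
    then show ?thesis by blast
  qed
  then show ?thesis using h by blast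
qed

lemma lin_hom_quotient_cyclic:
  assumes \<mu>: "lin_hom G \<mu>"
  shows "cyclic_group (G Mod {g \<in> carrier G. \<mu> g = 1})"
proof -
  define D where "D = {g \<in> carrier G. \<mu> g = 1}"
  interpret K: normal D G unfolding D_def by (rule lin_hom_kernel_normal) (rule \<mu>)
  interpret Q: group "G Mod D" by (rule K.factorgroup_is_group)
  obtain h where h: "h \<in> carrier G" "\<And>g. g \<in> carrier G \<Longrightarrow> \<exists>k::nat. \<mu> g = \<mu> h ^ k"
    using lin_hom_image_generator[OF \<mu>] by blast
  have hQ: "D #> h \<in> carrier (G Mod D)" 
    unfolding carrier_FactGroup using h(1) by (rule imageI)
  have "carrier (G Mod D) = range (\<lambda>n::int. (D #> h) [^]\<^bsub>G Mod D\<^esub> n)"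
  proof
    show "carrier (G Mod D) \<subseteq> range (\<lambda>n::int. (D #> h) [^]\<^bsub>G Mod D\<^esub> n)"
    proof
      fix C assume "C \<in> carrier (G Mod D)"
      then obtain g where g: "g \<in> carrier G" "C = D #> g"
        unfolding carrier_FactGroup by (rule imageE) blast
      obtain k :: nat where k: "\<mu> g = \<mu> h ^ k" using h g by blast
      let ?p = "h [^] k"
      have p: "?p \<in> carrier G" "\<mu> ?p = \<mu> g" using h(1) lin_hom_pow[OF \<mu>] k by simp_all
      have "g \<otimes> inv ?p \<in> D"
        unfolding D_def using g(1) p lin_hom_inv[OF \<mu>] \<mu> by (simp add: lin_hom_def)
      then have "g \<in> D #> ?p"
        unfolding r_coset_def using g(1) p by (intro UN_I[of "g \<otimes> inv ?p"]) (simp_all add: m_assoc)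
      then have "D #> g = D #> ?p"
        using repr_independence[OF _ p(1) K.subgroup_axioms] by simp
      also have "\<dots> = (D #> h) [^]\<^bsub>G Mod D\<^esub> k"
        by (rule K.FactGroup_pow[symmetric]) (rule h)
      also have "\<dots> = (D #> h) [^]\<^bsub>G Mod D\<^esub> int k" by (simp add: int_pow_int)
      finally show "C \<in> range (\<lambda>n::int. (D #> h) [^]\<^bsub>G Mod D\<^esub> n)" using g by blast
    qed
    show "range (\<lambda>n::int. (D #> h) [^]\<^bsub>G Mod D\<^esub> n) \<subseteq> carrier (G Mod D)"
      using Q.int_pow_closed[OF hQ] by blast
  qed
  then show ?thesis using Q.cyclic_group hQ unfolding D_def by blast
qed

end

section \<open>Irreducible characters are spherical\<close>

lemma ring_mat_Units:
  "x \<in> Units (ring_mat TYPE(complex) n b) \<longleftrightarrow>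
    x \<in> carrier_mat n n \<and> (\<exists>y\<in>carrier_mat n n. y * x = 1\<^sub>m n \<and> x * y = 1\<^sub>m n)"
  by (auto simp: Units_def ring_mat_def)

lemma carrier_vec_subspaceI:
  assumes "W \<subseteq> carrier_vec n" "0\<^sub>v n \<in> W" "\<And>v w. v \<in> W \<Longrightarrow> w \<in> W \<Longrightarrow> v + w \<in> W"
    "\<And>c v. v \<in> W \<Longrightarrow> c \<cdot>\<^sub>v v \<in> W"
  shows "VectorSpace.subspace class_ring W (module_vec TYPE(complex) n)"
proof -
  interpret vec_space "TYPE(complex)" n .
  show ?thesis
    unfolding VectorSpace.subspace_def submodule_def
    using assms vectorspace_axioms module_axioms by (auto simp: module_vec_simps)
qed

lemma carrier_vec_subspaceD:
  assumes "VectorSpace.subspace class_ring W (module_vec TYPE(complex) n)"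
  shows "W \<subseteq> carrier_vec n" "0\<^sub>v n \<in> W" "\<And>c v. v \<in> W \<Longrightarrow> c \<cdot>\<^sub>v v \<in> W"
  using assms unfolding VectorSpace.subspace_def submodule_def by (auto simp: module_vec_simps)

context fin_group
begin

lemma linear_character_lin_hom:
  assumes \<mu>: "lin_hom G \<mu>"
  shows "linear_character G (restrict \<mu> (carrier G))"
proof -
  define \<rho> where "\<rho> g = mat 1 1 (\<lambda>_. \<mu> g)" for g
  have c: "\<rho> g \<in> carrier_mat 1 1" for g by (simp add: \<rho>_def)
  have m: "\<rho> g * \<rho> h = \<rho> (g \<otimes> h)" if "g \<in> carrier G" "h \<in> carrier G" for g h
    using that \<mu> by (intro eq_matI) (auto simp: \<rho>_def scalar_prod_def lin_hom_def)
  have o: "\<rho> \<one> = 1\<^sub>m 1" using \<mu> by (intro eq_matI) (auto simp: \<rho>_def lin_hom_def)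
  have "\<rho> g \<in> Units (ring_mat TYPE(complex) 1 ())" if "g \<in> carrier G" for g
    unfolding ring_mat_Units using c m[of g "inv g"] m[of "inv g" g] that o
    by (intro conjI bexI[of _ "\<rho> (inv g)"]) auto
  then have "representation G 1 \<rho>"
    using m by (auto simp: representation_def hom_def units_of_def ring_mat_def)
  moreover have "W = {0\<^sub>v 1} \<or> W = carrier_vec 1"
    if W: "VectorSpace.subspace class_ring W (module_vec TYPE(complex) 1)" for W
  proof (cases "W = {0\<^sub>v 1}")
    case False
    note S = carrier_vec_subspaceD[OF W]
    obtain w where w: "w \<in> W" "w \<noteq> 0\<^sub>v 1" using False S(2) by blast
    then have wc: "w \<in> carrier_vec 1" using S(1) by blast
    have w0: "w $ 0 \<noteq> 0"
    proof
      assume "w $ 0 = 0"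
      then have "w = 0\<^sub>v 1" using wc by (intro eq_vecI) auto
      then show False using w by simp
    qed
    have "v \<in> W" if v: "v \<in> carrier_vec 1" for v
    proof -
      have "v = (v $ 0 / w $ 0) \<cdot>\<^sub>v w" using v wc w0 by (intro eq_vecI) auto
      then show ?thesis using S(3)[OF w(1)] by metis
    qed
    then show ?thesis using S(1) by blast
  qed simp
  ultimately have "irreducible_representation G 1 \<rho>"
    by (simp add: irreducible_representation_def)
  moreover have "restrict \<mu> (carrier G) = (\<lambda>g\<in>carrier G. mat_trace (\<rho> g))"
    by (simp add: mat_trace_def \<rho>_def)
  ultimately have "restrict \<mu> (carrier G) \<in> irr G" unfolding irr_def by blast
  then show ?thesis using \<mu> by (simp add: linear_character_def lin_hom_def)
qed

context
  fixes n \<rho>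
  assumes irred: "irreducible_representation G n \<rho>"
begin

lemma rep_n: "n > 0"
  using irred by (simp add: irreducible_representation_def)

lemma rep_units: "g \<in> carrier G \<Longrightarrow> \<rho> g \<in> Units (ring_mat TYPE(complex) n ())"
  and rep_mult: "g \<in> carrier G \<Longrightarrow> h \<in> carrier G \<Longrightarrow> \<rho> (g \<otimes> h) = \<rho> g * \<rho> h"
  using irred by (auto simp: irreducible_representation_def representation_def hom_def units_of_def ring_mat_def)

lemma rep_carrier: "g \<in> carrier G \<Longrightarrow> \<rho> g \<in> carrier_mat n n"
  using rep_units[of g] by (simp add: ring_mat_Units)

text \<open>Membership in \<open>hom\<close> only provides multiplicativity, so
  \<open>\<rho> \<one>\<close> is first known as an invertible idempotent.\<close>

lemma rep_one: "\<rho> \<one> = 1\<^sub>m n"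
proof -
  obtain y where y: "y \<in> carrier_mat n n" "y * \<rho> \<one> = 1\<^sub>m n"
    using rep_units[of \<one>] by (auto simp: ring_mat_Units)
  note c = rep_carrier[OF one_closed]
  have "\<rho> \<one> = (y * \<rho> \<one>) * \<rho> \<one>" using y c by simp
  also have "\<dots> = y * (\<rho> \<one> * \<rho> \<one>)" by (rule assoc_mult_mat[OF y(1) c c])
  also have "\<rho> \<one> * \<rho> \<one> = \<rho> \<one>" using rep_mult[of \<one> \<one>] by simp
  finally show ?thesis using y by simp
qed

lemma rep_entry_mult:
  assumes "g \<in> carrier G" "h \<in> carrier G" "i < n" "j < n"
  shows "\<rho> (g \<otimes> h) $$ (i, j) = (\<Sum>k<n. \<rho> g $$ (i, k) * \<rho> h $$ (k, j))"
  using assms rep_carrier[of g] rep_carrier[of h]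
  by (simp add: rep_mult scalar_prod_def atLeast0LessThan)

text \<open>An eigenspace of \<open>A\<close> is nonzero and invariant under \<open>\<rho>\<close>,
  hence the whole space. Existence of an eigenvalue is where algebraic closedness enters.\<close>

lemma schur:
  assumes A: "A \<in> carrier_mat n n" and comm: "\<And>g. g \<in> carrier G \<Longrightarrow> A * \<rho> g = \<rho> g * A"
  shows "\<exists>c. \<forall>i<n. \<forall>j<n. A $$ (i, j) = (if i = j then c else 0)"
proof -
  obtain k v where v: "eigenvector A v k"
    using spectrum_non_empty[OF A rep_n] by (auto simp: spectrum_def eigenvalue_def)
  define W where "W = {v \<in> carrier_vec n. A *\<^sub>v v = k \<cdot>\<^sub>v v}"
  have "VectorSpace.subspace class_ring W (module_vec TYPE(complex) n)"
  proof (rule carrier_vec_subspaceI)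
    show "W \<subseteq> carrier_vec n" by (auto simp: W_def)
    show "0\<^sub>v n \<in> W" using A by (auto simp: W_def)
    show "v + w \<in> W" if "v \<in> W" "w \<in> W" for v w
      using that A by (auto simp: W_def mult_add_distrib_mat_vec smult_add_distrib_vec)
    show "c \<cdot>\<^sub>v v \<in> W" if "v \<in> W" for c v
      using that A by (auto simp: W_def mult_mat_vec smult_smult_assoc mult.commute)
  qed
  moreover have "\<rho> g *\<^sub>v w \<in> W" if g: "g \<in> carrier G" and w: "w \<in> W" for g w
  proof -
    note c = rep_carrier[OF g]
    have wc: "w \<in> carrier_vec n" "A *\<^sub>v w = k \<cdot>\<^sub>v w" using w by (auto simp: W_def)
    have "A *\<^sub>v (\<rho> g *\<^sub>v w) = (A * \<rho> g) *\<^sub>v w" using A c wc by simp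
    also have "\<dots> = \<rho> g *\<^sub>v (A *\<^sub>v w)" using A c wc by (simp add: comm[OF g])
    also have "\<dots> = k \<cdot>\<^sub>v (\<rho> g *\<^sub>v w)" using wc mult_mat_vec[OF c wc(1)] by simp
    finally show ?thesis using c wc by (simp add: W_def)
  qed
  ultimately have "W = {0\<^sub>v n} \<or> W = carrier_vec n"
    using irred by (simp add: irreducible_representation_def)
  moreover have "v \<in> W" "v \<noteq> 0\<^sub>v n"
    using v A by (auto simp: W_def eigenvector_def)
  ultimately have W: "W = carrier_vec n" by blast
  have "A $$ (i, j) = (if i = j then k else 0)" if ij: "i < n" "j < n" for i j
  proof -
    have "unit_vec n j \<in> W" unfolding W by simp
    then have "(A *\<^sub>v unit_vec n j) $ i = (k \<cdot>\<^sub>v unit_vec n j) $ i" by (simp add: W_def)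
    moreover have "(A *\<^sub>v unit_vec n j) $ i = A $$ (i, j)"
      using A ij by (simp add: scalar_prod_right_unit)
    moreover have "(k \<cdot>\<^sub>v unit_vec n j) $ i = (if i = j then k else 0)"
      using ij by (simp add: unit_vec_def)
    ultimately show ?thesis by simp
  qed
  then show ?thesis by blast
qed

text \<open>The sums \<open>a i j\<close> are the entries of the sum over \<open>g\<close> of
  \<open>\<rho> (inv g) * E * \<rho> g\<close>, with \<open>E\<close> the elementary matrix at
  position \<open>(k, l)\<close>. This matrix commutes with \<open>\<rho>\<close>, so Schur's lemma
  makes it scalar, and its trace determines the scalar.\<close>

lemma schur_orthogonality:
  assumes i: "i < n" and j: "j < n" and k: "k < n" and l: "l < n"
  shows "(\<Sum>g\<in>carrier G. \<rho> (inv g) $$ (i, k) * \<rho> g $$ (l, j)) =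
    (if i = j \<and> k = l then of_nat (card (carrier G)) / of_nat n else 0)"
proof -
  define a where "a i j = (\<Sum>g\<in>carrier G. \<rho> (inv g) $$ (i, k) * \<rho> g $$ (l, j))" for i j
  define A where "A = mat n n (\<lambda>(i, j). a i j)"
  have A: "A \<in> carrier_mat n n" "\<And>i j. i < n \<Longrightarrow> j < n \<Longrightarrow> A $$ (i, j) = a i j"
    by (auto simp: A_def)
  have "A * \<rho> h = \<rho> h * A" if h: "h \<in> carrier G" for h
  proof (rule eq_matI)
    note c = rep_carrier[OF h]
    fix i m assume "i < dim_row (\<rho> h * A)" "m < dim_col (\<rho> h * A)"
    then have im: "i < n" "m < n" using A c by auto
    have "(A * \<rho> h) $$ (i, m) = (\<Sum>j<n. a i j * \<rho> h $$ (j, m))"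
      using A c im by (simp add: scalar_prod_def atLeast0LessThan)
    also have "\<dots> = (\<Sum>j<n. \<Sum>g\<in>carrier G. \<rho> (inv g) $$ (i, k) * (\<rho> g $$ (l, j) * \<rho> h $$ (j, m)))"
      by (simp add: a_def sum_distrib_right mult.assoc)
    also have "\<dots> = (\<Sum>g\<in>carrier G. \<Sum>j<n. \<rho> (inv g) $$ (i, k) * (\<rho> g $$ (l, j) * \<rho> h $$ (j, m)))"
      by (rule sum.swap)
    also have "\<dots> = (\<Sum>g\<in>carrier G. \<rho> (inv g) $$ (i, k) * \<rho> (g \<otimes> h) $$ (l, m))"
      using h l im by (intro sum.cong refl) (simp add: rep_entry_mult sum_distrib_left)
    also have "\<dots> = (\<Sum>g\<in>carrier G. \<rho> (h \<otimes> inv (g \<otimes> h)) $$ (i, k) * \<rho> (g \<otimes> h) $$ (l, m))"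
      using h by (intro sum.cong refl) (simp add: inv_mult_group)
    also have "\<dots> = (\<Sum>g\<in>carrier G. \<rho> (h \<otimes> inv g) $$ (i, k) * \<rho> g $$ (l, m))"
      by (rule sum_mult_right) (rule h)
    also have "\<dots> = (\<Sum>g\<in>carrier G. \<Sum>j<n. \<rho> h $$ (i, j) * (\<rho> (inv g) $$ (j, k) * \<rho> g $$ (l, m)))"
      using h k im by (intro sum.cong refl) (simp add: rep_entry_mult sum_distrib_right mult.assoc)
    also have "\<dots> = (\<Sum>j<n. \<Sum>g\<in>carrier G. \<rho> h $$ (i, j) * (\<rho> (inv g) $$ (j, k) * \<rho> g $$ (l, m)))"
      by (rule sum.swap)
    also have "\<dots> = (\<Sum>j<n. \<rho> h $$ (i, j) * a j m)"
      by (simp add: a_def sum_distrib_left)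
    also have "\<dots> = (\<rho> h * A) $$ (i, m)"
      using A c im by (simp add: scalar_prod_def atLeast0LessThan)
    finally show "(A * \<rho> h) $$ (i, m) = (\<rho> h * A) $$ (i, m)" .
  qed (use A rep_carrier[OF h] in auto)
  then obtain c where c: "\<And>i j. i < n \<Longrightarrow> j < n \<Longrightarrow> a i j = (if i = j then c else 0)"
    using schur[OF A(1)] A(2) by metis
  have "of_nat n * c = (\<Sum>i<n. a i i)" using c by simp
  also have "\<dots> = (\<Sum>g\<in>carrier G. \<Sum>i<n. \<rho> g $$ (l, i) * \<rho> (inv g) $$ (i, k))"
    unfolding a_def by (subst sum.swap) (simp add: mult.commute)
  also have "\<dots> = (\<Sum>g\<in>carrier G. \<rho> (g \<otimes> inv g) $$ (l, k))"
    using k l by (intro sum.cong refl) (simp add: rep_entry_mult del: r_inv Units_r_inv)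
  also have "\<dots> = (if k = l then of_nat (card (carrier G)) else 0)"
    using k l by (simp add: rep_one)
  finally have "c = (if k = l then of_nat (card (carrier G)) / of_nat n else 0)"
    using rep_n by (auto simp: field_simps split: if_splits)
  then show ?thesis using c[OF i j] by (auto simp: a_def)
qed

text \<open>Both conditions reduce to orthogonality of matrix entries. In the second one the sum
  over \<open>x\<close> only meets entries of \<open>\<rho> (inv x)\<close> and
  \<open>\<rho> x\<close>; what survives is the product of the diagonal sums of
  \<open>\<rho> g\<close> and \<open>\<rho> h\<close>.\<close>

lemma spherical_trace: "spherical G (\<lambda>g. mat_trace (\<rho> g))"
proof -
  define \<chi> where "\<chi> g = (\<Sum>i<n. \<rho> g $$ (i, i))" for g
  have tr: "mat_trace (\<rho> g) = \<chi> g" if "g \<in> carrier G" for g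
    using rep_carrier[OF that] by (simp add: mat_trace_def \<chi>_def)
  let ?N = "of_nat (card (carrier G)) :: complex"
  have one: "\<chi> \<one> = of_nat n" by (simp add: \<chi>_def rep_one)
  have n0: "of_nat n \<noteq> (0::complex)" using rep_n by simp
  have "(\<Sum>g\<in>carrier G. \<chi> g * \<chi> (inv g)) = (\<Sum>g\<in>carrier G. \<Sum>i<n. \<Sum>j<n. \<rho> g $$ (i, i) * \<rho> (inv g) $$ (j, j))"
    by (simp add: \<chi>_def sum_product)
  also have "\<dots> = (\<Sum>i<n. \<Sum>g\<in>carrier G. \<Sum>j<n. \<rho> g $$ (i, i) * \<rho> (inv g) $$ (j, j))" by (rule sum.swap)
  also have "\<dots> = (\<Sum>i<n. \<Sum>j<n. \<Sum>g\<in>carrier G. \<rho> g $$ (i, i) * \<rho> (inv g) $$ (j, j))"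
    by (intro sum.cong[OF refl] sum.swap)
  also have "\<dots> = (\<Sum>i<n. \<Sum>j<n. \<Sum>g\<in>carrier G. \<rho> (inv g) $$ (j, j) * \<rho> g $$ (i, i))"
    by (simp add: mult.commute)
  also have "\<dots> = (\<Sum>i<n. \<Sum>j<n. if j = i then ?N / of_nat n else 0)"
    by (intro sum.cong[OF refl]) (simp add: schur_orthogonality)
  also have "\<dots> = ?N" using n0 by simp
  finally have norm: "(\<Sum>g\<in>carrier G. \<chi> g * \<chi> (inv g)) = ?N" .
  have eq: "\<chi> g * \<chi> h * ?N = of_nat n * (\<Sum>x\<in>carrier G. \<chi> (g \<otimes> (inv x \<otimes> h \<otimes> x)))"
    if g: "g \<in> carrier G" and h: "h \<in> carrier G" for g h
  proof -
    have "\<chi> (g \<otimes> (inv x \<otimes> h \<otimes> x)) = (\<Sum>i<n. \<Sum>k<n. \<Sum>m<n. \<Sum>l<n. \<rho> g $$ (i, k) * \<rho> h $$ (l, m) * (\<rho> (inv x) $$ (k, l) * \<rho> x $$ (m, i)))"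
      if x: "x \<in> carrier G" for x
    proof -
      have "\<rho> (g \<otimes> (inv x \<otimes> h \<otimes> x)) $$ (i, i) = (\<Sum>k<n. \<Sum>m<n. \<Sum>l<n. \<rho> g $$ (i, k) * \<rho> h $$ (l, m) * (\<rho> (inv x) $$ (k, l) * \<rho> x $$ (m, i)))"
        if i: "i < n" for i
      proof -
        have "\<rho> (g \<otimes> (inv x \<otimes> h \<otimes> x)) $$ (i, i) = (\<Sum>k<n. \<rho> g $$ (i, k) * (\<Sum>m<n. (\<Sum>l<n. \<rho> (inv x) $$ (k, l) * \<rho> h $$ (l, m)) * \<rho> x $$ (m, i)))"
          using g h x i by (simp add: rep_entry_mult)
        then show ?thesis by (simp add: sum_distrib_left sum_distrib_right mult_ac)
      qed
      then show ?thesis by (simp add: \<chi>_def)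
    qed
    then have "(\<Sum>x\<in>carrier G. \<chi> (g \<otimes> (inv x \<otimes> h \<otimes> x)))
      = (\<Sum>x\<in>carrier G. \<Sum>i<n. \<Sum>k<n. \<Sum>m<n. \<Sum>l<n. \<rho> g $$ (i, k) * \<rho> h $$ (l, m) * (\<rho> (inv x) $$ (k, l) * \<rho> x $$ (m, i)))"
      by simp
    also have "\<dots> = (\<Sum>i<n. \<Sum>x\<in>carrier G. \<Sum>k<n. \<Sum>m<n. \<Sum>l<n. \<rho> g $$ (i, k) * \<rho> h $$ (l, m) * (\<rho> (inv x) $$ (k, l) * \<rho> x $$ (m, i)))"
      by (rule sum.swap)
    also have "\<dots> = (\<Sum>i<n. \<Sum>k<n. \<Sum>x\<in>carrier G. \<Sum>m<n. \<Sum>l<n. \<rho> g $$ (i, k) * \<rho> h $$ (l, m) * (\<rho> (inv x) $$ (k, l) * \<rho> x $$ (m, i)))"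
      by (intro sum.cong[OF refl] sum.swap)
    also have "\<dots> = (\<Sum>i<n. \<Sum>k<n. \<Sum>m<n. \<Sum>x\<in>carrier G. \<Sum>l<n. \<rho> g $$ (i, k) * \<rho> h $$ (l, m) * (\<rho> (inv x) $$ (k, l) * \<rho> x $$ (m, i)))"
      by (intro sum.cong[OF refl] sum.swap)
    also have "\<dots> = (\<Sum>i<n. \<Sum>k<n. \<Sum>m<n. \<Sum>l<n. \<Sum>x\<in>carrier G. \<rho> g $$ (i, k) * \<rho> h $$ (l, m) * (\<rho> (inv x) $$ (k, l) * \<rho> x $$ (m, i)))"
      by (intro sum.cong[OF refl] sum.swap)
    also have "\<dots> = (\<Sum>i<n. \<Sum>k<n. \<Sum>m<n. \<Sum>l<n. if l = m then (if k = i then \<rho> g $$ (i, k) * \<rho> h $$ (l, m) * (?N / of_nat n) else 0) else 0)"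
      by (intro sum.cong[OF refl]) (simp add: schur_orthogonality sum_distrib_left[symmetric])
    also have "\<dots> = (\<Sum>i<n. \<Sum>k<n. if k = i then (\<Sum>m<n. \<rho> g $$ (i, i) * \<rho> h $$ (m, m) * (?N / of_nat n)) else 0)"
      by (intro sum.cong[OF refl]) simp
    also have "\<dots> = (\<Sum>i<n. \<Sum>m<n. \<rho> g $$ (i, i) * \<rho> h $$ (m, m) * (?N / of_nat n))"
      by (rule sum.cong[OF refl]) (simp only: sum.delta finite_lessThan if_True)
    also have "\<dots> = \<chi> g * \<chi> h * (?N / of_nat n)"
      unfolding \<chi>_def by (simp only: sum_product) (simp only: sum_distrib_right)
    finally show ?thesis using n0 by simp
  qed
  have "spherical G \<chi>"
    using one norm eq rep_n by (simp add: spherical_def)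
  then show ?thesis using spherical_cong[OF is_group tr] by simp
qed

end

lemma irr_spherical: "\<chi> \<in> irr G \<Longrightarrow> spherical G \<chi>"
proof -
  assume "\<chi> \<in> irr G"
  then obtain n \<rho> where \<rho>: "irreducible_representation G n \<rho>"
    and \<chi>: "\<chi> = (\<lambda>g\<in>carrier G. mat_trace (\<rho> g))" by (auto simp: irr_def)
  have "spherical G \<chi> = spherical G (\<lambda>g. mat_trace (\<rho> g))"
    by (intro spherical_cong is_group) (simp add: \<chi>)
  then show ?thesis using spherical_trace[OF \<rho>] by simp
qed

end

section \<open>Triangular permutations of a group with an abelian series\<close>

text \<open>The extension takes the value \<open>\<nu> a\<close> on \<open>a \<otimes> c\<close>. It
  is well defined because \<open>\<nu>\<close> is trivial on the intersection, so \<open>C\<close>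
  need only be a complement modulo the kernel of \<open>\<nu>\<close>; it is multiplicative because
  \<open>\<nu>\<close> is invariant.\<close>

lemma (in fin_group) lin_hom_extend:
  assumes A: "A \<lhd> G" and C: "subgroup C G" and \<nu>: "lin_hom (subgrp G A) \<nu>"
    and AC: "\<And>g. g \<in> carrier G \<Longrightarrow> \<exists>a\<in>A. \<exists>c\<in>C. g = a \<otimes> c"
    and inv\<nu>: "\<And>g a. g \<in> carrier G \<Longrightarrow> a \<in> A \<Longrightarrow> \<nu> (inv g \<otimes> a \<otimes> g) = \<nu> a"
    and int: "\<And>c. c \<in> A \<Longrightarrow> c \<in> C \<Longrightarrow> \<nu> c = 1"
  obtains \<delta> where "lin_hom G \<delta>" "\<And>a. a \<in> A \<Longrightarrow> \<delta> a = \<nu> a"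
proof -
  interpret A: normal A G by fact
  interpret C: subgroup C G by fact
  have \<nu>m: "\<nu> (a \<otimes> b) = \<nu> a * \<nu> b" if "a \<in> A" "b \<in> A" for a b
    using \<nu> that by (simp add: lin_hom_def)
  define p where "p g = (SOME a. a \<in> A \<and> (\<exists>c\<in>C. g = a \<otimes> c))" for g
  define \<delta> where "\<delta> g = \<nu> (p g)" for g
  have \<delta>: "\<delta> (a \<otimes> c) = \<nu> a" if ac: "a \<in> A" "c \<in> C" for a c
  proof -
    have "p (a \<otimes> c) \<in> A \<and> (\<exists>c'\<in>C. a \<otimes> c = p (a \<otimes> c) \<otimes> c')"
      unfolding p_def by (rule someI[of _ a]) (use ac in blast)
    then obtain c' where p: "p (a \<otimes> c) \<in> A" "c' \<in> C" "a \<otimes> c = p (a \<otimes> c) \<otimes> c'" by blast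
    let ?q = "p (a \<otimes> c)"
    have G: "a \<in> carrier G" "c \<in> carrier G" "?q \<in> carrier G" "c' \<in> carrier G"
      using ac p A.mem_carrier C.mem_carrier by blast+
    have e: "inv ?q \<otimes> a = c' \<otimes> inv c"
    proof -
      have "inv ?q \<otimes> (a \<otimes> c) \<otimes> inv c = inv ?q \<otimes> (?q \<otimes> c') \<otimes> inv c" using p(3) by simp
      then show ?thesis using G by (simp add: m_assoc)
    qed
    have qA: "inv ?q \<otimes> a \<in> A" using p(1) ac(1) by blast
    have "inv ?q \<otimes> a \<in> C" unfolding e using p(2) ac(2) by blast
    with qA have "\<nu> (inv ?q \<otimes> a) = 1" by (rule int)
    moreover have "\<nu> a = \<nu> (?q \<otimes> (inv ?q \<otimes> a))" using G by simp
    ultimately have "\<nu> a = \<nu> ?q" using \<nu>m[OF p(1) qA] by simp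
    then show ?thesis by (simp add: \<delta>_def)
  qed
  have \<delta>A: "\<delta> a = \<nu> a" if "a \<in> A" for a
    using \<delta>[OF that C.one_closed] A.mem_carrier[OF that] by simp
  have "\<delta> (g \<otimes> h) = \<delta> g * \<delta> h" if gh: "g \<in> carrier G" "h \<in> carrier G" for g h
  proof -
    obtain a c where 1: "a \<in> A" "c \<in> C" "g = a \<otimes> c" using AC[OF gh(1)] by blast
    obtain b d where 2: "b \<in> A" "d \<in> C" "h = b \<otimes> d" using AC[OF gh(2)] by blast
    have G: "a \<in> carrier G" "c \<in> carrier G" "b \<in> carrier G" "d \<in> carrier G"
      using 1 2 A.mem_carrier C.mem_carrier by blast+
    have e: "g \<otimes> h = (a \<otimes> (c \<otimes> b \<otimes> inv c)) \<otimes> (c \<otimes> d)"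
      using 1(3) 2(3) G by (simp add: m_assoc)
    have cb: "c \<otimes> b \<otimes> inv c \<in> A" using G 2 by (intro A.inv_op_closed2)
    have "\<nu> (c \<otimes> b \<otimes> inv c) = \<nu> b" using inv\<nu>[of "inv c" b] G 2 by simp
    then have "\<delta> (g \<otimes> h) = \<nu> a * \<nu> b"
      unfolding e using \<delta>[OF A.m_closed[OF 1(1) cb] C.m_closed[OF 1(2) 2(2)]] \<nu>m[OF 1(1) cb] by simp
    then show ?thesis using \<delta> 1 2 by simp
  qed
  moreover have "\<delta> \<one> = 1" using \<delta>A[OF A.one_closed] \<nu> by (simp add: lin_hom_def)
  ultimately have "lin_hom G \<delta>" by (simp add: lin_hom_def)
  then show ?thesis using \<delta>A that by blast
qed

definition coset_cong :: "('a, 'b) monoid_scheme \<Rightarrow> 'a set \<Rightarrow> 'a \<Rightarrow> 'a \<Rightarrow> bool" where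
  "coset_cong G N x y \<longleftrightarrow> inv\<^bsub>G\<^esub> x \<otimes>\<^bsub>G\<^esub> y \<in> N"

text \<open>At every layer \<open>\<pi>\<close> commutes with right multiplication by
  \<open>N i\<close> up to \<open>N (Suc i)\<close>. Left multiplications commute with right
  multiplications exactly, which is how \<open>G\<close> gets in.\<close>

definition triangular ::
    "('a, 'b) monoid_scheme \<Rightarrow> (nat \<Rightarrow> 'a set) \<Rightarrow> nat \<Rightarrow> ('a \<Rightarrow> 'a) \<Rightarrow> bool" where
  "triangular G N k \<pi> \<longleftrightarrow> bij_betw \<pi> (carrier G) (carrier G) \<and>
     (\<forall>i<k. \<forall>x\<in>carrier G. \<forall>n\<in>N i. coset_cong G (N (Suc i)) (\<pi> (x \<otimes>\<^bsub>G\<^esub> n)) (\<pi> x \<otimes>\<^bsub>G\<^esub> n))"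

locale abelian_series = G: fin_group G for G (structure) +
  fixes N :: "nat \<Rightarrow> 'a set" and k :: nat
  assumes N_normal: "N i \<lhd> G"
    and N_0: "N 0 = carrier G" and N_k: "N k = {\<one>}" and N_Suc: "N (Suc i) \<subseteq> N i"
    and N_comm: "a \<in> N i \<Longrightarrow> b \<in> N i \<Longrightarrow> inv (a \<otimes> b) \<otimes> (b \<otimes> a) \<in> N (Suc i)"
begin

abbreviation "cng i \<equiv> coset_cong G (N i)"

lemma N_subgroup: "subgroup (N i) G"
  using N_normal by (rule normal_imp_subgroup)

lemma N_carrier: "n \<in> N i \<Longrightarrow> n \<in> carrier G"
  using N_subgroup by (rule subgroup.mem_carrier)

lemma N_mono: "i \<le> j \<Longrightarrow> N j \<subseteq> N i"
  by (rule lift_Suc_antimono_le[of N]) (use N_Suc in auto)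

lemma cng_refl [simp]: "x \<in> carrier G \<Longrightarrow> cng i x x"
  using subgroup.one_closed[OF N_subgroup] by (simp add: coset_cong_def)

lemma cng_sym:
  assumes "cng i x y" "x \<in> carrier G" "y \<in> carrier G" shows "cng i y x"
proof -
  have "inv (inv x \<otimes> y) \<in> N i"
    using assms subgroup.m_inv_closed[OF N_subgroup] by (simp add: coset_cong_def)
  then show ?thesis using assms by (simp add: coset_cong_def G.inv_mult_group)
qed

lemma cng_trans:
  assumes "cng i x y" "cng i y z" "x \<in> carrier G" "y \<in> carrier G" "z \<in> carrier G"
  shows "cng i x z"
proof -
  have "(inv x \<otimes> y) \<otimes> (inv y \<otimes> z) \<in> N i"
    using assms subgroup.m_closed[OF N_subgroup] by (simp add: coset_cong_def)
  then show ?thesis using assms by (simp add: coset_cong_def G.m_assoc)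
qed

lemma cng_mono: "cng j x y \<Longrightarrow> i \<le> j \<Longrightarrow> cng i x y"
  using N_mono by (auto simp: coset_cong_def)

lemma cng_mult_right:
  assumes "cng i x y" "x \<in> carrier G" "y \<in> carrier G" "z \<in> carrier G"
  shows "cng i (x \<otimes> z) (y \<otimes> z)"
proof -
  interpret N: normal "N i" G by (rule N_normal)
  have "inv z \<otimes> (inv x \<otimes> y) \<otimes> z \<in> N i"
    using assms by (intro N.inv_op_closed1) (auto simp: coset_cong_def)
  then show ?thesis using assms by (simp add: coset_cong_def G.inv_mult_group G.m_assoc)
qed

lemma cng_mult_N: "x \<in> carrier G \<Longrightarrow> n \<in> N i \<Longrightarrow> cng i x (x \<otimes> n)"
  using N_carrier[of n i] by (simp add: coset_cong_def)

lemma cngE: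
  assumes "cng i x y" "x \<in> carrier G" "y \<in> carrier G"
  obtains n where "n \<in> N i" "y = x \<otimes> n"
  using assms that[of "inv x \<otimes> y"] by (simp add: coset_cong_def)

lemma cng_0: "x \<in> carrier G \<Longrightarrow> y \<in> carrier G \<Longrightarrow> cng 0 x y"
  by (simp add: coset_cong_def N_0)

lemma cng_k: "cng k x y \<Longrightarrow> x \<in> carrier G \<Longrightarrow> y \<in> carrier G \<Longrightarrow> x = y"
  using G.mult_inv_cancel(1)[of x y] by (simp add: coset_cong_def N_k)

lemma triangular_cng:
  assumes \<pi>: "triangular G N k \<pi>" and i: "i \<le> k" and c: "cng i x y" and x: "x \<in> carrier G" and y: "y \<in> carrier G"
  shows "cng i (\<pi> x) (\<pi> y)"
proof -
  have \<pi>G: "\<pi> z \<in> carrier G" if "z \<in> carrier G" for z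
    using \<pi> that by (auto simp: triangular_def bij_betw_def)
  show ?thesis
  proof (cases "i = k")
    case True
    then have "x = y" using cng_k c x y by blast
    then show ?thesis using \<pi>G x by simp
  next
    case False
    then have ik: "i < k" using i by simp
    obtain n where n: "n \<in> N i" "y = x \<otimes> n" using cngE[OF c x y] .
    have nG: "n \<in> carrier G" using N_carrier n by blast
    have "cng (Suc i) (\<pi> y) (\<pi> x \<otimes> n)" using \<pi> ik n x by (simp add: triangular_def)
    then have "cng i (\<pi> y) (\<pi> x \<otimes> n)" by (rule cng_mono) simp
    then have 1: "cng i (\<pi> x \<otimes> n) (\<pi> y)"
      by (rule cng_sym) (use \<pi>G x y nG in blast)+
    have "cng i (\<pi> x) (\<pi> x \<otimes> n)" using cng_mult_N \<pi>G x n by blast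
    from this 1 show ?thesis
      by (rule cng_trans) (use \<pi>G x y nG in blast)+
  qed
qed

text \<open>For \<open>j \<le> i\<close> the points \<open>x\<close> and
  \<open>x \<otimes> n\<close> share one coset of \<open>N j\<close>, hence one
  \<open>\<tau> x\<close>. For \<open>i < j\<close> congruence modulo \<open>N (Suc i)\<close>
  cannot tell the pieces from \<open>\<pi>\<close>. Injectivity holds since \<open>\<pi>\<close>
  separates the cosets of \<open>N j\<close> and each \<open>\<tau> x\<close> is injective.\<close>

lemma triangular_patch:
  assumes j: "j \<le> k" and \<tau>: "\<And>x. x \<in> carrier G \<Longrightarrow> triangular G N k (\<tau> x)"
    and \<tau>c: "\<And>x y. x \<in> carrier G \<Longrightarrow> y \<in> carrier G \<Longrightarrow> cng j x y \<Longrightarrow> \<tau> x = \<tau> y"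
    and \<pi>: "triangular G N k \<pi>" and \<tau>\<pi>: "\<And>x. x \<in> carrier G \<Longrightarrow> cng j (\<tau> x x) (\<pi> x)"
  shows "triangular G N k (\<lambda>x. \<tau> x x)"
proof -
  have cl: "\<sigma> x \<in> carrier G" if "triangular G N k \<sigma>" "x \<in> carrier G" for \<sigma> x
    using that by (auto simp: triangular_def bij_betw_def)
  have inj: "x = y" if "triangular G N k \<sigma>" "x \<in> carrier G" "y \<in> carrier G" "\<sigma> x = \<sigma> y" for \<sigma> x y
    using that by (auto simp: triangular_def bij_betw_def dest: inj_onD)
  have tri: "cng (Suc i) (\<sigma> (x \<otimes> n)) (\<sigma> x \<otimes> n)"
    if "triangular G N k \<sigma>" "i < k" "x \<in> carrier G" "n \<in> N i" for \<sigma> x n i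
    using that by (auto simp: triangular_def)
  have \<pi>inj: "cng j x y" if c: "cng j (\<pi> x) (\<pi> y)" and x: "x \<in> carrier G" and y: "y \<in> carrier G" for x y
  proof -
    obtain n where n: "n \<in> N j" "\<pi> y = \<pi> x \<otimes> n" using cngE[OF c cl[OF \<pi> x] cl[OF \<pi> y]] .
    have fin: "finite {z \<in> carrier G. cng j x z}" by simp
    have "inj_on \<pi> {z \<in> carrier G. cng j x z}" using inj[OF \<pi>] by (auto intro: inj_onI)
    moreover have sub: "\<pi> ` {z \<in> carrier G. cng j x z} \<subseteq> {z \<in> carrier G. cng j (\<pi> x) z}"
      using triangular_cng[OF \<pi> j] x cl[OF \<pi>] by auto
    moreover have cc: "card {z \<in> carrier G. cng j w z} = card (N j)" if w: "w \<in> carrier G" for w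
    proof -
      have "bij_betw (\<lambda>n. w \<otimes> n) (N j) {z \<in> carrier G. cng j w z}"
        by (rule bij_betwI[where g="\<lambda>z. inv w \<otimes> z"])
           (use w N_carrier[of _ j] cng_mult_N[OF w, of _ j] in \<open>auto simp: coset_cong_def\<close>)
      then show ?thesis by (rule bij_betw_same_card[symmetric])
    qed
    \<comment> \<open>Cosets of \<open>N j\<close> have equal finite size, so \<open>\<pi>\<close>
      maps each one onto another; being injective, it also separates cosets.\<close>
    ultimately have im: "\<pi> ` {z \<in> carrier G. cng j x z} = {z \<in> carrier G. cng j (\<pi> x) z}"
      using x cl[OF \<pi> x] by (intro card_subset_eq) (auto simp: card_image cc)
    have "\<pi> y \<in> \<pi> ` {z \<in> carrier G. cng j x z}"
      unfolding im using c cl[OF \<pi> y] by blast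
    then obtain z where "z \<in> carrier G" "cng j x z" "\<pi> z = \<pi> y" by auto
    then show ?thesis using inj[OF \<pi>] y by blast
  qed
  show ?thesis unfolding triangular_def
  proof (intro conjI allI impI ballI)
    have "inj_on (\<lambda>x. \<tau> x x) (carrier G)"
    proof (rule inj_onI)
      fix x y assume xy: "x \<in> carrier G" "y \<in> carrier G" "\<tau> x x = \<tau> y y"
      note xyG = cl[OF \<tau>[OF xy(1)] xy(1)] cl[OF \<pi> xy(1)] cl[OF \<pi> xy(2)]
      have "cng j (\<pi> x) (\<tau> x x)" by (rule cng_sym[OF \<tau>\<pi>[OF xy(1)] xyG(1,2)])
      moreover have "cng j (\<tau> x x) (\<pi> y)" unfolding xy(3) by (rule \<tau>\<pi>[OF xy(2)])
      ultimately have "cng j (\<pi> x) (\<pi> y)" by (rule cng_trans[OF _ _ xyG(2,1,3)])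
      then have "\<tau> x = \<tau> y" using \<pi>inj \<tau>c xy by blast
      then show "x = y" using inj[OF \<tau>[OF xy(1)]] xy by simp
    qed
    moreover have "(\<lambda>x. \<tau> x x) ` carrier G \<subseteq> carrier G" using cl \<tau> by auto
    ultimately show "bij_betw (\<lambda>x. \<tau> x x) (carrier G) (carrier G)"
      by (simp add: bij_betw_def endo_inj_surj)
    fix i x n assume i: "i < k" and x: "x \<in> carrier G" and n: "n \<in> N i"
    have nG: "n \<in> carrier G" and xn: "x \<otimes> n \<in> carrier G" using n x N_carrier by auto
    note G = cl[OF \<tau>[OF x] x] cl[OF \<tau>[OF xn] xn] cl[OF \<pi> x] cl[OF \<pi> xn] nG
    show "cng (Suc i) (\<tau> (x \<otimes> n) (x \<otimes> n)) (\<tau> x x \<otimes> n)"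
    proof (cases "j \<le> i")
      case True
      then have "cng j x (x \<otimes> n)" using cng_mono[OF cng_mult_N[OF x n]] by blast
      then have "\<tau> (x \<otimes> n) = \<tau> x" using \<tau>c[OF x xn] by simp
      then show ?thesis using tri[OF \<tau>[OF x] i x n] by simp
    next
      case False
      then have ji: "Suc i \<le> j" by simp
      have 1: "cng (Suc i) (\<tau> (x \<otimes> n) (x \<otimes> n)) (\<pi> (x \<otimes> n))" using cng_mono[OF \<tau>\<pi>[OF xn] ji] .
      have 2: "cng (Suc i) (\<pi> (x \<otimes> n)) (\<pi> x \<otimes> n)" by (rule tri[OF \<pi> i x n])
      have "cng (Suc i) (\<pi> x) (\<tau> x x)" by (rule cng_sym[OF cng_mono[OF \<tau>\<pi>[OF x] ji] G(1,3)])
      then have 3: "cng (Suc i) (\<pi> x \<otimes> n) (\<tau> x x \<otimes> n)" by (rule cng_mult_right[OF _ G(3,1,5)])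
      show ?thesis using cng_trans[OF cng_trans[OF 1 2] 3] G by simp
    qed
  qed
qed

end

text \<open>An abstract action instead of a set of permutations, so that \<open>M\<close> can later
  consist of natural numbers. Fullness is what turns glued permutations back into elements of
  \<open>M\<close>.\<close>

locale triangular_action = abelian_series G N k + M: fin_group M
  for G :: "('a, 'b) monoid_scheme" (structure) and N k and M :: "('m, 'c) monoid_scheme" +
  fixes act :: "'m \<Rightarrow> 'a \<Rightarrow> 'a"
  assumes act_triangular: "m \<in> carrier M \<Longrightarrow> triangular G N k (act m)"
    and act_mult: "\<lbrakk>m \<in> carrier M; m' \<in> carrier M; x \<in> carrier G\<rbrakk> \<Longrightarrow> act (m \<otimes>\<^bsub>M\<^esub> m') x = act m (act m' x)"
    and act_faithful: "\<lbrakk>m \<in> carrier M; m' \<in> carrier M; \<And>x. x \<in> carrier G \<Longrightarrow> act m x = act m' x\<rbrakk> \<Longrightarrow> m = m'"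
    and act_full: "triangular G N k \<pi> \<Longrightarrow> \<exists>m\<in>carrier M. \<forall>x\<in>carrier G. act m x = \<pi> x"
begin

lemma act_closed [simp]: "m \<in> carrier M \<Longrightarrow> x \<in> carrier G \<Longrightarrow> act m x \<in> carrier G"
  using act_triangular[of m] by (auto simp: triangular_def bij_betw_def)

lemma act_inj: "\<lbrakk>m \<in> carrier M; x \<in> carrier G; y \<in> carrier G; act m x = act m y\<rbrakk> \<Longrightarrow> x = y"
  using act_triangular[of m] by (auto simp: triangular_def bij_betw_def dest: inj_onD)

lemma act_one [simp]: "x \<in> carrier G \<Longrightarrow> act \<one>\<^bsub>M\<^esub> x = x"
  using act_mult[of "\<one>\<^bsub>M\<^esub>" "\<one>\<^bsub>M\<^esub>" x] act_inj[of "\<one>\<^bsub>M\<^esub>" "act \<one>\<^bsub>M\<^esub> x" x] by simp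

lemma act_inv [simp]:
  "m \<in> carrier M \<Longrightarrow> x \<in> carrier G \<Longrightarrow> act (inv\<^bsub>M\<^esub> m) (act m x) = x"
  "m \<in> carrier M \<Longrightarrow> x \<in> carrier G \<Longrightarrow> act m (act (inv\<^bsub>M\<^esub> m) x) = x"
  using act_mult[of "inv\<^bsub>M\<^esub> m" m x] act_mult[of m "inv\<^bsub>M\<^esub> m" x] by simp_all

lemma act_cng:
  "\<lbrakk>m \<in> carrier M; i \<le> k; cng i x y; x \<in> carrier G; y \<in> carrier G\<rbrakk> \<Longrightarrow> cng i (act m x) (act m y)"
  by (rule triangular_cng[OF act_triangular])

lemma act_mult_N:
  "\<lbrakk>m \<in> carrier M; i < k; x \<in> carrier G; n \<in> N i\<rbrakk> \<Longrightarrow> cng (Suc i) (act m (x \<otimes> n)) (act m x \<otimes> n)"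
  using act_triangular[of m] by (auto simp: triangular_def)

lemma act_cng_cancel:
  assumes "m \<in> carrier M" "i \<le> k" "cng i (act m x) (act m y)" "x \<in> carrier G" "y \<in> carrier G"
  shows "cng i x y"
  using act_cng[of "inv\<^bsub>M\<^esub> m" i "act m x" "act m y"] assms by simp

lemma patch:
  assumes j: "j \<le> k" and \<tau>: "\<And>x. x \<in> carrier G \<Longrightarrow> \<tau> x \<in> carrier M"
    and \<tau>c: "\<And>x y. x \<in> carrier G \<Longrightarrow> y \<in> carrier G \<Longrightarrow> cng j x y \<Longrightarrow> \<tau> x = \<tau> y"
    and m: "m \<in> carrier M" and \<tau>m: "\<And>x. x \<in> carrier G \<Longrightarrow> cng j (act (\<tau> x) x) (act m x)"
  shows "\<exists>r\<in>carrier M. \<forall>x\<in>carrier G. act r x = act (\<tau> x) x"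
proof -
  have 1: "triangular G N k (act (\<tau> x))" if "x \<in> carrier G" for x
    by (rule act_triangular[OF \<tau>[OF that]])
  have 2: "act (\<tau> x) = act (\<tau> y)" if "x \<in> carrier G" "y \<in> carrier G" "cng j x y" for x y
    using \<tau>c[OF that] by simp
  have "triangular G N k (\<lambda>x. act (\<tau> x) x)"
    using triangular_patch[where \<tau>="\<lambda>x. act (\<tau> x)" and \<pi>="act m" and j=j, OF j]
      1 2 act_triangular[OF m] \<tau>m by blast
  then show ?thesis using act_full by blast
qed

definition act_cong :: "nat \<Rightarrow> 'm \<Rightarrow> 'm \<Rightarrow> bool" where
  "act_cong j m m' \<longleftrightarrow> (\<forall>x\<in>carrier G. cng j (act m x) (act m' x))"

definition act_kernel :: "nat \<Rightarrow> 'm set" where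
  "act_kernel j = {m \<in> carrier M. \<forall>x\<in>carrier G. cng j (act m x) x}"

text \<open>Relative to \<open>M\<close>, this is 1-closedness in Wielandt's sense for the action on
  \<open>G / N j\<close>: the element \<open>t\<close> of the premise may depend on
  \<open>x\<close>.\<close>

definition orbit_closed :: "nat \<Rightarrow> 'm set \<Rightarrow> bool" where
  "orbit_closed j T \<longleftrightarrow> (\<forall>m\<in>carrier M.
     (\<forall>x\<in>carrier G. \<exists>t\<in>T. cng j (act m x) (act t x)) \<longrightarrow> (\<exists>t\<in>T. act_cong j m t))"

lemma act_kernelD: "m \<in> act_kernel j \<Longrightarrow> m \<in> carrier M"
  "m \<in> act_kernel j \<Longrightarrow> x \<in> carrier G \<Longrightarrow> cng j (act m x) x"
  by (auto simp: act_kernel_def)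

lemma act_kernel_0: "act_kernel 0 = carrier M"
  by (auto simp: act_kernel_def cng_0)

lemma act_kernel_k: "act_kernel k \<subseteq> {\<one>\<^bsub>M\<^esub>}"
proof
  fix m assume m: "m \<in> act_kernel k"
  have "m = \<one>\<^bsub>M\<^esub>"
    by (rule act_faithful) (use m act_kernelD in \<open>auto intro: cng_k\<close>)
  then show "m \<in> {\<one>\<^bsub>M\<^esub>}" by simp
qed

lemma act_kernel_mono: "i \<le> j \<Longrightarrow> act_kernel j \<subseteq> act_kernel i"
  using cng_mono by (auto simp: act_kernel_def)

lemma act_kernel_normal:
  assumes j: "j \<le> k" shows "act_kernel j \<lhd> M"
proof (rule M.normal_invI)
  show "subgroup (act_kernel j) M"
  proof (rule M.subgroupI)
    show "act_kernel j \<subseteq> carrier M" by (auto simp: act_kernel_def)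
    show "act_kernel j \<noteq> {}" by (auto simp: act_kernel_def intro!: exI[of _ "\<one>\<^bsub>M\<^esub>"])
    fix a assume a: "a \<in> act_kernel j"
    note aM = act_kernelD(1)[OF a]
    show "inv\<^bsub>M\<^esub> a \<in> act_kernel j"
      unfolding act_kernel_def
    proof (intro CollectI conjI ballI)
      fix x assume x: "x \<in> carrier G"
      have "cng j (act a (act (inv\<^bsub>M\<^esub> a) x)) (act (inv\<^bsub>M\<^esub> a) x)"
        using a aM x by (intro act_kernelD) auto
      then have "cng j x (act (inv\<^bsub>M\<^esub> a) x)" using aM x by simp
      then show "cng j (act (inv\<^bsub>M\<^esub> a) x) x" by (rule cng_sym) (use aM x in simp_all)
    qed (use aM in simp)
    fix b assume b: "b \<in> act_kernel j"
    note bM = act_kernelD(1)[OF b]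
    show "a \<otimes>\<^bsub>M\<^esub> b \<in> act_kernel j"
      unfolding act_kernel_def
    proof (intro CollectI conjI ballI)
      fix x assume x: "x \<in> carrier G"
      have "cng j (act a (act b x)) (act b x)" using a bM x by (intro act_kernelD) auto
      from cng_trans[OF this act_kernelD(2)[OF b x]]
      show "cng j (act (a \<otimes>\<^bsub>M\<^esub> b) x) x" using aM bM x by (simp add: act_mult)
    qed (use aM bM in simp)
  qed
  fix m a assume m: "m \<in> carrier M" and a: "a \<in> act_kernel j"
  note aM = act_kernelD(1)[OF a]
  show "m \<otimes>\<^bsub>M\<^esub> a \<otimes>\<^bsub>M\<^esub> inv\<^bsub>M\<^esub> m \<in> act_kernel j"
    unfolding act_kernel_def
  proof (intro CollectI conjI ballI)
    fix x assume x: "x \<in> carrier G"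
    have "cng j (act a (act (inv\<^bsub>M\<^esub> m) x)) (act (inv\<^bsub>M\<^esub> m) x)"
      using a m x by (intro act_kernelD) auto
    then have "cng j (act m (act a (act (inv\<^bsub>M\<^esub> m) x))) (act m (act (inv\<^bsub>M\<^esub> m) x))"
      using j m aM x by (intro act_cng) auto
    then show "cng j (act (m \<otimes>\<^bsub>M\<^esub> a \<otimes>\<^bsub>M\<^esub> inv\<^bsub>M\<^esub> m) x) x"
      using m aM x by (simp add: act_mult)
  qed (use m aM in simp)
qed

lemma act_cong_kernel:
  assumes j: "j \<le> k" and c: "act_cong j m m'" and m: "m \<in> carrier M" "m' \<in> carrier M"
  shows "m \<otimes>\<^bsub>M\<^esub> inv\<^bsub>M\<^esub> m' \<in> act_kernel j"
  unfolding act_kernel_def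
proof (intro CollectI conjI ballI)
  fix x assume x: "x \<in> carrier G"
  have "act (inv\<^bsub>M\<^esub> m') x \<in> carrier G" using m x by simp
  then have "cng j (act m (act (inv\<^bsub>M\<^esub> m') x)) (act m' (act (inv\<^bsub>M\<^esub> m') x))"
    using c unfolding act_cong_def by blast
  then show "cng j (act (m \<otimes>\<^bsub>M\<^esub> inv\<^bsub>M\<^esub> m') x) x" using m x by (simp add: act_mult)
qed (use m in simp)

text \<open>At a point \<open>x\<close>, \<open>a\<close> and \<open>b\<close> multiply on the right
  by some \<open>p\<close> and \<open>q\<close> in \<open>N j\<close>. By triangularity
  \<open>a b\<close> and \<open>b a\<close> multiply by \<open>p \<otimes> q\<close> and
  \<open>q \<otimes> p\<close> modulo \<open>N (Suc j)\<close>, and there \<open>N j\<close> is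
  abelian.\<close>

lemma act_kernel_Suc_mult:
  assumes j: "j < k" and a: "a \<in> act_kernel j" and b: "b \<in> act_kernel j"
  shows "a \<otimes>\<^bsub>M\<^esub> b \<otimes>\<^bsub>M\<^esub> inv\<^bsub>M\<^esub> (b \<otimes>\<^bsub>M\<^esub> a) \<in> act_kernel (Suc j)"
proof -
  note aM = act_kernelD(1)[OF a] and bM = act_kernelD(1)[OF b]
  have half: "cng (Suc j) (act a (act b x)) (x \<otimes> p \<otimes> q)"
    if a: "a \<in> carrier M" and b: "b \<in> carrier M" and x: "x \<in> carrier G"
      and p: "p \<in> N j" "act a x = x \<otimes> p" and q: "q \<in> N j" "act b x = x \<otimes> q" for a b x p q
    using act_mult_N[OF a j x q(1)] p q by simp
  have "act_cong (Suc j) (a \<otimes>\<^bsub>M\<^esub> b) (b \<otimes>\<^bsub>M\<^esub> a)"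
    unfolding act_cong_def
  proof
    fix x assume x: "x \<in> carrier G"
    have "cng j x (act a x)" by (rule cng_sym[OF act_kernelD(2)[OF a x]]) (use aM x in simp_all)
    then obtain p where p: "p \<in> N j" "act a x = x \<otimes> p"
      using cngE[of j x "act a x"] aM x by (metis act_closed)
    have "cng j x (act b x)" by (rule cng_sym[OF act_kernelD(2)[OF b x]]) (use bM x in simp_all)
    then obtain q where q: "q \<in> N j" "act b x = x \<otimes> q"
      using cngE[of j x "act b x"] bM x by (metis act_closed)
    have pq: "p \<in> carrier G" "q \<in> carrier G" using p q N_carrier by blast+
    have 1: "cng (Suc j) (act a (act b x)) (x \<otimes> p \<otimes> q)" by (rule half[OF aM bM x p q])
    have 2: "cng (Suc j) (act b (act a x)) (x \<otimes> q \<otimes> p)" by (rule half[OF bM aM x q p])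
    have 3: "cng (Suc j) (x \<otimes> p \<otimes> q) (x \<otimes> q \<otimes> p)"
      using N_comm[OF p(1) q(1)] x pq by (simp add: coset_cong_def G.inv_mult_group G.m_assoc)
    have "cng (Suc j) (act a (act b x)) (x \<otimes> q \<otimes> p)"
      by (rule cng_trans[OF 1 3]) (use x pq aM bM in simp_all)
    then have "cng (Suc j) (act a (act b x)) (act b (act a x))"
      by (rule cng_trans[OF _ cng_sym[OF 2]]) (use x pq aM bM in simp_all)
    then show "cng (Suc j) (act (a \<otimes>\<^bsub>M\<^esub> b) x) (act (b \<otimes>\<^bsub>M\<^esub> a) x)"
      using aM bM x by (simp add: act_mult)
  qed
  then show ?thesis using j aM bM by (intro act_cong_kernel) auto
qed

text \<open>The base points \<open>b x\<close> are chosen, one in each coset of \<open>N j\<close>, so that base points of cosets in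
  one \<open>T\<close>-orbit lie in one \<open>T\<close>-orbit of \<open>G\<close>. The complement consists of the elements of \<open>T\<close> that
  permute the base points modulo \<open>N (j+1)\<close>.\<close>

lemma complement_exists:
  assumes j: "j < k" and T: "subgroup T M" and oc: "orbit_closed (Suc j) T"
  obtains C where "subgroup C M" "C \<subseteq> T"
    "\<And>t. t \<in> T \<Longrightarrow> \<exists>a\<in>act_kernel j \<inter> T. \<exists>c\<in>C. t = a \<otimes>\<^bsub>M\<^esub> c"
    "C \<inter> act_kernel j \<subseteq> act_kernel (Suc j)"
proof -
  interpret T: subgroup T M by fact
  have TM [simp]: "t \<in> T \<Longrightarrow> t \<in> carrier M" for t by (rule T.mem_carrier)
  have jk: "j \<le> k" "Suc j \<le> k" using j by auto
  \<comment> \<open>\<open>orb x\<close> is the full preimage of a \<open>T\<close>-orbit on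
    \<open>G / N j\<close>. Choosing \<open>rep\<close> from the orbit alone, and \<open>b\<close>
    from the coset and \<open>rep\<close> alone, makes \<open>b\<close> constant on cosets; all base
    points over one orbit are \<open>T\<close>-translates of a single point.\<close>
  define orb where "orb x = {y \<in> carrier G. \<exists>t\<in>T. cng j (act t x) y}" for x
  define rep where "rep x = (SOME y. y \<in> orb x)" for x
  define b where "b x = (SOME z. z \<in> {z \<in> carrier G. cng j x z} \<and> (\<exists>t\<in>T. z = act t (rep x)))" for x
  have orbI: "x \<in> orb x" if "x \<in> carrier G" for x
    unfolding orb_def using that by (auto intro!: bexI[of _ "\<one>\<^bsub>M\<^esub>"])
  have orb_sub: "orb y \<subseteq> orb x" if x: "x \<in> carrier G" and y: "y \<in> orb x" for x y
  proof
    fix z assume z: "z \<in> orb y"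
    obtain t where t: "t \<in> T" "cng j (act t x) y" "y \<in> carrier G" using y by (auto simp: orb_def)
    obtain s where s: "s \<in> T" "cng j (act s y) z" "z \<in> carrier G" using z by (auto simp: orb_def)
    have "cng j (act s (act t x)) (act s y)" using t s x jk by (intro act_cng) auto
    then have "cng j (act s (act t x)) z" by (rule cng_trans[OF _ s(2)]) (use t s x in simp_all)
    then have "cng j (act (s \<otimes>\<^bsub>M\<^esub> t) x) z" using s t x by (simp add: act_mult)
    then show "z \<in> orb x" using s t by (auto simp: orb_def)
  qed
  have orb_sym: "x \<in> orb y" if x: "x \<in> carrier G" and y: "y \<in> orb x" for x y
  proof -
    obtain t where t: "t \<in> T" "cng j (act t x) y" "y \<in> carrier G" using y by (auto simp: orb_def)
    have "cng j (act (inv\<^bsub>M\<^esub> t) (act t x)) (act (inv\<^bsub>M\<^esub> t) y)" using t x jk by (intro act_cng) auto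
    then have "cng j x (act (inv\<^bsub>M\<^esub> t) y)" using t x by simp
    then have "cng j (act (inv\<^bsub>M\<^esub> t) y) x" by (rule cng_sym) (use t x in simp_all)
    then show ?thesis using t x unfolding orb_def by blast
  qed
  have orb_eq: "orb y = orb x" if x: "x \<in> carrier G" and y: "y \<in> orb x" for x y
    using orb_sub[OF x y] orb_sub[OF _ orb_sym[OF x y]] y by (auto simp: orb_def)
  have b: "b x \<in> carrier G" "cng j x (b x)" "\<exists>t\<in>T. b x = act t (rep x)" and rG: "rep x \<in> carrier G"
    if x: "x \<in> carrier G" for x
  proof -
    have r: "rep x \<in> orb x" unfolding rep_def by (rule someI[of _ x]) (rule orbI[OF x])
    then show rG: "rep x \<in> carrier G" by (simp add: orb_def)
    obtain t where t: "t \<in> T" "cng j (act t (rep x)) x" using orb_sym[OF x r] by (auto simp: orb_def)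
    have "act t (rep x) \<in> {z \<in> carrier G. cng j x z} \<and> (\<exists>t'\<in>T. act t (rep x) = act t' (rep x))"
      using t rG x cng_sym[OF t(2)] by auto
    from someI[of "\<lambda>z. z \<in> {z \<in> carrier G. cng j x z} \<and> (\<exists>t\<in>T. z = act t (rep x))", OF this]
    have "b x \<in> {z \<in> carrier G. cng j x z} \<and> (\<exists>t\<in>T. b x = act t (rep x))"
      unfolding b_def .
    then show "b x \<in> carrier G" "cng j x (b x)" "\<exists>t\<in>T. b x = act t (rep x)" by auto
  qed
  have b_cong: "b x = b y" if x: "x \<in> carrier G" and y: "y \<in> carrier G" and c: "cng j x y" for x y
  proof -
    have "y \<in> orb x" unfolding orb_def using x y c by (auto intro!: bexI[of _ "\<one>\<^bsub>M\<^esub>"])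
    then have "rep y = rep x" using orb_eq[OF x] by (simp add: rep_def)
    moreover have "{z \<in> carrier G. cng j x z} = {z \<in> carrier G. cng j y z}"
      using cng_trans[OF c _ x y] cng_trans[OF cng_sym[OF c x y] _ y x] by auto
    ultimately show ?thesis unfolding b_def by simp
  qed
  have b_orb: "\<exists>u\<in>T. act u (b y) = b x" if x: "x \<in> carrier G" and y: "y \<in> orb x" for x y
  proof -
    have yG: "y \<in> carrier G" using y by (simp add: orb_def)
    have r: "rep y = rep x" using orb_eq[OF x y] by (simp add: rep_def)
    obtain t where t: "t \<in> T" "b x = act t (rep x)" using b(3)[OF x] by blast
    obtain s where s: "s \<in> T" "b y = act s (rep x)" using b(3)[OF yG] r by auto
    have "act (t \<otimes>\<^bsub>M\<^esub> inv\<^bsub>M\<^esub> s) (b y) = b x" using t s rG[OF x] by (simp add: act_mult)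
    then show ?thesis using t s by blast
  qed
  define C where "C = {c \<in> T. \<forall>x\<in>carrier G. cng (Suc j) (act c (b x)) (b (act c x))}"
  have bb: "cng (Suc j) (b x) (b y)" if "x \<in> carrier G" "y \<in> carrier G" "cng j x y" for x y
    using b_cong[OF that] b(1)[OF that(2)] by simp
  have sC: "subgroup C M"
  proof (rule M.subgroupI)
    show "C \<subseteq> carrier M" by (auto simp: C_def)
    have "\<one>\<^bsub>M\<^esub> \<in> C" using b by (simp add: C_def)
    then show "C \<noteq> {}" by blast
    fix c assume c: "c \<in> C"
    then have cT: "c \<in> T" by (simp add: C_def)
    have cM: "c \<in> carrier M" using cT by simp
    have "cng (Suc j) (act (inv\<^bsub>M\<^esub> c) (b x)) (b (act (inv\<^bsub>M\<^esub> c) x))" if x: "x \<in> carrier G" for x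
    proof -
      let ?y = "act (inv\<^bsub>M\<^esub> c) x"
      have y: "?y \<in> carrier G" using cM x by simp
      have "cng (Suc j) (act c (b ?y)) (b (act c ?y))" using c y by (simp add: C_def)
      then have "cng (Suc j) (act c (b ?y)) (act c (act (inv\<^bsub>M\<^esub> c) (b x)))"
        using cM x b(1)[OF x] by simp
      then have "cng (Suc j) (b ?y) (act (inv\<^bsub>M\<^esub> c) (b x))"
        by (rule act_cng_cancel[OF cM jk(2)]) (use b(1)[OF y] b(1)[OF x] cM in simp_all)
      then show ?thesis by (rule cng_sym) (use b(1)[OF y] b(1)[OF x] cM in simp_all)
    qed
    then show "inv\<^bsub>M\<^esub> c \<in> C" using cT by (simp add: C_def)
    fix d assume d: "d \<in> C"
    then have dT: "d \<in> T" by (simp add: C_def)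
    have dM: "d \<in> carrier M" using dT by simp
    have "cng (Suc j) (act (c \<otimes>\<^bsub>M\<^esub> d) (b x)) (b (act (c \<otimes>\<^bsub>M\<^esub> d) x))" if x: "x \<in> carrier G" for x
    proof -
      have dx: "act d x \<in> carrier G" using dM x by simp
      have "cng (Suc j) (act d (b x)) (b (act d x))" using d x by (simp add: C_def)
      then have 1: "cng (Suc j) (act c (act d (b x))) (act c (b (act d x)))"
        by (rule act_cng[OF cM jk(2)]) (use b(1)[OF x] b(1)[OF dx] dM in simp_all)
      have 2: "cng (Suc j) (act c (b (act d x))) (b (act c (act d x)))"
        using c dx by (simp add: C_def)
      have "act c (act d x) \<in> carrier G" using dx cM by simp
      from cng_trans[OF 1 2 _ _ b(1)[OF this]] show ?thesis
        using cM dM x b(1)[OF x] b(1)[OF dx] by (simp add: act_mult)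
    qed
    then show "c \<otimes>\<^bsub>M\<^esub> d \<in> C" using cT dT by (simp add: C_def)
  qed
  \<comment> \<open>The kernel part \<open>a\<close> of \<open>t\<close> must send the base point
    \<open>b y\<close> to the image under \<open>t\<close> of the base point over
    \<open>inv t\<close> applied to \<open>y\<close>. On a single coset an element
    \<open>t u\<close> of \<open>T\<close> does this; patching and orbit closure merge these into
    one element of \<open>T\<close>.\<close>
  have dec: "\<exists>a\<in>act_kernel j \<inter> T. \<exists>c\<in>C. t = a \<otimes>\<^bsub>M\<^esub> c" if t: "t \<in> T" for t
  proof -
    have tM: "t \<in> carrier M" using t by simp
    \<comment> \<open>The condition involves \<open>y\<close> only through two base points, so the
      choice, and with it \<open>\<tau>\<close>, is constant on cosets of
      \<open>N j\<close>.\<close>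
    define u where "u y = (SOME u. u \<in> T \<and> act u (b y) = b (act (inv\<^bsub>M\<^esub> t) y))" for y
    have u: "u y \<in> T \<and> act (u y) (b y) = b (act (inv\<^bsub>M\<^esub> t) y)" if y: "y \<in> carrier G" for y
    proof -
      have ty: "act (inv\<^bsub>M\<^esub> t) y \<in> carrier G" using tM y by simp
      have "y \<in> orb (act (inv\<^bsub>M\<^esub> t) y)"
        unfolding orb_def using tM t y by (auto intro!: bexI[of _ t])
      from b_orb[OF ty this] have "\<exists>u. u \<in> T \<and> act u (b y) = b (act (inv\<^bsub>M\<^esub> t) y)" by blast
      then show ?thesis unfolding u_def by (rule someI_ex)
    qed
    define \<tau> where "\<tau> y = t \<otimes>\<^bsub>M\<^esub> u y" for y
    have \<tau>T: "\<tau> y \<in> T" "\<tau> y \<in> carrier M" if "y \<in> carrier G" for y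
      using u[OF that] t by (auto simp: \<tau>_def)
    have \<tau>b: "act (\<tau> y) (b y) = act t (b (act (inv\<^bsub>M\<^esub> t) y))" if y: "y \<in> carrier G" for y
      using u[OF y] t b(1)[OF y] by (simp add: \<tau>_def act_mult)
    have \<tau>c: "\<tau> x = \<tau> y" if x: "x \<in> carrier G" and y: "y \<in> carrier G" and c: "cng j x y" for x y
    proof -
      have "cng j (act (inv\<^bsub>M\<^esub> t) x) (act (inv\<^bsub>M\<^esub> t) y)" using x y c tM jk by (intro act_cng) auto
      then have "b (act (inv\<^bsub>M\<^esub> t) x) = b (act (inv\<^bsub>M\<^esub> t) y)" using x y tM by (intro b_cong) auto
      then show ?thesis using b_cong[OF x y c] by (simp add: \<tau>_def u_def)
    qed
    have \<tau>j: "cng j (act (\<tau> y) y) y" if y: "y \<in> carrier G" for y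
    proof -
      have ty: "act (inv\<^bsub>M\<^esub> t) y \<in> carrier G" using tM y by simp
      have 1: "cng j (act (\<tau> y) y) (act (\<tau> y) (b y))"
        by (rule act_cng[OF \<tau>T(2)[OF y] jk(1) b(2)[OF y] y b(1)[OF y]])
      have "cng j (act t (act (inv\<^bsub>M\<^esub> t) y)) (act t (b (act (inv\<^bsub>M\<^esub> t) y)))"
        by (rule act_cng[OF tM jk(1) b(2)[OF ty] ty b(1)[OF ty]])
      then have 2: "cng j y (act (\<tau> y) (b y))" using \<tau>b[OF y] tM y by simp
      show ?thesis
        by (rule cng_trans[OF 1 cng_sym[OF 2]]) (use y \<tau>T[OF y] b(1)[OF y] in simp_all)
    qed
    have "\<exists>r\<in>carrier M. \<forall>x\<in>carrier G. act r x = act (\<tau> x) x"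
    proof (rule patch[where \<tau>=\<tau> and j=j and m="\<one>\<^bsub>M\<^esub>", OF jk(1)])
      show "cng j (act (\<tau> x) x) (act \<one>\<^bsub>M\<^esub> x)" if "x \<in> carrier G" for x
        using \<tau>j[OF that] that by simp
    qed (use \<tau>T(2) \<tau>c M.one_closed in blast)+
    then obtain r where r: "r \<in> carrier M" "\<And>x. x \<in> carrier G \<Longrightarrow> act r x = act (\<tau> x) x"
      by blast
    have "\<exists>s\<in>T. cng (Suc j) (act r x) (act s x)" if x: "x \<in> carrier G" for x
      using r(2)[OF x] \<tau>T[OF x] x by (auto intro!: bexI[of _ "\<tau> x"])
    then obtain a where a: "a \<in> T" "act_cong (Suc j) r a"
      using oc r(1) unfolding orbit_closed_def by blast
    have aM: "a \<in> carrier M" using a by simp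
    have ra: "cng (Suc j) (act r x) (act a x)" if "x \<in> carrier G" for x
      using a(2) that by (simp add: act_cong_def)
    have aK: "cng j (act a x) x" if x: "x \<in> carrier G" for x
    proof -
      have "cng j (act r x) (act a x)" by (rule cng_mono[OF ra[OF x]]) simp
      then have "cng j (act a x) (act r x)" by (rule cng_sym) (use x aM r(1) in simp_all)
      then show ?thesis
        by (rule cng_trans) (use \<tau>j[OF x] r(2)[OF x] x aM \<tau>T(2)[OF x] in simp_all)
    qed
    let ?c = "inv\<^bsub>M\<^esub> a \<otimes>\<^bsub>M\<^esub> t"
    have cT: "?c \<in> T" using a t by blast
    \<comment> \<open>As \<open>a\<close> fixes the cosets of \<open>N j\<close>, the right side is
      \<open>b (act t x)\<close>, and \<open>a\<close> was built to send this point to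
      \<open>act t (b x)\<close> modulo \<open>N (Suc j)\<close>.\<close>
    have "cng (Suc j) (act ?c (b x)) (b (act ?c x))" if x: "x \<in> carrier G" for x
    proof -
      let ?y = "act t x"
      have y: "?y \<in> carrier G" using tM x by simp
      have by_: "b ?y \<in> carrier G" "cng j ?y (b ?y)" using b[OF y] by auto
      have bx: "b x \<in> carrier G" using b[OF x] by auto
      have cx: "act ?c x = act (inv\<^bsub>M\<^esub> a) ?y" using aM tM x by (simp add: act_mult)
      have "cng j (act a (act (inv\<^bsub>M\<^esub> a) ?y)) (act (inv\<^bsub>M\<^esub> a) ?y)"
        by (rule aK) (use aM y in simp)
      then have "b ?y = b (act ?c x)" unfolding cx using aM y by (intro b_cong) auto
      moreover have "\<tau> (b ?y) = \<tau> ?y" using \<tau>c[OF y by_] by simp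
      then have "act r (b ?y) = act t (b x)" using r(2)[OF by_(1)] \<tau>b[OF y] tM x by simp
      then have "cng (Suc j) (act t (b x)) (act a (b ?y))" using ra[OF by_(1)] by simp
      then have "cng (Suc j) (act a (act (inv\<^bsub>M\<^esub> a) (act t (b x)))) (act a (b ?y))"
        using aM tM bx by simp
      then have "cng (Suc j) (act (inv\<^bsub>M\<^esub> a) (act t (b x))) (b ?y)"
        by (rule act_cng_cancel[OF aM jk(2)]) (use aM tM bx by_ in simp_all)
      ultimately show ?thesis using aM tM bx by (simp add: act_mult)
    qed
    then have "?c \<in> C" using cT by (simp add: C_def)
    moreover have "t = a \<otimes>\<^bsub>M\<^esub> ?c" using aM tM by simp
    moreover have "a \<in> act_kernel j \<inter> T" using a aM aK by (simp add: act_kernel_def)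
    ultimately show ?thesis by blast
  qed
  \<comment> \<open>Such an element fixes all base points modulo \<open>N (Suc j)\<close>, and
    triangularity spreads this to every point \<open>b x \<otimes> n\<close> of the coset.\<close>
  have int: "C \<inter> act_kernel j \<subseteq> act_kernel (Suc j)"
  proof
    fix c assume c: "c \<in> C \<inter> act_kernel j"
    then have cM: "c \<in> carrier M" by (auto simp: C_def)
    have "cng (Suc j) (act c x) x" if x: "x \<in> carrier G" for x
    proof -
      note bx = b[OF x]
      obtain n where n: "n \<in> N j" "x = b x \<otimes> n" using cngE[OF cng_sym[OF bx(2) x bx(1)] bx(1) x] .
      have nG: "n \<in> carrier G" using N_carrier n by blast
      have cx: "act c x \<in> carrier G" "act c (b x) \<in> carrier G" using cM x bx by auto
      have 1: "cng (Suc j) (act c x) (act c (b x) \<otimes> n)"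
        using act_mult_N[OF cM j bx(1) n(1)] n(2) by simp
      have "cng j (act c x) x" using c x by (auto simp: act_kernel_def)
      then have "b (act c x) = b x" using cx x by (intro b_cong) auto
      then have "cng (Suc j) (act c (b x)) (b x)" using c x by (auto simp: C_def)
      then have "cng (Suc j) (act c (b x) \<otimes> n) (b x \<otimes> n)"
        by (rule cng_mult_right) (use cx bx nG in simp_all)
      then have 2: "cng (Suc j) (act c (b x) \<otimes> n) x" using n(2) by simp
      show ?thesis by (rule cng_trans[OF 1 2]) (use cx nG x in simp_all)
    qed
    then show "c \<in> act_kernel (Suc j)" using cM by (simp add: act_kernel_def)
  qed
  have "C \<subseteq> T" by (auto simp: C_def)
  then show ?thesis using that sC dec int by blast
qed

end

context triangular_action
begin

text \<open>An element of \<open>A\<close> is, modulo the action on \<open>G / N (j+1)\<close>, a product of elements each moving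
  the points of a single coset of \<open>N j\<close> only. It therefore suffices to compare characters on these,
  and there a patched element \<open>\<rho>\<close> acts by conjugation like some element of the stabilizer.\<close>

lemma orbit_closed_stabilizer:
  assumes j: "j < k" and T: "subgroup T M" and oc: "orbit_closed (Suc j) T"
    and \<nu>: "lin_hom (subgrp M (act_kernel j \<inter> T)) \<nu>"
    and \<nu>1: "\<And>a. a \<in> act_kernel (Suc j) \<Longrightarrow> a \<in> T \<Longrightarrow> \<nu> a = 1"
  shows "orbit_closed j (stabilizer (subgrp M T) (act_kernel j \<inter> T) \<nu>)"
proof -
  define A where "A = act_kernel j \<inter> T"
  define S where "S = stabilizer (subgrp M T) A \<nu>"
  interpret T: subgroup T M by fact
  have TM [simp]: "t \<in> T \<Longrightarrow> t \<in> carrier M" for t by (rule T.mem_carrier)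
  have jk: "j \<le> k" "Suc j \<le> k" using j by auto
  have nA: "A \<lhd> subgrp M T"
    unfolding A_def by (rule M.normal_Int_subgroup[OF T act_kernel_normal[OF jk(1)]])
  have AT: "a \<in> T" if "a \<in> A" for a using that by (simp add: A_def)
  have sA: "subgroup A M" unfolding A_def
    using M.subgroups_Inter_pair[OF normal_imp_subgroup[OF act_kernel_normal[OF jk(1)]] T] .
  interpret A: subgroup A M by (rule sA)
  have \<nu>m: "\<nu> (a \<otimes>\<^bsub>M\<^esub> b) = \<nu> a * \<nu> b" if "a \<in> A" "b \<in> A" for a b
    using \<nu> that by (simp add: lin_hom_def A_def)
  have Aj: "cng j (act a x) x" if "a \<in> A" "x \<in> carrier G" for a x
    using that act_kernelD(2) by (simp add: A_def)
  have S_iff: "s \<in> S \<longleftrightarrow> s \<in> T \<and> (\<forall>a\<in>A. \<nu> (inv\<^bsub>M\<^esub> s \<otimes>\<^bsub>M\<^esub> a \<otimes>\<^bsub>M\<^esub> s) = \<nu> a)" for s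
    unfolding S_def stabilizer_def using M.inv_subgrp[OF T] by auto
  have conjA: "inv\<^bsub>M\<^esub> t \<otimes>\<^bsub>M\<^esub> a \<otimes>\<^bsub>M\<^esub> t \<in> A" if "t \<in> T" "a \<in> A" for t a
    using normal.inv_op_closed1[OF nA, of t a] that M.inv_subgrp[OF T] by simp
  have \<nu>cong: "\<nu> a = \<nu> b" if ab: "a \<in> A" "b \<in> A" and c: "act_cong (Suc j) a b" for a b
  proof -
    have "a \<otimes>\<^bsub>M\<^esub> inv\<^bsub>M\<^esub> b \<in> act_kernel (Suc j)"
      using act_cong_kernel[OF jk(2) c] ab AT by simp
    then have "\<nu> (a \<otimes>\<^bsub>M\<^esub> inv\<^bsub>M\<^esub> b) = 1" using ab AT by (intro \<nu>1) blast+
    moreover have "\<nu> ((a \<otimes>\<^bsub>M\<^esub> inv\<^bsub>M\<^esub> b) \<otimes>\<^bsub>M\<^esub> b) = \<nu> (a \<otimes>\<^bsub>M\<^esub> inv\<^bsub>M\<^esub> b) * \<nu> b"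
      using ab by (intro \<nu>m) blast+
    moreover have "(a \<otimes>\<^bsub>M\<^esub> inv\<^bsub>M\<^esub> b) \<otimes>\<^bsub>M\<^esub> b = a"
      using ab AT by (simp add: M.m_assoc)
    ultimately show ?thesis by simp
  qed
  have "\<exists>s\<in>S. act_cong j m s"
    if m: "m \<in> carrier M" and mS: "\<forall>x\<in>carrier G. \<exists>t\<in>S. cng j (act m x) (act t x)" for m
  proof -
    \<comment> \<open>The condition speaks about the whole coset of \<open>x\<close>, so the choice
      \<open>\<tau>\<close> is constant on cosets. Its values stabilize \<open>\<nu>\<close>, but
      the glued element is at first only known to lie in \<open>M\<close>.\<close>
    define P where "P x t \<longleftrightarrow> t \<in> S \<and> (\<forall>y\<in>{y \<in> carrier G. cng j x y}. cng j (act m y) (act t y))" for x t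
    define \<tau> where "\<tau> x = (SOME t. P x t)" for x
    have P: "P x (\<tau> x)" if x: "x \<in> carrier G" for x
    proof -
      obtain t where t: "t \<in> S" "cng j (act m x) (act t x)" using mS x by blast
      have tM: "t \<in> carrier M" using t S_iff by simp
      have "cng j (act m y) (act t y)" if y: "y \<in> carrier G" "cng j x y" for y
      proof -
        have 1: "cng j (act m x) (act m y)" by (rule act_cng[OF m jk(1) y(2) x y(1)])
        have 2: "cng j (act t x) (act t y)" by (rule act_cng[OF tM jk(1) y(2) x y(1)])
        have "cng j (act m y) (act m x)" by (rule cng_sym[OF 1]) (use m x y in simp_all)
        then have "cng j (act m y) (act t x)" by (rule cng_trans[OF _ t(2)]) (use m x y tM in simp_all)
        then show ?thesis by (rule cng_trans[OF _ 2]) (use m x y tM in simp_all)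
      qed
      then have "P x t" using t by (simp add: P_def)
      then show ?thesis unfolding \<tau>_def by (rule someI)
    qed
    have \<tau>S: "\<tau> x \<in> S" "\<tau> x \<in> T" "\<tau> x \<in> carrier M" if "x \<in> carrier G" for x
      using P[OF that] S_iff by (auto simp: P_def)
    have \<tau>m: "cng j (act m y) (act (\<tau> x) y)" if "x \<in> carrier G" "y \<in> carrier G" "cng j x y" for x y
      using P[OF that(1)] that by (simp add: P_def)
    have \<tau>c: "\<tau> x = \<tau> y" if x: "x \<in> carrier G" and y: "y \<in> carrier G" and c: "cng j x y" for x y
    proof -
      have "{z \<in> carrier G. cng j x z} = {z \<in> carrier G. cng j y z}"
        using cng_trans[OF c _ x y] cng_trans[OF cng_sym[OF c x y] _ y x] by auto
      then show ?thesis unfolding \<tau>_def P_def by simp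
    qed
    have "\<exists>r\<in>carrier M. \<forall>x\<in>carrier G. act r x = act (\<tau> x) x"
    proof (rule patch[where \<tau>=\<tau> and j=j and m=m, OF jk(1)])
      show "cng j (act (\<tau> x) x) (act m x)" if x: "x \<in> carrier G" for x
        by (rule cng_sym[OF \<tau>m[OF x x cng_refl[OF x]]]) (use x m \<tau>S[OF x] in simp_all)
    qed (use \<tau>S(3) \<tau>c m in blast)+
    then obtain r where r: "r \<in> carrier M" "\<And>x. x \<in> carrier G \<Longrightarrow> act r x = act (\<tau> x) x"
      by blast
    have "\<exists>t\<in>T. cng (Suc j) (act r x) (act t x)" if x: "x \<in> carrier G" for x
      using r(2)[OF x] \<tau>S[OF x] x by (intro bexI[of _ "\<tau> x"]) simp_all
    then obtain \<rho> where \<rho>: "\<rho> \<in> T" "act_cong (Suc j) r \<rho>"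
      using oc r(1) unfolding orbit_closed_def by blast
    have \<rho>M: "\<rho> \<in> carrier M" using \<rho> by simp
    have r\<rho>: "cng (Suc j) (act (\<tau> x) x) (act \<rho> x)" if "x \<in> carrier G" for x
    proof -
      have "cng (Suc j) (act r x) (act \<rho> x)" using \<rho>(2) that unfolding act_cong_def by blast
      then show ?thesis by (simp only: r(2)[OF that])
    qed
    have m\<rho>: "cng j (act m x) (act \<rho> x)" if x: "x \<in> carrier G" for x
      by (rule cng_trans[OF \<tau>m[OF x x cng_refl[OF x]] cng_mono[OF r\<rho>[OF x]]])
         (use x m \<rho>M \<tau>S[OF x] in simp_all)
    have local: "\<nu> (inv\<^bsub>M\<^esub> \<rho> \<otimes>\<^bsub>M\<^esub> a \<otimes>\<^bsub>M\<^esub> \<rho>) = \<nu> a"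
      if a: "a \<in> A" and x0: "x0 \<in> carrier G"
        and supp: "\<And>x. x \<in> carrier G \<Longrightarrow> \<not> cng j x0 x \<Longrightarrow> cng (Suc j) (act a x) x" for a x0
    proof -
      have aM: "a \<in> carrier M" using a AT by simp
      \<comment> \<open>Conjugating \<open>a\<close> by \<open>\<rho>\<close> pulls it back along
        \<open>\<rho>\<close>; the piece of \<open>\<rho>\<close> that matters is the one over the
        preimage of the coset of \<open>x0\<close>.\<close>
      define x' where "x' = act (inv\<^bsub>M\<^esub> \<rho>) x0"
      have x': "x' \<in> carrier G" "act \<rho> x' = x0" using \<rho>M x0 by (simp_all add: x'_def)
      define \<tau>0 where "\<tau>0 = \<tau> x'"
      have \<tau>0: "\<tau>0 \<in> S" "\<tau>0 \<in> T" "\<tau>0 \<in> carrier M" using \<tau>S[OF x'(1)] by (auto simp: \<tau>0_def)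
      have agree: "cng (Suc j) (act \<tau>0 z) (act \<rho> z)" if z: "z \<in> carrier G" "cng j x' z" for z
        using r\<rho>[OF z(1)] \<tau>c[OF x'(1) z] by (simp add: \<tau>0_def)
      have \<tau>0x': "cng j (act \<tau>0 x') x0"
        using cng_mono[OF agree[OF x'(1) cng_refl[OF x'(1)]], of j] x' by simp
      have to_x0: "cng j x0 (act \<tau>0 z)" if z: "z \<in> carrier G" "cng j x' z" for z
      proof -
        have "cng j (act \<tau>0 x') (act \<tau>0 z)" by (rule act_cng[OF \<tau>0(3) jk(1) z(2) x'(1) z(1)])
        with cng_sym[OF \<tau>0x'] show ?thesis
          using z x0 x' \<tau>0 by (meson act_closed cng_trans)
      qed
      have from_x0: "cng j x' z" if z: "z \<in> carrier G" "cng j x0 (act \<tau>0 z)" for z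
      proof -
        have "cng j (act \<tau>0 x') (act \<tau>0 z)"
          by (rule cng_trans[OF \<tau>0x' z(2)]) (use z x0 x' \<tau>0 in simp_all)
        then show ?thesis by (rule act_cng_cancel[OF \<tau>0(3) jk(1) _ x'(1) z(1)])
      qed
      have from_x0': "cng j x' z" if z: "z \<in> carrier G" "cng j x0 (act \<rho> z)" for z
        using act_cng_cancel[OF \<rho>M jk(1) _ x'(1) z(1)] z(2) x'(2) by simp
      have "act_cong (Suc j) (inv\<^bsub>M\<^esub> \<rho> \<otimes>\<^bsub>M\<^esub> a \<otimes>\<^bsub>M\<^esub> \<rho>) (inv\<^bsub>M\<^esub> \<tau>0 \<otimes>\<^bsub>M\<^esub> a \<otimes>\<^bsub>M\<^esub> \<tau>0)"
        unfolding act_cong_def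
      proof
        fix z assume z: "z \<in> carrier G"
        let ?u = "act (inv\<^bsub>M\<^esub> \<tau>0) (act a (act \<tau>0 z))"
        let ?v = "act (inv\<^bsub>M\<^esub> \<rho>) (act a (act \<rho> z))"
        have uv: "?u \<in> carrier G" "?v \<in> carrier G" using z aM \<tau>0 \<rho>M by simp_all
        have "cng (Suc j) ?v ?u"
        proof (cases "cng j x' z")
          case True
          let ?w = "act a (act \<tau>0 z)"
          have w: "?w \<in> carrier G" using z aM \<tau>0 by simp
          have "cng j (act \<tau>0 z) ?w" by (rule cng_sym[OF Aj[OF a]]) (use z \<tau>0 aM in simp_all)
          then have "cng j x0 ?w" by (rule cng_trans[OF to_x0[OF z True]]) (use z \<tau>0 x0 w in simp_all)
          then have "cng j x' ?u" using w \<tau>0 uv by (intro from_x0) simp_all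
          then have "cng (Suc j) (act \<tau>0 ?u) (act \<rho> ?u)" by (rule agree[OF uv(1)])
          then have 1: "cng (Suc j) ?w (act \<rho> ?u)" using \<tau>0 w by simp
          have "cng (Suc j) (act \<rho> z) (act \<tau>0 z)"
            by (rule cng_sym[OF agree[OF z True]]) (use z \<tau>0 \<rho>M in simp_all)
          then have "cng (Suc j) (act a (act \<rho> z)) ?w"
            by (rule act_cng[OF aM jk(2)]) (use z \<tau>0 \<rho>M in simp_all)
          then have "cng (Suc j) (act a (act \<rho> z)) (act \<rho> ?u)"
            by (rule cng_trans[OF _ 1]) (use z w aM uv \<rho>M in simp_all)
          then have "cng (Suc j) (act \<rho> ?v) (act \<rho> ?u)" using \<rho>M aM z by simp
          then show ?thesis by (rule act_cng_cancel[OF \<rho>M jk(2) _ uv(2,1)])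
        next
          case False
          have fix_pt: "cng (Suc j) (act (inv\<^bsub>M\<^esub> \<sigma>) (act a (act \<sigma> z))) z"
            if \<sigma>: "\<sigma> \<in> carrier M" and n: "\<not> cng j x0 (act \<sigma> z)" for \<sigma>
          proof -
            have "cng (Suc j) (act a (act \<sigma> z)) (act \<sigma> z)"
              by (rule supp[OF _ n]) (use \<sigma> z in simp)
            then have "cng (Suc j) (act \<sigma> (act (inv\<^bsub>M\<^esub> \<sigma>) (act a (act \<sigma> z)))) (act \<sigma> z)"
              using \<sigma> z aM by simp
            then show ?thesis by (rule act_cng_cancel[OF \<sigma> jk(2)]) (use \<sigma> z aM in simp_all)
          qed
          have "cng (Suc j) ?v z" using from_x0'[OF z] False by (intro fix_pt[OF \<rho>M]) blast
          moreover have "cng (Suc j) ?u z" using from_x0[OF z] False by (intro fix_pt[OF \<tau>0(3)]) blast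
          ultimately show ?thesis
            using cng_trans[OF _ cng_sym[of "Suc j" ?u z] uv(2) z uv(1)] uv z by blast
        qed
        then show "cng (Suc j) (act (inv\<^bsub>M\<^esub> \<rho> \<otimes>\<^bsub>M\<^esub> a \<otimes>\<^bsub>M\<^esub> \<rho>) z) (act (inv\<^bsub>M\<^esub> \<tau>0 \<otimes>\<^bsub>M\<^esub> a \<otimes>\<^bsub>M\<^esub> \<tau>0) z)"
          using z aM \<tau>0 \<rho>M by (simp add: act_mult)
      qed
      then have "\<nu> (inv\<^bsub>M\<^esub> \<rho> \<otimes>\<^bsub>M\<^esub> a \<otimes>\<^bsub>M\<^esub> \<rho>) = \<nu> (inv\<^bsub>M\<^esub> \<tau>0 \<otimes>\<^bsub>M\<^esub> a \<otimes>\<^bsub>M\<^esub> \<tau>0)"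
        by (rule \<nu>cong[OF conjA[OF \<rho>(1) a] conjA[OF \<tau>0(2) a]])
      also have "\<dots> = \<nu> a" using \<tau>0(1) a S_iff by blast
      finally show ?thesis .
    qed
    \<comment> \<open>Induction on the number of points moved modulo \<open>N (Suc j)\<close>: the
      factor \<open>a1\<close> carries the action of \<open>a\<close> on one coset of
      \<open>N j\<close>, and the remaining factor \<open>a2\<close> moves fewer points.\<close>
    have "\<nu> (inv\<^bsub>M\<^esub> \<rho> \<otimes>\<^bsub>M\<^esub> a \<otimes>\<^bsub>M\<^esub> \<rho>) = \<nu> a" if "a \<in> A" for a
      using that
    proof (induction "card {x \<in> carrier G. \<not> cng (Suc j) (act a x) x}" arbitrary: a rule: less_induct)
      case less
      note a = less.prems
      have aM: "a \<in> carrier M" and aT: "a \<in> T" using a AT by auto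
      show ?case
      proof (cases "\<exists>x0\<in>carrier G. \<not> cng (Suc j) (act a x0) x0")
        case False
        obtain x0 where x0: "x0 \<in> carrier G" using G.one_closed by blast
        show ?thesis by (rule local[OF a x0]) (use False in blast)
      next
        case True
        then obtain x0 where x0: "x0 \<in> carrier G" "\<not> cng (Suc j) (act a x0) x0" by blast
        \<comment> \<open>\<open>a\<close> on the coset of \<open>x0\<close> and the identity
          elsewhere. The glued map stays in the \<open>T\<close>-orbits, so orbit closure replaces
          it by an element of \<open>T\<close>.\<close>
        define \<sigma> where "\<sigma> y = (if cng j x0 y then a else \<one>\<^bsub>M\<^esub>)" for y
        have \<sigma>: "\<sigma> y \<in> T" "\<sigma> y \<in> carrier M" for y using aT aM by (auto simp: \<sigma>_def)
        have "\<exists>r\<in>carrier M. \<forall>x\<in>carrier G. act r x = act (\<sigma> x) x"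
        proof (rule patch[where \<tau>=\<sigma> and j=j and m="\<one>\<^bsub>M\<^esub>", OF jk(1)])
          show "\<sigma> x = \<sigma> y" if x: "x \<in> carrier G" and y: "y \<in> carrier G" and c: "cng j x y" for x y
            using cng_trans[OF _ c x0(1) x y] cng_trans[OF _ cng_sym[OF c x y] x0(1) y x]
            by (auto simp: \<sigma>_def)
          show "cng j (act (\<sigma> x) x) (act \<one>\<^bsub>M\<^esub> x)" if "x \<in> carrier G" for x
            using Aj[OF a that] that by (simp add: \<sigma>_def)
        qed (use \<sigma> in simp_all)
        then obtain s where s: "s \<in> carrier M" "\<And>x. x \<in> carrier G \<Longrightarrow> act s x = act (\<sigma> x) x"
          by blast
        have "\<exists>t\<in>T. cng (Suc j) (act s x) (act t x)" if x: "x \<in> carrier G" for x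
          using s(2)[OF x] \<sigma> x by (intro bexI[of _ "\<sigma> x"]) simp_all
        then obtain a1 where a1: "a1 \<in> T" "act_cong (Suc j) s a1"
          using oc s(1) unfolding orbit_closed_def by blast
        have a1M: "a1 \<in> carrier M" using a1 by simp
        have sa1: "cng (Suc j) (act a1 x) (act (\<sigma> x) x)" if x: "x \<in> carrier G" for x
        proof -
          have "cng (Suc j) (act s x) (act a1 x)" using a1(2) x unfolding act_cong_def by blast
          then have "cng (Suc j) (act (\<sigma> x) x) (act a1 x)" by (simp only: s(2)[OF x])
          then show ?thesis by (rule cng_sym) (use x \<sigma> a1M in simp_all)
        qed
        have in1: "cng (Suc j) (act a1 x) (act a x)" if "x \<in> carrier G" "cng j x0 x" for x
          using sa1[OF that(1)] that by (simp add: \<sigma>_def)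
        have out1: "cng (Suc j) (act a1 x) x" if "x \<in> carrier G" "\<not> cng j x0 x" for x
          using sa1[OF that(1)] that by (simp add: \<sigma>_def)
        have "cng j (act a1 x) x" if x: "x \<in> carrier G" for x
        proof (cases "cng j x0 x")
          case True
          show ?thesis
            by (rule cng_trans[OF cng_mono[OF in1[OF x True]] Aj[OF a x]]) (use x a1M aM in simp_all)
        next
          case False
          show ?thesis by (rule cng_mono[OF out1[OF x False]]) simp
        qed
        then have a1A: "a1 \<in> A" unfolding A_def act_kernel_def using a1(1) a1M by blast
        define a2 where "a2 = inv\<^bsub>M\<^esub> a1 \<otimes>\<^bsub>M\<^esub> a"
        have a2A: "a2 \<in> A" using a a1A by (simp add: a2_def)
        have a2M: "a2 \<in> carrier M" using a2A AT by simp
        have act2: "act a1 (act a2 x) = act a x" if "x \<in> carrier G" for x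
          using that a1M aM by (simp add: a2_def act_mult)
        have in2: "cng (Suc j) (act a2 x) x" if x: "x \<in> carrier G" "cng j x0 x" for x
        proof -
          have "cng (Suc j) (act a1 (act a2 x)) (act a1 x)"
            unfolding act2[OF x(1)] by (rule cng_sym[OF in1[OF x]]) (use x a1M aM in simp_all)
          then show ?thesis by (rule act_cng_cancel[OF a1M jk(2)]) (use x a2M in simp_all)
        qed
        have out2: "cng (Suc j) (act a2 x) (act a x)" if x: "x \<in> carrier G" "\<not> cng j x0 x" for x
        proof -
          have "\<not> cng j x0 (act a x)"
            using cng_trans[OF _ Aj[OF a x(1)] x0(1) _ x(1)] x aM by auto
          then have "cng (Suc j) (act a1 (act a x)) (act a x)" using x aM by (intro out1) simp_all
          then have "cng (Suc j) (act a x) (act a1 (act a x))"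
            by (rule cng_sym) (use x aM a1M in simp_all)
          then have "cng (Suc j) (act a1 (act a2 x)) (act a1 (act a x))" using act2[OF x(1)] by simp
          then show ?thesis by (rule act_cng_cancel[OF a1M jk(2)]) (use x a2M aM in simp_all)
        qed
        let ?s = "\<lambda>a. {x \<in> carrier G. \<not> cng (Suc j) (act a x) x}"
        have "?s a2 \<subset> ?s a"
        proof
          show "?s a2 \<subseteq> ?s a"
          proof
            fix x assume x: "x \<in> ?s a2"
            then have xG: "x \<in> carrier G" and n: "\<not> cng j x0 x" using in2 by auto
            have "cng (Suc j) (act a2 x) x" if "cng (Suc j) (act a x) x"
              by (rule cng_trans[OF out2[OF xG n] that]) (use xG aM a2M in simp_all)
            then show "x \<in> ?s a" using x by auto
          qed
          show "?s a2 \<noteq> ?s a" using x0 in2[OF x0(1)] by auto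
        qed
        then have lt: "card (?s a2) < card (?s a)" by (rule psubset_card_mono[rotated]) simp
        have 2: "\<nu> (inv\<^bsub>M\<^esub> \<rho> \<otimes>\<^bsub>M\<^esub> a2 \<otimes>\<^bsub>M\<^esub> \<rho>) = \<nu> a2" by (rule less.hyps[OF lt a2A])
        have 1: "\<nu> (inv\<^bsub>M\<^esub> \<rho> \<otimes>\<^bsub>M\<^esub> a1 \<otimes>\<^bsub>M\<^esub> \<rho>) = \<nu> a1"
          by (rule local[OF a1A x0(1) out1])
        have e: "inv\<^bsub>M\<^esub> \<rho> \<otimes>\<^bsub>M\<^esub> a \<otimes>\<^bsub>M\<^esub> \<rho>
          = (inv\<^bsub>M\<^esub> \<rho> \<otimes>\<^bsub>M\<^esub> a1 \<otimes>\<^bsub>M\<^esub> \<rho>) \<otimes>\<^bsub>M\<^esub> (inv\<^bsub>M\<^esub> \<rho> \<otimes>\<^bsub>M\<^esub> a2 \<otimes>\<^bsub>M\<^esub> \<rho>)"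
          and e': "a = a1 \<otimes>\<^bsub>M\<^esub> a2"
          using aM a1M \<rho>M by (simp_all add: a2_def M.m_assoc)
        show ?thesis
          unfolding e \<nu>m[OF conjA[OF \<rho>(1) a1A] conjA[OF \<rho>(1) a2A]] 1 2
          using \<nu>m[OF a1A a2A] e' by simp
      qed
    qed
    then have "\<rho> \<in> S" using \<rho>(1) S_iff by blast
    then show ?thesis using m\<rho> unfolding act_cong_def by blast
  qed
  then show ?thesis unfolding orbit_closed_def S_def A_def by blast
qed

text \<open>The clauses about \<open>act_kernel j\<close> let the induction close: for the next
  level they put \<open>A\<close> inside \<open>H\<close> with \<open>\<mu>\<close> trivial on it,
  so multiplying by the extension of \<open>\<nu>\<close> produces a character that restricts to
  \<open>\<nu>\<close>, as \<open>clifford_chain.step\<close> demands.\<close>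

theorem triangular_clifford_chain:
  assumes "j \<le> k" "subgroup T M" "orbit_closed j T" "spherical (subgrp M T) \<chi>"
    "\<And>a t. a \<in> act_kernel j \<Longrightarrow> a \<in> T \<Longrightarrow> t \<in> T \<Longrightarrow> \<chi> (a \<otimes>\<^bsub>M\<^esub> t) = \<chi> t"
  shows "\<exists>H \<mu>. clifford_chain M T H \<mu> \<and> act_kernel j \<inter> T \<subseteq> H \<and>
    (\<forall>a\<in>act_kernel j \<inter> T. \<mu> a = 1) \<and> (\<forall>t\<in>T. \<chi> t = induced (subgrp M T) H \<mu> t)"
  using assms
proof (induction j arbitrary: T \<chi>)
  case 0
  note T = 0(2) and \<chi> = 0(4)
  interpret T: subgroup T M by fact
  interpret TM: fin_group "subgrp M T" by (rule M.subgroup_fin_group) fact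
  have const: "\<chi> t = \<chi> \<one>\<^bsub>M\<^esub>" if "t \<in> T" for t
    using 0(5)[of t "\<one>\<^bsub>M\<^esub>"] that T.mem_carrier[OF that] by (simp add: act_kernel_0)
  have "(\<Sum>g\<in>T. \<chi> g * \<chi> (inv\<^bsub>subgrp M T\<^esub> g)) = of_nat (card T)"
    using \<chi> by (simp add: spherical_def)
  moreover have "\<chi> g * \<chi> (inv\<^bsub>subgrp M T\<^esub> g) = \<chi> \<one>\<^bsub>M\<^esub> * \<chi> \<one>\<^bsub>M\<^esub>" if "g \<in> T" for g
    using const[OF that] const[of "inv\<^bsub>subgrp M T\<^esub> g"] TM.inv_closed[of g] that by simp
  ultimately have "of_nat (card T) * (\<chi> \<one>\<^bsub>M\<^esub> * \<chi> \<one>\<^bsub>M\<^esub>) = of_nat (card T)" by simp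
  moreover have "of_nat (card T) \<noteq> (0::complex)"
    using M.finite_subgroup[OF T] T.one_closed by (metis card_0_eq empty_iff of_nat_eq_0_iff)
  ultimately have "\<chi> \<one>\<^bsub>M\<^esub> * \<chi> \<one>\<^bsub>M\<^esub> = 1" by simp
  \<comment> \<open>At level 0 the function is constant; the norm leaves only the values 1 and -1,
    and positivity of the degree decides.\<close>
  then have "\<chi> \<one>\<^bsub>M\<^esub> = 1 \<or> \<chi> \<one>\<^bsub>M\<^esub> = -1" by (simp add: square_eq_1_iff)
  moreover have "Re (\<chi> \<one>\<^bsub>M\<^esub>) > 0" using \<chi> by (simp add: spherical_def)
  ultimately have one: "\<chi> \<one>\<^bsub>M\<^esub> = 1" by auto
  have l: "lin_hom (subgrp M T) (\<lambda>_. 1)" by (simp add: lin_hom_def)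
  have "\<chi> t = induced (subgrp M T) T (\<lambda>_. 1) t" if "t \<in> T" for t
    using TM.induced_self[OF l, of t] const[OF that] one that by simp
  then show ?case
    using clifford_chain.base[OF T l] by (intro exI[of _ T] exI[of _ "\<lambda>_. 1"]) auto
next
  case (Suc j)
  note T = Suc.prems(2) and oc = Suc.prems(3) and \<chi> = Suc.prems(4)
  have j: "j < k" "j \<le> k" using Suc.prems by auto
  interpret T: subgroup T M by (rule T)
  interpret TM: fin_group "subgrp M T" by (rule M.subgroup_fin_group) (rule T)
  note invT = M.inv_subgrp[OF T]
  define A where "A = act_kernel j \<inter> T"
  define L where "L = act_kernel (Suc j) \<inter> T"
  have nA: "A \<lhd> subgrp M T"
    unfolding A_def by (rule M.normal_Int_subgroup[OF T act_kernel_normal[OF j(2)]])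
  have nL: "L \<lhd> subgrp M T"
    unfolding L_def by (rule M.normal_Int_subgroup[OF T act_kernel_normal[OF Suc.prems(1)]])
  interpret A: normal A "subgrp M T" by (rule nA)
  have LA: "L \<subseteq> A" using act_kernel_mono[of j "Suc j"] by (auto simp: L_def A_def)
  have AT: "A \<subseteq> T" by (auto simp: A_def)
  have comm: "a \<otimes>\<^bsub>subgrp M T\<^esub> b \<otimes>\<^bsub>subgrp M T\<^esub> inv\<^bsub>subgrp M T\<^esub> (b \<otimes>\<^bsub>subgrp M T\<^esub> a) \<in> L"
    if "a \<in> A" "b \<in> A" for a b
  proof -
    have ab: "a \<in> T" "b \<in> T" "a \<in> act_kernel j" "b \<in> act_kernel j" using that by (auto simp: A_def)
    have "inv\<^bsub>subgrp M T\<^esub> (b \<otimes>\<^bsub>M\<^esub> a) = inv\<^bsub>M\<^esub> (b \<otimes>\<^bsub>M\<^esub> a)" by (rule invT) (use ab in blast)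
    moreover have "a \<otimes>\<^bsub>M\<^esub> b \<otimes>\<^bsub>M\<^esub> inv\<^bsub>M\<^esub> (b \<otimes>\<^bsub>M\<^esub> a) \<in> T" using ab by blast
    ultimately show ?thesis using act_kernel_Suc_mult[OF j(1) ab(3,4)] by (simp add: L_def)
  qed
  have sA: "subgroup A (subgrp M T)" and sL: "subgroup L (subgrp M T)"
    using normal_imp_subgroup[OF nA] normal_imp_subgroup[OF nL] by blast+
  have \<chi>L: "\<chi> (a \<otimes>\<^bsub>subgrp M T\<^esub> t) = \<chi> t" if "a \<in> L" "t \<in> carrier (subgrp M T)" for a t
    using Suc.prems(5)[of a t] that by (simp add: L_def)
  have \<chi>0: "\<one>\<^bsub>subgrp M T\<^esub> \<in> carrier (subgrp M T)" "\<chi> \<one>\<^bsub>subgrp M T\<^esub> \<noteq> 0"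
    using spherical_one_neq_0[OF \<chi>] by simp_all
  have "\<exists>\<nu>. lin_hom (subgrp (subgrp M T) A) \<nu> \<and> (\<forall>a\<in>L. \<nu> a = 1) \<and>
      (\<exists>t\<in>carrier (subgrp M T). eigen_avg (subgrp M T) A \<nu> \<chi> t \<noteq> 0)"
    using TM.eigen_avg_exists[where A=A and K=L and \<chi>=\<chi>, OF sA sL LA comm \<chi>L \<chi>0] .
  then obtain \<nu> t0 where \<nu>: "lin_hom (subgrp M A) \<nu>" and \<nu>L: "\<And>a. a \<in> L \<Longrightarrow> \<nu> a = 1"
    and t0: "t0 \<in> carrier (subgrp M T)" "eigen_avg (subgrp M T) A \<nu> \<chi> t0 \<noteq> 0" by auto
  have \<nu>': "lin_hom (subgrp (subgrp M T) A) \<nu>" using \<nu> by simp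
  define F where "F = eigen_avg (subgrp M T) A \<nu> \<chi>"
  define S where "S = stabilizer (subgrp M T) A \<nu>"
  note cl = TM.eigen_avg_clifford[OF nA \<nu>' \<chi> F_def S_def t0(1) t0(2)[folded F_def]]
  have sphF: "spherical (subgrp M S) F" using cl(1) by simp
  have F_left: "F (a \<otimes>\<^bsub>M\<^esub> t) = \<nu> a * F t" if "a \<in> A" "t \<in> T" for a t
    using TM.eigen_avg_left[OF nA \<nu>' \<chi> F_def S_def that(1)] that by simp
  have sS': "subgroup S (subgrp M T)" unfolding S_def by (rule TM.subgroup_stabilizer[OF nA])
  have sS: "subgroup S M" using M.incl_subgroup[OF T sS'] .
  have ST: "S \<subseteq> T" using subgroup.subset[OF sS'] by simp
  interpret S: subgroup S M by (rule sS)
  interpret SM: fin_group "subgrp M S" by (rule M.subgroup_fin_group) (rule sS)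
  have ocS: "orbit_closed j S"
    unfolding S_def A_def
    by (rule orbit_closed_stabilizer[OF j(1) T oc \<nu>[unfolded A_def]]) (use \<nu>L in \<open>simp add: L_def\<close>)
  have \<nu>m: "\<nu> (a \<otimes>\<^bsub>M\<^esub> b) = \<nu> a * \<nu> b" if "a \<in> A" "b \<in> A" for a b
    using \<nu> that by (simp add: lin_hom_def)
  have AM: "subgroup A M" using M.incl_subgroup[OF T A.subgroup_axioms] .
  interpret AM: fin_group "subgrp M A" by (rule M.subgroup_fin_group) (rule AM)
  have AS: "A \<subseteq> S"
  proof
    fix a assume a: "a \<in> A"
    have "\<nu> (inv\<^bsub>subgrp M T\<^esub> a \<otimes>\<^bsub>M\<^esub> b \<otimes>\<^bsub>M\<^esub> a) = \<nu> b" if b: "b \<in> A" for b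
    proof -
      have "a \<in> T" using a AT by blast
      then have "inv\<^bsub>subgrp M T\<^esub> a = inv\<^bsub>subgrp M A\<^esub> a"
        using M.inv_subgrp[OF AM a] invT[of a] by simp
      then show ?thesis using AM.lin_hom_conj[OF \<nu>, of a b] a b by simp
    qed
    then show "a \<in> S" using a AT by (auto simp: S_def stabilizer_def)
  qed
  have SA: "act_kernel j \<inter> S = A" using AS ST by (auto simp: A_def)
  have nAS: "A \<lhd> subgrp M S"
    using TM.normal_restrict_supergroup[OF sS' nA AS] by simp
  have invS: "\<nu> (inv\<^bsub>subgrp M S\<^esub> s \<otimes>\<^bsub>M\<^esub> a \<otimes>\<^bsub>M\<^esub> s) = \<nu> a" if "s \<in> S" "a \<in> A" for s a
  proof -
    have "inv\<^bsub>subgrp M S\<^esub> s = inv\<^bsub>subgrp M T\<^esub> s" using M.inv_subgrp[OF sS that(1)] invT[of s] ST that by auto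
    then show ?thesis using that by (simp add: S_def stabilizer_def)
  qed
  obtain C where C: "subgroup C M" "C \<subseteq> T"
    "\<And>t. t \<in> T \<Longrightarrow> \<exists>a\<in>act_kernel j \<inter> T. \<exists>c\<in>C. t = a \<otimes>\<^bsub>M\<^esub> c"
    "C \<inter> act_kernel j \<subseteq> act_kernel (Suc j)"
    by (rule complement_exists[OF j(1) T oc]) blast
  \<comment> \<open>Since \<open>A \<subseteq> S\<close>, the \<open>C\<close>-part of an element of
    \<open>S\<close> lies in \<open>S\<close> again, so \<open>C \<inter> S\<close> complements
    \<open>A\<close> in \<open>S\<close> modulo \<open>L\<close>, on which \<open>\<nu>\<close> is
    trivial.\<close>
  obtain \<delta> where \<delta>: "lin_hom (subgrp M S) \<delta>" and \<delta>A: "\<And>a. a \<in> A \<Longrightarrow> \<delta> a = \<nu> a"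
  proof (rule SM.lin_hom_extend[where A=A and C="C \<inter> S" and \<nu>=\<nu>])
    show "A \<lhd> subgrp M S" by (rule nAS)
    have "subgroup (C \<inter> S) M" by (rule M.subgroups_Inter_pair[OF C(1) sS])
    then show "subgroup (C \<inter> S) (subgrp M S)" by (rule M.subgroup_incl[OF _ sS]) blast
    show "lin_hom (subgrp (subgrp M S) A) \<nu>" using \<nu> by simp
    show "\<exists>a\<in>A. \<exists>c\<in>C \<inter> S. g = a \<otimes>\<^bsub>subgrp M S\<^esub> c" if "g \<in> carrier (subgrp M S)" for g
    proof -
      have g: "g \<in> S" using that by simp
      then obtain a c where ac: "a \<in> A" "c \<in> C" "g = a \<otimes>\<^bsub>M\<^esub> c" using C(3)[of g] ST by (auto simp: A_def)
      have aS: "a \<in> S" and cM: "c \<in> carrier M" using ac AS subgroup.mem_carrier[OF C(1)] by auto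
      have "c = inv\<^bsub>M\<^esub> a \<otimes>\<^bsub>M\<^esub> g" using ac(3) aS cM by simp
      then have "c \<in> S" using aS g by simp
      then show ?thesis using ac by auto
    qed
    show "\<nu> (inv\<^bsub>subgrp M S\<^esub> g \<otimes>\<^bsub>subgrp M S\<^esub> a \<otimes>\<^bsub>subgrp M S\<^esub> g) = \<nu> a"
      if "g \<in> carrier (subgrp M S)" "a \<in> A" for g a
      using invS that by simp
    show "\<nu> c = 1" if "c \<in> A" "c \<in> C \<inter> S" for c
      by (rule \<nu>L) (use that C(4) in \<open>auto simp: L_def A_def\<close>)
  qed blast
  have \<delta>0: "\<delta> s \<noteq> 0" if "s \<in> S" for s using SM.lin_hom_inv(2)[OF \<delta>, of s] that by simp
  have \<delta>': "lin_hom (subgrp M S) (\<lambda>s. inverse (\<delta> s))" using \<delta> by (simp add: lin_hom_def)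
  \<comment> \<open>\<open>F\<close> lies over \<open>\<nu>\<close> on \<open>A\<close>. Dividing by
    the extension makes it invariant under \<open>A\<close>, which is
    \<open>act_kernel j \<inter> S\<close>, so the induction hypothesis applies at level
    \<open>j\<close>.\<close>
  define \<psi> where "\<psi> s = inverse (\<delta> s) * F s" for s
  have sph\<psi>: "spherical (subgrp M S) \<psi>"
    unfolding \<psi>_def by (rule SM.spherical_twist[OF sphF \<delta>'])
  have \<psi>A: "\<psi> (a \<otimes>\<^bsub>M\<^esub> t) = \<psi> t" if "a \<in> act_kernel j" "a \<in> S" "t \<in> S" for a t
  proof -
    have a: "a \<in> A" using that SA by blast
    have "\<delta> (a \<otimes>\<^bsub>M\<^esub> t) = \<nu> a * \<delta> t" using \<delta> that \<delta>A[OF a] by (simp add: lin_hom_def)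
    moreover have "\<nu> a \<noteq> 0" using \<delta>0[OF that(2)] \<delta>A[OF a] by simp
    moreover have "t \<in> T" using that(3) ST by blast
    ultimately show ?thesis unfolding \<psi>_def by (simp only: F_left[OF a]) simp
  qed
  obtain H \<mu> where H: "clifford_chain M S H \<mu>" "A \<subseteq> H" "\<forall>a\<in>A. \<mu> a = 1"
    and \<psi>: "\<forall>t\<in>S. \<psi> t = induced (subgrp M S) H \<mu> t"
    using Suc.IH[OF j(2) sS ocS sph\<psi> \<psi>A] SA by auto
  let ?\<mu> = "\<lambda>s. \<delta> s * \<mu> s"
  have cc: "clifford_chain M S H ?\<mu>" by (rule M.clifford_chain_twist[OF H(1) \<delta>])
  note ccD = M.clifford_chainD[OF cc]
  have \<mu>A: "?\<mu> a = \<nu> a" if "a \<in> A" for a using \<delta>A[OF that] H(3) that by simp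
  have F_ind: "F s = induced (subgrp M S) H ?\<mu> s" if "s \<in> S" for s
  proof -
    have "F s = \<delta> s * \<psi> s" using \<delta>0[OF that] by (simp add: \<psi>_def)
    then show ?thesis using SM.induced_twist[OF \<delta>, of s H \<mu>] \<psi> that by simp
  qed
  have \<chi>_ind: "\<chi> t = induced (subgrp M T) H ?\<mu> t" if t: "t \<in> T" for t
  proof -
    have "\<chi> t = induced (subgrp M T) S F t" using cl(2) t by simp
    also have "induced (subgrp M T) S F = induced (subgrp M T) S (induced (subgrp M S) H ?\<mu>)"
      by (rule TM.induced_cong) (rule F_ind)
    also have "\<dots> = induced (subgrp M T) S (induced (subgrp (subgrp M T) S) H ?\<mu>)" by simp
    also have "\<dots> = induced (subgrp M T) H ?\<mu>"
      using subgroup.one_closed[OF ccD(2)] by (intro TM.induced_trans[OF sS' ccD(3)]) blast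
    finally show ?thesis .
  qed
  have "clifford_chain M T H ?\<mu>"
  proof (rule clifford_chain.step[OF cc T nA H(2)])
    have "inv\<^bsub>subgrp M T\<^esub> t \<otimes>\<^bsub>M\<^esub> a \<otimes>\<^bsub>M\<^esub> t \<in> A" if "t \<in> T" "a \<in> A" for t a
      using A.inv_op_closed1[of t a] that by simp
    then show "S = stabilizer (subgrp M T) A ?\<mu>"
      using \<mu>A by (auto simp: S_def stabilizer_def)
    have "spherical (subgrp M T) \<chi> = spherical (subgrp M T) (induced (subgrp M T) H ?\<mu>)"
      using \<chi>_ind by (intro spherical_cong TM.is_group) simp
    then show "spherical (subgrp M T) (induced (subgrp M T) H ?\<mu>)" using \<chi> by simp
  qed
  moreover have "act_kernel (Suc j) \<inter> T \<subseteq> H" using LA H(2) unfolding L_def by blast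
  moreover have "\<forall>a\<in>act_kernel (Suc j) \<inter> T. ?\<mu> a = 1"
  proof
    fix a assume "a \<in> act_kernel (Suc j) \<inter> T"
    then have aL: "a \<in> L" unfolding L_def .
    then have "a \<in> A" using LA by blast
    then show "?\<mu> a = 1" using \<mu>A \<nu>L[OF aL] by simp
  qed
  ultimately show ?case using \<chi>_ind by (intro exI[of _ H] exI[of _ ?\<mu>]) blast
qed

end

section \<open>Embedding of solvable groups\<close>

lemma (in fin_group) clifford_chain_gen_strongly_monomial:
  assumes c: "clifford_chain G (carrier G) H \<mu>" and \<chi>: "\<chi> \<in> irr G"
    and ind: "\<And>g. g \<in> carrier G \<Longrightarrow> \<chi> g = induced G H \<mu> g"
  shows "gen_strongly_monomial_char G \<chi>"
proof -
  note cc = clifford_chainD[OF c]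
  interpret H: fin_group "subgrp G H" by (rule subgroup_fin_group) (rule cc)
  have oneH: "\<one> \<in> H" by (rule subgroup.one_closed[OF cc(2)])
  \<comment> \<open>Characters are compared as functions, so the values of \<open>\<mu>\<close>
    outside \<open>H\<close> are discarded; kernel and induced functions only see
    \<open>H\<close>.\<close>
  define \<psi> where "\<psi> = restrict \<mu> H"
  define D where "D = {h \<in> carrier (subgrp G H). \<mu> h = 1}"
  have \<mu>1: "\<mu> \<one> = 1" using cc(4) by (simp add: lin_hom_def)
  have lc: "linear_character (subgrp G H) \<psi>"
    using H.linear_character_lin_hom[OF cc(4)] by (simp add: \<psi>_def)
  have ker: "char_kernel (subgrp G H) \<psi> = D"
    using \<mu>1 oneH by (auto simp: char_kernel_def \<psi>_def D_def)
  have ind\<psi>: "induced (subgrp G B) H \<psi> = induced (subgrp G B) H \<mu>" if "subgroup B G" for B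
  proof -
    interpret B: fin_group "subgrp G B" by (rule subgroup_fin_group) (rule that)
    show ?thesis by (rule B.induced_cong) (simp add: \<psi>_def)
  qed
  have \<chi>\<psi>: "\<chi> = induced G H \<psi>"
  proof
    fix g
    have "\<chi> \<in> extensional (carrier G)" using \<chi> by (auto simp: irr_def)
    then show "\<chi> g = induced G H \<psi> g"
      using ind[of g] induced_cong[of H \<psi> \<mu>]
      by (cases "g \<in> carrier G") (auto simp: \<psi>_def extensional_def induced_def)
  qed
  obtain n C where C: "C 0 = H" "C n = carrier G" "\<forall>i\<le>n. subgroup (C i) G"
    and st: "\<forall>i<n. C i \<subseteq> C (Suc i) \<and>
        (let L = subgrp G (C (Suc i));
             e = e_rat (subgrp G (C i)) (induced (subgrp G (C i)) H \<mu>)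
         in C i \<lhd> subgrp G (ga_cen L e) \<and>
            (\<forall>g\<in>C (Suc i). \<forall>h\<in>C (Suc i).
               ga_conj L e g \<noteq> ga_conj L e h \<longrightarrow>
               ga_orthogonal L (ga_conj L e g) (ga_conj L e h)))"
    using clifford_chain_strong[OF c] by blast
  have ie: "induced (subgrp G (C i)) H \<psi> = induced (subgrp G (C i)) H \<mu>" if "i < n" for i
    using C(3) that by (intro ind\<psi>) simp
  have "strong_inductive_chain G H \<psi> n C \<longleftrightarrow> strong_inductive_chain G H \<mu> n C"
    unfolding strong_inductive_chain_def by (intro conj_cong refl all_cong1 imp_cong) (simp only: ie)
  then have "strong_inductive_chain G H \<psi> n C"
    using C st unfolding strong_inductive_chain_def by blast
  moreover have "shoda_pair G H D"
    unfolding shoda_pair_def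
  proof (intro conjI ballI impI)
    show "subgroup H G" by (rule cc)
    show "D \<lhd> subgrp G H" unfolding D_def by (rule H.lin_hom_kernel_normal[OF cc(4)])
    show "cyclic_group (subgrp G H Mod D)" unfolding D_def by (rule H.lin_hom_quotient_cyclic[OF cc(4)])
    fix g assume g: "g \<in> carrier G" and sub: "{inv h \<otimes> inv g \<otimes> h \<otimes> g |h. h \<in> H} \<inter> H \<subseteq> D"
    show "g \<in> H"
    proof (rule clifford_chain_shoda[OF c g])
      fix h assume "h \<in> H" "inv h \<otimes> inv g \<otimes> h \<otimes> g \<in> H"
      then have "inv h \<otimes> inv g \<otimes> h \<otimes> g \<in> D" using sub by blast
      then show "\<mu> (inv h \<otimes> inv g \<otimes> h \<otimes> g) = 1" unfolding D_def by blast
    qed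
  qed
  ultimately have "gen_strong_shoda_pair G H (char_kernel (subgrp G H) \<psi>)"
    unfolding gen_strong_shoda_pair_def ker using lc ker by blast
  then show ?thesis
    unfolding gen_strongly_monomial_char_def using \<chi> \<chi>\<psi> cc(2) lc by blast
qed

text \<open>Start at level \<open>k\<close> with \<open>T\<close> the whole group: any
  \<open>m\<close> agrees with itself, so it is orbit closed, and \<open>act_kernel k\<close> is
  trivial, so every irreducible character qualifies.\<close>

lemma (in triangular_action) gen_strongly_monomial: "gen_strongly_monomial_group M"
  unfolding gen_strongly_monomial_group_def
proof (intro conjI ballI)
  show "group M" by (rule M.is_group)
  show "finite (carrier M)" by (rule M.fin)
  fix \<chi> assume \<chi>: "\<chi> \<in> irr M"
  have sph: "spherical (subgrp M (carrier M)) \<chi>" using M.irr_spherical[OF \<chi>] by simp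
  have oc: "orbit_closed k (carrier M)"
    unfolding orbit_closed_def act_cong_def
  proof (intro ballI impI)
    fix m assume m: "m \<in> carrier M"
    show "\<exists>t\<in>carrier M. \<forall>x\<in>carrier G. cng k (act m x) (act t x)"
      using m by (intro bexI[of _ m]) simp_all
  qed
  have K: "\<chi> (a \<otimes>\<^bsub>M\<^esub> t) = \<chi> t" if "a \<in> act_kernel k" "t \<in> carrier M" for a t
    using that act_kernel_k by auto
  obtain H \<mu> where "clifford_chain M (carrier M) H \<mu>"
    "\<forall>t\<in>carrier M. \<chi> t = induced (subgrp M (carrier M)) H \<mu> t"
    using triangular_clifford_chain[OF order_refl M.subgroup_self oc sph] K by blast
  then show "gen_strongly_monomial_char M \<chi>"
    using \<chi> by (intro M.clifford_chain_gen_strongly_monomial) simp_all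
qed

lemma (in fin_group) derived_series_abelian:
  assumes "(derived G ^^ k) (carrier G) = {\<one>}"
  shows "abelian_series G (\<lambda>i. (derived G ^^ i) (carrier G)) k"
proof -
  let ?N = "\<lambda>i. (derived G ^^ i) (carrier G)"
  have nN: "?N i \<lhd> G" for i
    by (induction i) (simp_all add: normal_self derived_is_normal)
  have sN: "subgroup (?N i) G" for i by (rule normal_imp_subgroup[OF nN])
  have Suc: "?N (Suc i) \<subseteq> ?N i" for i
    using derived_incl[OF order_refl sN[of i]] by simp
  have comm: "inv (a \<otimes> b) \<otimes> (b \<otimes> a) \<in> ?N (Suc i)" if a: "a \<in> ?N i" and b: "b \<in> ?N i" for a b i
  proof -
    interpret N: subgroup "?N i" G by (rule sN)
    have ab: "a \<in> carrier G" "b \<in> carrier G" using a b N.mem_carrier by blast+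
    \<comment> \<open>A member of \<open>derived_set\<close> is a product
      \<open>h \<otimes> h' \<otimes> inv h \<otimes> inv h'\<close>; the required commutator is the
      one of \<open>inv b\<close> and \<open>inv a\<close>.\<close>
    have "inv b \<otimes> inv a \<otimes> inv (inv b) \<otimes> inv (inv a) \<in> derived_set G (?N i)"
      using N.m_inv_closed[OF a] N.m_inv_closed[OF b] by blast
    moreover have "inv b \<otimes> inv a \<otimes> inv (inv b) \<otimes> inv (inv a) = inv (a \<otimes> b) \<otimes> (b \<otimes> a)"
      using ab by (simp add: inv_mult_group m_assoc)
    ultimately show ?thesis by (simp add: derived_def generate.incl)
  qed
  show ?thesis
  proof (intro abelian_series.intro abelian_series_axioms.intro)
    show "fin_group G" by (rule fin_group_axioms)
    show "(derived G ^^ 0) (carrier G) = carrier G" by simp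
  qed (fact nN assms Suc comm)+
qed

context abelian_series
begin

definition tri_perms :: "('a \<Rightarrow> 'a) set" where
  "tri_perms = {\<pi> \<in> extensional (carrier G). triangular G N k \<pi>}"

lemma tri_permsD:
  assumes "\<pi> \<in> tri_perms"
  shows "triangular G N k \<pi>" "\<pi> \<in> extensional (carrier G)" "x \<in> carrier G \<Longrightarrow> \<pi> x \<in> carrier G"
    "\<pi> ` carrier G = carrier G"
  using assms by (auto simp: tri_perms_def triangular_def bij_betw_def)

lemma finite_tri_perms: "finite tri_perms"
proof (rule finite_subset)
  show "tri_perms \<subseteq> carrier G \<rightarrow>\<^sub>E carrier G"
    using tri_permsD by (auto simp: PiE_def)
  show "finite (carrier G \<rightarrow>\<^sub>E carrier G)" by (intro finite_PiE) simp_all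
qed

lemma triangular_cong:
  assumes "\<And>x. x \<in> carrier G \<Longrightarrow> \<pi> x = \<pi>' x"
  shows "triangular G N k \<pi> \<longleftrightarrow> triangular G N k \<pi>'"
proof -
  have "bij_betw \<pi> (carrier G) (carrier G) = bij_betw \<pi>' (carrier G) (carrier G)"
    by (rule bij_betw_cong) (rule assms)
  moreover have "\<pi> (x \<otimes> n) = \<pi>' (x \<otimes> n)" if "x \<in> carrier G" "n \<in> N i" for x n i
    using that N_carrier by (intro assms) auto
  ultimately show ?thesis using assms unfolding triangular_def by (simp cong: ball_cong)
qed

lemma tri_perms_compose:
  assumes \<pi>: "\<pi> \<in> tri_perms" and \<rho>: "\<rho> \<in> tri_perms"
  shows "compose (carrier G) \<pi> \<rho> \<in> tri_perms"
proof -
  note p = tri_permsD[OF \<pi>] and r = tri_permsD[OF \<rho>]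
  have "triangular G N k (\<lambda>x. \<pi> (\<rho> x))"
    unfolding triangular_def
  proof (intro conjI allI impI ballI)
    have "bij_betw (\<pi> \<circ> \<rho>) (carrier G) (carrier G)"
      using p(1) r(1) by (intro bij_betw_trans[of \<rho> _ "carrier G"]) (auto simp: triangular_def)
    then show "bij_betw (\<lambda>x. \<pi> (\<rho> x)) (carrier G) (carrier G)" by (simp add: comp_def)
    fix i x n assume i: "i < k" and x: "x \<in> carrier G" and n: "n \<in> N i"
    have nG: "n \<in> carrier G" using N_carrier n by blast
    have "cng (Suc i) (\<rho> (x \<otimes> n)) (\<rho> x \<otimes> n)" using r(1) i x n by (simp add: triangular_def)
    then have 1: "cng (Suc i) (\<pi> (\<rho> (x \<otimes> n))) (\<pi> (\<rho> x \<otimes> n))"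
      by (rule triangular_cng[OF p(1) Suc_leI[OF i]]) (use r(3) x nG in simp_all)
    have 2: "cng (Suc i) (\<pi> (\<rho> x \<otimes> n)) (\<pi> (\<rho> x) \<otimes> n)"
      using p(1) i r(3)[OF x] n by (simp add: triangular_def)
    show "cng (Suc i) (\<pi> (\<rho> (x \<otimes> n))) (\<pi> (\<rho> x) \<otimes> n)"
      by (rule cng_trans[OF 1 2]) (use p(3) r(3) x nG in simp_all)
  qed
  then have "triangular G N k (compose (carrier G) \<pi> \<rho>)"
    by (subst triangular_cong[where \<pi>'="\<lambda>x. \<pi> (\<rho> x)"]) (simp_all add: compose_def)
  then show ?thesis by (simp add: tri_perms_def compose_def)
qed

lemma left_mult_tri_perms:
  assumes g: "g \<in> carrier G" shows "(\<lambda>x\<in>carrier G. g \<otimes> x) \<in> tri_perms"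
proof -
  have "bij_betw (\<lambda>x. g \<otimes> x) (carrier G) (carrier G)"
    by (rule bij_betwI[where g="\<lambda>x. inv g \<otimes> x"]) (use g in auto)
  moreover have "g \<otimes> (x \<otimes> n) = g \<otimes> x \<otimes> n" "g \<otimes> x \<otimes> n \<in> carrier G" if "x \<in> carrier G" "n \<in> N i" for x n i
    using that g N_carrier[of n i] by (simp_all add: G.m_assoc)
  ultimately have "triangular G N k (\<lambda>x. g \<otimes> x)"
    by (simp add: triangular_def)
  then have "triangular G N k (\<lambda>x\<in>carrier G. g \<otimes> x)"
    by (subst triangular_cong[where \<pi>'="\<lambda>x. g \<otimes> x"]) simp_all
  then show ?thesis by (simp add: tri_perms_def)
qed

lemma id_tri_perms: "(\<lambda>x\<in>carrier G. x) \<in> tri_perms"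
proof -
  have "(\<lambda>x\<in>carrier G. \<one> \<otimes> x) = (\<lambda>x\<in>carrier G. x)" by (rule restrict_ext) simp
  then show ?thesis using left_mult_tri_perms[OF G.one_closed] by simp
qed

text \<open>Composition with \<open>\<pi>\<close> on the right is injective on a finite set, hence
  onto, and the identity is hit. No inverse permutation has to be checked for triangularity.\<close>

lemma tri_perms_left_inverse:
  assumes \<pi>: "\<pi> \<in> tri_perms"
  shows "\<exists>\<rho>\<in>tri_perms. compose (carrier G) \<rho> \<pi> = (\<lambda>x\<in>carrier G. x)"
proof -
  let ?c = "\<lambda>\<rho>. compose (carrier G) \<rho> \<pi>"
  have "inj_on ?c tri_perms"
  proof (rule inj_onI)
    fix \<rho> \<rho>' assume a: "\<rho> \<in> tri_perms" "\<rho>' \<in> tri_perms" "?c \<rho> = ?c \<rho>'"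
    show "\<rho> = \<rho>'"
    proof (rule extensionalityI[OF tri_permsD(2)[OF a(1)] tri_permsD(2)[OF a(2)]])
      fix y assume "y \<in> carrier G"
      then obtain x where x: "x \<in> carrier G" "y = \<pi> x" using tri_permsD(4)[OF \<pi>] by blast
      then show "\<rho> y = \<rho>' y" using fun_cong[OF a(3), of x] by (simp add: compose_def)
    qed
  qed
  moreover have "?c ` tri_perms \<subseteq> tri_perms" using tri_perms_compose[OF _ \<pi>] by auto
  ultimately have "?c ` tri_perms = tri_perms" using finite_tri_perms by (intro endo_inj_surj)
  then show ?thesis using id_tri_perms by (metis (no_types, lifting) imageE)
qed

lemma embeds_in_gen_strongly_monomial:
  "\<exists>(M :: nat monoid) S. gen_strongly_monomial_group M \<and> subgroup S M \<and> G \<cong> M\<lparr>carrier := S\<rparr>"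
proof -
  \<comment> \<open>The group of permutations is coded by natural numbers to fit the type of
    \<open>M\<close>; the decoding \<open>e\<close> becomes the action.\<close>
  obtain f :: "('a \<Rightarrow> 'a) \<Rightarrow> nat" where f: "inj_on f tri_perms"
    using finite_imp_inj_to_nat_seg[OF finite_tri_perms] by auto
  define e where "e = inv_into tri_perms f"
  have fe: "e (f \<pi>) = \<pi>" if "\<pi> \<in> tri_perms" for \<pi> using that f by (simp add: e_def)
  define M :: "nat monoid" where
    "M = \<lparr>partial_object.carrier = f ` tri_perms, monoid.mult = (\<lambda>x y. f (compose (carrier G) (e x) (e y))), monoid.one = f (\<lambda>x\<in>carrier G. x)\<rparr>"
  have M: "carrier M = f ` tri_perms" "\<one>\<^bsub>M\<^esub> = f (\<lambda>x\<in>carrier G. x)" by (simp_all add: M_def)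
  have Mm: "f \<pi> \<otimes>\<^bsub>M\<^esub> f \<rho> = f (compose (carrier G) \<pi> \<rho>)" if "\<pi> \<in> tri_perms" "\<rho> \<in> tri_perms" for \<pi> \<rho>
    using that by (simp add: M_def fe)
  have "group M"
  proof (rule groupI)
    show "\<one>\<^bsub>M\<^esub> \<in> carrier M" using id_tri_perms by (simp add: M)
    fix x assume "x \<in> carrier M"
    then obtain \<pi> where \<pi>: "\<pi> \<in> tri_perms" "x = f \<pi>" by (auto simp: M)
    have "compose (carrier G) (\<lambda>x\<in>carrier G. x) \<pi> = \<pi>"
      using tri_permsD[OF \<pi>(1)] by (intro Id_compose) auto
    then show "\<one>\<^bsub>M\<^esub> \<otimes>\<^bsub>M\<^esub> x = x" using \<pi> id_tri_perms by (simp add: M(2) Mm)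
    obtain \<rho>' where \<rho>': "\<rho>' \<in> tri_perms" "compose (carrier G) \<rho>' \<pi> = (\<lambda>x\<in>carrier G. x)"
      using tri_perms_left_inverse[OF \<pi>(1)] by blast
    then have "f \<rho>' \<otimes>\<^bsub>M\<^esub> x = \<one>\<^bsub>M\<^esub>" using \<pi> by (simp only: Mm M(2))
    then show "\<exists>y\<in>carrier M. y \<otimes>\<^bsub>M\<^esub> x = \<one>\<^bsub>M\<^esub>" using \<rho>'(1) by (auto simp only: M(1))
    fix y assume "y \<in> carrier M"
    then obtain \<rho> where \<rho>: "\<rho> \<in> tri_perms" "y = f \<rho>" by (auto simp: M)
    show "x \<otimes>\<^bsub>M\<^esub> y \<in> carrier M" using \<pi> \<rho> tri_perms_compose by (simp add: Mm M(1))
    fix z assume "z \<in> carrier M"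
    then obtain \<sigma> where \<sigma>: "\<sigma> \<in> tri_perms" "z = f \<sigma>" by (auto simp: M)
    have "\<sigma> \<in> carrier G \<rightarrow> carrier G" using tri_permsD(3)[OF \<sigma>(1)] by blast
    then show "x \<otimes>\<^bsub>M\<^esub> y \<otimes>\<^bsub>M\<^esub> z = x \<otimes>\<^bsub>M\<^esub> (y \<otimes>\<^bsub>M\<^esub> z)"
      using \<pi> \<rho> \<sigma> by (simp add: Mm tri_perms_compose compose_assoc)
  qed
  then interpret M: group M .
  interpret M: fin_group M by unfold_locales (simp add: M finite_tri_perms)
  interpret triangular_action G N k M e
  proof unfold_locales
    show "triangular G N k (e m)" if "m \<in> carrier M" for m
      using that fe tri_permsD(1) by (auto simp: M)
    show "e (m \<otimes>\<^bsub>M\<^esub> m') x = e m (e m' x)"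
      if "m \<in> carrier M" "m' \<in> carrier M" "x \<in> carrier G" for m m' x
      using that by (auto simp: M(1) Mm fe tri_perms_compose compose_eq)
    show "m = m'" if m: "m \<in> carrier M" "m' \<in> carrier M"
      and eq: "\<And>x. x \<in> carrier G \<Longrightarrow> e m x = e m' x" for m m'
    proof -
      obtain \<pi> \<rho> where p: "\<pi> \<in> tri_perms" "m = f \<pi>" "\<rho> \<in> tri_perms" "m' = f \<rho>"
        using m by (auto simp: M)
      have "\<pi> = \<rho>"
        by (rule extensionalityI[OF tri_permsD(2)[OF p(1)] tri_permsD(2)[OF p(3)]])
           (use eq p fe in simp)
      then show ?thesis using p by simp
    qed
    show "\<exists>m\<in>carrier M. \<forall>x\<in>carrier G. e m x = \<pi> x" if \<pi>: "triangular G N k \<pi>" for \<pi>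
    proof -
      have "triangular G N k (restrict \<pi> (carrier G))"
        using \<pi> by (subst triangular_cong[where \<pi>'=\<pi>]) simp_all
      then have "restrict \<pi> (carrier G) \<in> tri_perms" by (simp add: tri_perms_def)
      then show ?thesis unfolding M by (intro bexI[of _ "f (restrict \<pi> (carrier G))"]) (simp_all add: fe)
    qed
  qed
  define \<phi> where "\<phi> g = f (\<lambda>x\<in>carrier G. g \<otimes> x)" for g
  have hom: "\<phi> \<in> hom G M"
  proof (rule homI)
    fix g h assume gh: "g \<in> carrier G" "h \<in> carrier G"
    show "\<phi> g \<in> carrier M" using left_mult_tri_perms[OF gh(1)] by (simp add: \<phi>_def M)
    have "compose (carrier G) (\<lambda>x\<in>carrier G. g \<otimes> x) (\<lambda>x\<in>carrier G. h \<otimes> x) = (\<lambda>x\<in>carrier G. g \<otimes> h \<otimes> x)"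
      unfolding compose_def using gh by (intro restrict_ext) (simp add: G.m_assoc)
    then show "\<phi> (g \<otimes> h) = \<phi> g \<otimes>\<^bsub>M\<^esub> \<phi> h"
      using left_mult_tri_perms[OF gh(1)] left_mult_tri_perms[OF gh(2)] by (simp add: \<phi>_def Mm)
  qed
  have inj: "inj_on \<phi> (carrier G)"
  proof (rule inj_onI)
    fix g h assume gh: "g \<in> carrier G" "h \<in> carrier G" "\<phi> g = \<phi> h"
    then have "(\<lambda>x\<in>carrier G. g \<otimes> x) = (\<lambda>x\<in>carrier G. h \<otimes> x)"
      using f left_mult_tri_perms unfolding \<phi>_def by (blast dest: inj_onD)
    from fun_cong[OF this, of \<one>] show "g = h" using gh by simp
  qed
  interpret \<phi>: group_hom G M \<phi> by unfold_locales (rule hom)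
  have "\<phi> \<in> iso G (M\<lparr>carrier := \<phi> ` carrier G\<rparr>)"
    using hom inj by (auto simp: iso_def hom_def bij_betw_def)
  then have "G \<cong> M\<lparr>carrier := \<phi> ` carrier G\<rparr>" by (rule is_isoI)
  then show ?thesis using gen_strongly_monomial \<phi>.img_is_subgroup by blast
qed

end

theorem theorem1:
  fixes G :: "('a, 'b) monoid_scheme"
  assumes "group G" and "finite (carrier G)" and "solvable G"
  shows "\<exists>(M :: nat monoid) S.
           gen_strongly_monomial_group M \<and> subgroup S M \<and> G \<cong> M\<lparr>carrier := S\<rparr>"
proof -
  interpret fin_group G using assms by (simp add: fin_group_def fin_group_axioms_def)
  obtain k where "(derived G ^^ k) (carrier G) = {\<one>\<^bsub>G\<^esub>}"
    using assms(3) solvable_iff_trivial_derived_seq by blast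
  then interpret abelian_series G "\<lambda>i. (derived G ^^ i) (carrier G)" k
    by (rule derived_series_abelian)
  show ?thesis by (rule embeds_in_gen_strongly_monomial)
qed

end
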